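(* Let $\gamma>0$ be irrational, let $b>0$, and let $V(x)=x^\gamma W(x)$ and the compact energy interval $K\subset(0,\infty)$ satisfy the assumptions listed in the context. Consider the Dirichlet eigenvalue problem $$-h^2u''+Vu=Eu\ \text{ on }[0,b],\qquad u(0)=u(b)=0 .$$ Then there exist functions $\Theta_h:K\to\mathbb{R}$, admitting as $h\to0^+$ an asymptotic expansion $$\Theta_h(E)\sim\sum_{m,n\ge0,\ (m,n)\ne(0,0)}h^{m\gamma+n}\,\theta_{m,n}(E),$$ such that, for all sufficiently small $h>0$, $E\in K$ is an eigenvalue of this Dirichlet problem if and only if there exists $k\in\mathbb{Z}$ with $$\frac1h\int_0^b\sqrt{E-V(y)}\,dy+\Theta_h(E)=k\pi .$$
   Context: Assumptions on $V$: $V$ is continuous on $[0,b]$, smooth and increasing on $(0,b]$, $V(0)=0$, and $V(x)=x^\gamma W(x)$ for $x>0$ with $W$ smooth and $W>0$ on $[0,b]$. $K\subset(0,\infty)$ is a compact interval, and there is $\delta_0>0$ with $E-V(x)\ge\delta_0$ for all $E\in K$, $x\in[0,b]$. The asymptotic expansion means: for every $N\ge0$ there are $C_N$ and $h_N>0$ such that $\big|\Theta_h(E)-\sum_{(m,n)\neq(0,0),\,m\gamma+n<N}h^{m\gamma+n}\theta_{m,n}(E)\big|\le C_Nh^N$ for all $E\in K$ and $0<h<h_N$. *)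

theory Defs
  imports "HOL-Analysis.Analysis"
begin

text \<open>
  Smoothness on a set, with derivatives taken within the set: on \<open>{0..b}\<close> these are one-sided at
  the end points (so all of them extend continuously to the boundary), on \<open>{0<..b}\<close> only the
  right end point is affected.  \<open>D n\<close> is the \<open>n\<close>-th derivative.
\<close>
definition smooth_on :: "real set \<Rightarrow> (real \<Rightarrow> real) \<Rightarrow> bool" where
  "smooth_on S f \<longleftrightarrow>
     (\<exists>D :: nat \<Rightarrow> real \<Rightarrow> real. (\<forall>x\<in>S. D 0 x = f x) \<and>
        (\<forall>n. \<forall>x\<in>S. (D n has_real_derivative D (Suc n) x) (at x within S)))"

text \<open>
  Classical solutions; since the potential is continuous on \<open>{0..b}\<close> and real, these give the same
  spectrum as weak or complex-valued solutions.
\<close>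
definition dirichlet_eigenvalue :: "(real \<Rightarrow> real) \<Rightarrow> real \<Rightarrow> real \<Rightarrow> real \<Rightarrow> bool" where
  "dirichlet_eigenvalue V b h E \<longleftrightarrow>
     (\<exists>u u' u'' :: real \<Rightarrow> real.
        (\<forall>x\<in>{0..b}. (u has_real_derivative u' x) (at x within {0..b})) \<and>
        (\<forall>x\<in>{0..b}. (u' has_real_derivative u'' x) (at x within {0..b})) \<and>
        (\<forall>x\<in>{0..b}. - h\<^sup>2 * u'' x + V x * u x = E * u x) \<and>
        u 0 = 0 \<and> u b = 0 \<and> (\<exists>x\<in>{0..b}. u x \<noteq> 0))"

definition expansion_indices :: "real \<Rightarrow> real \<Rightarrow> (nat \<times> nat) set" where
  "expansion_indices \<gamma> N = {(m, n). (m, n) \<noteq> (0, 0) \<and> real m * \<gamma> + real n < N}"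

lemma finite_expansion_indices:
  assumes "\<gamma> > 0"
  shows "finite (expansion_indices \<gamma> N)"
proof (rule finite_subset)
  show "expansion_indices \<gamma> N \<subseteq> {..nat \<lceil>N / \<gamma>\<rceil>} \<times> {..nat \<lceil>N\<rceil>}"
  proof (clarsimp simp: expansion_indices_def)
    fix m n :: nat
    assume less: "real m * \<gamma> + real n < N"
    have "0 \<le> real m * \<gamma>" using assms by simp
    then have "real n \<le> N" and "real m * \<gamma> \<le> N" using less by linarith+
    then have "real n \<le> N" and "real m \<le> N / \<gamma>" using assms by (simp_all add: pos_le_divide_eq)
    then show "m \<le> nat \<lceil>N / \<gamma>\<rceil> \<and> n \<le> nat \<lceil>N\<rceil>" by linarith
  qed
qed simp

definition has_expansion ::
    "real \<Rightarrow> real set \<Rightarrow> (real \<Rightarrow> real \<Rightarrow> real) \<Rightarrow> (nat \<Rightarrow> nat \<Rightarrow> real \<Rightarrow> real) \<Rightarrow> bool" where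
  "has_expansion \<gamma> K \<Theta> \<theta> \<longleftrightarrow>
     (\<forall>N\<ge>0. \<exists>C. \<exists>h\<^sub>N>0. \<forall>E\<in>K. \<forall>h. 0 < h \<and> h < h\<^sub>N \<longrightarrow>
        \<bar>\<Theta> h E - (\<Sum>(m, n)\<in>expansion_indices \<gamma> N. h powr (real m * \<gamma> + real n) * \<theta> m n E)\<bar>
          \<le> C * h powr N)"

end

theory Submission
  imports Defs "HOL-Complex_Analysis.Complex_Analysis"
begin

text \<open>Write the solution with \<open>u(0) = 0\<close> near \<open>0\<close> in the variable \<open>t = sqrt E * x / h\<close>, in which the
  potential is a small perturbation; the Picard iterates of its complex amplitude are sums of
  powers of \<open>h\<close> times universal functions of \<open>t\<close> with expansions in
  \<open>t powr (m * \<gamma> + n) * cis (2 * l * t)\<close> at infinity. Irrationality of \<open>\<gamma>\<close> excludes the exponent \<open>-1\<close> and hence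
  logarithms. Away from \<open>0\<close>, the Wronskian of \<open>u\<close> with a WKB solution of high order is constant up to
  a high power of \<open>h / x\<close>. Its value at the right end point decides whether \<open>u(b) = 0\<close>, and its
  argument is the phase of the quantization condition. Evaluating it instead at a matching point
  \<open>x = pi * h * n / sqrt E\<close>, with \<open>n\<close> between two negative powers of \<open>h\<close>, yields an expansion in
  \<open>h powr (m * \<gamma> + k) * n powr \<alpha>\<close>. No cancellation has to be verified by hand: since the Wronskian
  does not depend on \<open>n\<close>, averaging over \<open>n, 2 * n, 4 * n, \<dots>\<close> with suitable weights removes all
  terms with \<open>\<alpha> \<noteq> 0\<close>.\<close>

section \<open>Asymptotic expansions in spans of model functions\<close>

text \<open>The obstacle is that neither description of the solution reaches both end points. The
  \<open>n\<close>-th WKB coefficient may be as singular as \<open>1 / x ^ n\<close>, so the WKB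
  parameter is \<open>h / x\<close> and the method fails for \<open>x\<close> of size
  \<open>h\<close>; the Picard description is an expansion in powers of \<open>h\<close> only while
  \<open>x\<close> stays close to 0. A window in which both hold is therefore indispensable.
  Irrationality of \<open>\<gamma>\<close> is needed in two further places: for the primitives of
  the WKB terms as \<open>x\<close> tends to 0, where the exponent -1 has to be excluded once more,
  and for the uniqueness of coefficients, because the exponents \<open>m * \<gamma> + n\<close> are
  then pairwise distinct. Uniqueness is what glues the approximants of different orders into one
  series. Monotonicity of \<open>V\<close> supplies a bound on the exact solution that is uniform in
  \<open>h\<close> on the whole interval; without such a bound the error of the Wronskian could not
  be controlled. With the right normalization the Wronskian tends to 1, uniformly in the energy. Its
  principal logarithm is then harmless, and the phase has no term of index
  \<open>(0, 0)\<close>.\<close>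

text \<open>\<open>bigo_on P r F\<close> reads \<open>F h p = O(h powr r)\<close> as \<open>h\<close> tends to \<open>0\<close> from the right, uniformly in
  \<open>p \<in> P h\<close>; \<open>approx B P F\<close> says that \<open>F\<close> lies in the linear span of \<open>B\<close> up to
  \<open>O(h powr N)\<close> for every \<open>N\<close>, the approximant being allowed to depend on \<open>N\<close>.\<close>
definition bigo_on :: "(real \<Rightarrow> 'a set) \<Rightarrow> real \<Rightarrow> (real \<Rightarrow> 'a \<Rightarrow> complex) \<Rightarrow> bool" where
  "bigo_on P r F \<longleftrightarrow> (\<exists>C. \<forall>\<^sub>F h in at_right 0. \<forall>p\<in>P h. norm (F h p) \<le> C * h powr r)"

text \<open>No coefficients are attached to the summands, because the sets \<open>B\<close> used
  below are themselves closed under scalar multiples. Properties of spans then follow by induction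
  on the number of terms, without choosing finite families.\<close>

inductive_set lin :: "(real \<Rightarrow> 'a \<Rightarrow> complex) set \<Rightarrow> (real \<Rightarrow> 'a \<Rightarrow> complex) set"
  for B where
  lin_zero: "(\<lambda>h p. 0) \<in> lin B"
| lin_plus: "f \<in> B \<Longrightarrow> g \<in> lin B \<Longrightarrow> (\<lambda>h p. f h p + g h p) \<in> lin B"

definition approx ::
    "(real \<Rightarrow> 'a \<Rightarrow> complex) set \<Rightarrow> (real \<Rightarrow> 'a set) \<Rightarrow> (real \<Rightarrow> 'a \<Rightarrow> complex) \<Rightarrow> bool" where
  "approx B P F \<longleftrightarrow> (\<forall>N. \<exists>g\<in>lin B. bigo_on P N (\<lambda>h p. F h p - g h p))"

text \<open>These conditions make the span an algebra. The growth condition allows negative orders: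
  multiplying an error by a growing function costs a fixed power of \<open>h\<close>, which a better
  approximant pays for. The unit is 1 only eventually, since \<open>0 powr 0\<close> is 0.\<close>

definition gauge_basis :: "(real \<Rightarrow> 'a \<Rightarrow> complex) set \<Rightarrow> (real \<Rightarrow> 'a set) \<Rightarrow> bool" where
  "gauge_basis B P \<longleftrightarrow> (\<exists>e\<in>B. \<forall>\<^sub>F h in at_right 0. \<forall>p\<in>P h. e h p = 1) \<and> (\<forall>f\<in>B. \<exists>r. bigo_on P r f) \<and>
     (\<forall>c. \<forall>f\<in>B. (\<lambda>h p. c * f h p) \<in> B) \<and> (\<forall>f\<in>B. \<forall>g\<in>B. (\<lambda>h p. f h p * g h p) \<in> B)"

lemma eventually_at_right_0I:
  fixes c :: real
  assumes "c > 0" and "\<And>h. 0 < h \<Longrightarrow> h < c \<Longrightarrow> Q h"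
  shows "eventually Q (at_right 0)"
  unfolding eventually_at_right_field using assms by blast

lemma eventually_small: "c > 0 \<Longrightarrow> \<forall>\<^sub>F h in at_right (0::real). 0 < h \<and> h < c"
  by (rule eventually_at_right_0I) auto

lemma eventually_powr_le:
  fixes r c :: real
  assumes "r > 0" "c > 0"
  shows "\<forall>\<^sub>F h in at_right 0. h powr r \<le> c"
proof (rule eventually_at_right_0I[of "c powr (1/r)"])
  fix h :: real assume h: "0 < h" "h < c powr (1/r)"
  have "h powr r \<le> (c powr (1/r)) powr r" using h assms by (intro powr_mono2) auto
  also have "\<dots> = c" using assms by (simp add: powr_powr)
  finally show "h powr r \<le> c" .
qed (use assms in auto)

lemma bigo_onE:
  assumes "bigo_on P r F"
  obtains C where "C \<ge> 0" "\<forall>\<^sub>F h in at_right 0. \<forall>p\<in>P h. norm (F h p) \<le> C * h powr r"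
proof -
  obtain C where C: "\<forall>\<^sub>F h in at_right 0. \<forall>p\<in>P h. norm (F h p) \<le> C * h powr r"
    using assms by (auto simp: bigo_on_def)
  have "\<forall>\<^sub>F h in at_right 0. \<forall>p\<in>P h. norm (F h p) \<le> max C 0 * h powr r"
    using C by eventually_elim (meson max.cobounded1 mult_right_mono order_trans powr_ge_zero)
  then show ?thesis using that[of "max C 0"] by simp
qed

lemma bigo_onI:
  "\<forall>\<^sub>F h in at_right 0. \<forall>p\<in>P h. norm (F h p) \<le> C * h powr r \<Longrightarrow> bigo_on P r F"
  by (auto simp: bigo_on_def)

lemma bigo_on_cong:
  assumes "bigo_on P r F" "\<forall>\<^sub>F h in at_right 0. \<forall>p\<in>P h. F h p = G h p"
  shows "bigo_on P r G"
proof -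
  obtain C where C: "\<forall>\<^sub>F h in at_right 0. \<forall>p\<in>P h. norm (F h p) \<le> C * h powr r"
    using assms by (auto simp: bigo_on_def)
  show ?thesis by (rule bigo_onI[of _ _ C], use C assms(2) in eventually_elim) auto
qed

lemma bigo_on_mono:
  assumes "bigo_on P r F" "s \<le> r"
  shows "bigo_on P s F"
proof -
  obtain C where C: "C \<ge> 0" "\<forall>\<^sub>F h in at_right 0. \<forall>p\<in>P h. norm (F h p) \<le> C * h powr r"
    using assms(1) by (rule bigo_onE)
  show ?thesis
  proof (rule bigo_onI[of _ _ C], use C(2) eventually_small[of 1, OF zero_less_one] in eventually_elim)
    case (elim h)
    have "h powr r \<le> h powr s" using elim assms(2) by (intro powr_mono') auto
    then have "C * h powr r \<le> C * h powr s" using C(1) by (rule mult_left_mono)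
    then show ?case using elim by fastforce
  qed
qed

lemma bigo_on_le:
  assumes "bigo_on P r F" "\<forall>\<^sub>F h in at_right 0. \<forall>p\<in>P h. norm (G h p) \<le> norm (F h p)"
  shows "bigo_on P r G"
proof -
  obtain C where C: "\<forall>\<^sub>F h in at_right 0. \<forall>p\<in>P h. norm (F h p) \<le> C * h powr r"
    using assms by (auto simp: bigo_on_def)
  show ?thesis by (rule bigo_onI[of _ _ C], use C assms(2) in eventually_elim) force
qed

lemma bigo_on_zero: "bigo_on P r (\<lambda>h p. 0)"
  by (rule bigo_onI[of _ _ 0]) auto

lemma bigo_on_add:
  assumes "bigo_on P r F" "bigo_on P r G"
  shows "bigo_on P r (\<lambda>h p. F h p + G h p)"
proof -
  obtain C where C: "\<forall>\<^sub>F h in at_right 0. \<forall>p\<in>P h. norm (F h p) \<le> C * h powr r"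
    using assms by (auto simp: bigo_on_def)
  obtain D where D: "\<forall>\<^sub>F h in at_right 0. \<forall>p\<in>P h. norm (G h p) \<le> D * h powr r"
    using assms by (auto simp: bigo_on_def)
  show ?thesis
    by (rule bigo_onI[of _ _ "C + D"], use C D in eventually_elim)
      (auto simp: distrib_right intro!: norm_triangle_le add_mono)
qed

lemma bigo_on_mult:
  assumes "bigo_on P r F" "bigo_on P s G"
  shows "bigo_on P (r + s) (\<lambda>h p. F h p * G h p)"
proof -
  obtain C where C: "C \<ge> 0" "\<forall>\<^sub>F h in at_right 0. \<forall>p\<in>P h. norm (F h p) \<le> C * h powr r"
    using assms(1) by (rule bigo_onE)
  obtain D where D: "\<forall>\<^sub>F h in at_right 0. \<forall>p\<in>P h. norm (G h p) \<le> D * h powr s"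
    using assms by (auto simp: bigo_on_def)
  show ?thesis
  proof (rule bigo_onI[of _ _ "C * D"], use C(2) D in eventually_elim)
    case (elim h)
    show ?case
    proof
      fix p assume "p \<in> P h"
      then have "norm (F h p) * norm (G h p) \<le> (C * h powr r) * (D * h powr s)"
        using elim C(1) by (intro mult_mono) auto
      then show "norm (F h p * G h p) \<le> C * D * h powr (r + s)"
        by (simp add: norm_mult powr_add mult_ac)
    qed
  qed
qed

lemma bigo_on_const: "bigo_on P 0 (\<lambda>h p. c)"
  by (rule bigo_onI[of _ _ "norm c"], rule eventually_at_right_0I[of 1]) auto

lemma bigo_on_cmult: "bigo_on P r F \<Longrightarrow> bigo_on P r (\<lambda>h p. c * F h p)"
  using bigo_on_mult[OF bigo_on_const] by fastforce

lemma bigo_on_minus: "bigo_on P r F \<Longrightarrow> bigo_on P r (\<lambda>h p. - F h p)"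
  using bigo_on_cmult[of P r F "-1"] by simp

lemma bigo_on_diff: "bigo_on P r F \<Longrightarrow> bigo_on P r G \<Longrightarrow> bigo_on P r (\<lambda>h p. F h p - G h p)"
  using bigo_on_add[OF _ bigo_on_minus, of P r F G] by simp

lemma bigo_on_sum:
  "finite I \<Longrightarrow> (\<And>i. i \<in> I \<Longrightarrow> bigo_on P r (F i)) \<Longrightarrow> bigo_on P r (\<lambda>h p. \<Sum>i\<in>I. F i h p)"
  by (induction I rule: finite_induct) (auto intro: bigo_on_zero bigo_on_add)

lemma bigo_on_power:
  assumes "bigo_on P r F"
  shows "bigo_on P (r * real n) (\<lambda>h p. F h p ^ n)"
proof (induction n)
  case 0 then show ?case using bigo_on_const[of P 1] by simp
next
  case (Suc n) then show ?case using bigo_on_mult[OF assms Suc] by (simp add: algebra_simps)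
qed

lemma bigo_on_mult_one:
  assumes "bigo_on P r (\<lambda>h p. F h p - 1)" "bigo_on P r (\<lambda>h p. G h p - 1)" "r \<ge> 0"
  shows "bigo_on P r (\<lambda>h p. F h p * G h p - 1)"
proof -
  have "bigo_on P r (\<lambda>h p. (F h p - 1) * (G h p - 1))"
    using bigo_on_mono[OF bigo_on_mult[OF assms(1,2)], of r] assms(3) by simp
  from bigo_on_add[OF this bigo_on_add[OF assms(1,2)]] show ?thesis
    by (simp add: algebra_simps)
qed

lemma bigo_on_small:
  assumes "bigo_on P r F" "r > 0" "c > 0"
  shows "\<forall>\<^sub>F h in at_right 0. \<forall>p\<in>P h. norm (F h p) \<le> c"
proof -
  obtain C where C: "C \<ge> 0" "\<forall>\<^sub>F h in at_right 0. \<forall>p\<in>P h. norm (F h p) \<le> C * h powr r"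
    using assms(1) by (rule bigo_onE)
  have "\<forall>\<^sub>F h in at_right 0. h powr r \<le> c / (C + 1)"
    using C(1) assms by (intro eventually_powr_le) auto
  with C(2) show ?thesis
  proof eventually_elim
    case (elim h)
    have "C * h powr r \<le> C * (c / (C+1))" using elim C by (intro mult_left_mono) auto
    also have "\<dots> \<le> c" using C assms by (simp add: field_simps)
    finally show ?case using elim by fastforce
  qed
qed

lemma lin_add: "f \<in> lin B \<Longrightarrow> g \<in> lin B \<Longrightarrow> (\<lambda>h p. f h p + g h p) \<in> lin B"
  by (induction f rule: lin.induct) (auto simp: add.assoc intro: lin.intros)

lemma lin_base: "f \<in> B \<Longrightarrow> f \<in> lin B"
  using lin_plus[OF _ lin_zero, of f B] by simp

lemma lin_mult:
  assumes "gauge_basis B P" "f \<in> lin B" "g \<in> lin B"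
  shows "(\<lambda>h p. f h p * g h p) \<in> lin B"
  using assms(2)
proof (induction f rule: lin.induct)
  case lin_zero then show ?case by (simp add: lin.lin_zero)
next
  case (lin_plus f1 f2)
  have "(\<lambda>h p. f1 h p * g h p) \<in> lin B" using assms(3)
  proof (induction g rule: lin.induct)
    case lin_zero then show ?case by (simp add: lin.lin_zero)
  next
    case (lin_plus g1 g2)
    have "(\<lambda>h p. f1 h p * g1 h p) \<in> B"
      using \<open>f1 \<in> B\<close> lin_plus(1) assms(1) by (auto simp: gauge_basis_def)
    from lin.lin_plus[OF this lin_plus.IH] show ?case by (simp add: distrib_left)
  qed
  from lin_add[OF this lin_plus.IH] show ?case by (simp add: distrib_right)
qed

lemma lin_moderate:
  assumes "gauge_basis B P" "f \<in> lin B"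
  shows "\<exists>r. bigo_on P r f"
  using assms(2)
proof (induction f rule: lin.induct)
  case lin_zero then show ?case using bigo_on_zero by blast
next
  case (lin_plus f g)
  obtain r where "bigo_on P r f" using lin_plus assms(1) by (auto simp: gauge_basis_def)
  moreover obtain s where "bigo_on P s g" using lin_plus by blast
  ultimately have "bigo_on P (min r s) (\<lambda>h p. f h p + g h p)"
    by (intro bigo_on_add) (auto elim: bigo_on_mono)
  then show ?case by blast
qed

lemma approx_moderate:
  assumes "gauge_basis B P" "approx B P F"
  shows "\<exists>r. bigo_on P r F"
proof -
  obtain g where g: "g \<in> lin B" "bigo_on P 0 (\<lambda>h p. F h p - g h p)"
    using assms(2) by (auto simp: approx_def)
  obtain r where "bigo_on P r g" using lin_moderate[OF assms(1) g(1)] by blast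
  with g(2) have "bigo_on P (min 0 r) (\<lambda>h p. (F h p - g h p) + g h p)"
    by (intro bigo_on_add) (auto elim: bigo_on_mono)
  then show ?thesis by auto
qed

lemma approx_lin: "f \<in> lin B \<Longrightarrow> approx B P f"
  unfolding approx_def using bigo_on_zero by (intro allI bexI[of _ f]) auto

lemma approx_base: "f \<in> B \<Longrightarrow> approx B P f"
  by (rule approx_lin, rule lin_base)

lemma approx_zero: "approx B P (\<lambda>h p. 0)"
  by (rule approx_lin, rule lin_zero)

lemma approx_add:
  assumes "approx B P F" "approx B P G"
  shows "approx B P (\<lambda>h p. F h p + G h p)"
  unfolding approx_def
proof
  fix N
  obtain f where f: "f \<in> lin B" "bigo_on P N (\<lambda>h p. F h p - f h p)"
    using assms(1) by (auto simp: approx_def)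
  obtain g where g: "g \<in> lin B" "bigo_on P N (\<lambda>h p. G h p - g h p)"
    using assms(2) by (auto simp: approx_def)
  show "\<exists>g\<in>lin B. bigo_on P N (\<lambda>h p. F h p + G h p - g h p)"
    using lin_add[OF f(1) g(1)] bigo_on_add[OF f(2) g(2)] 
    by (intro bexI[of _ "\<lambda>h p. f h p + g h p"]) (auto simp: algebra_simps)
qed

lemma approx_limit:
  assumes "\<And>N. \<exists>G. approx B P G \<and> bigo_on P N (\<lambda>h p. F h p - G h p)"
  shows "approx B P F"
  unfolding approx_def
proof
  fix N
  obtain G where G: "approx B P G" "bigo_on P N (\<lambda>h p. F h p - G h p)" using assms by blast
  obtain g where g: "g \<in> lin B" "bigo_on P N (\<lambda>h p. G h p - g h p)"
    using G(1) by (auto simp: approx_def)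
  show "\<exists>g\<in>lin B. bigo_on P N (\<lambda>h p. F h p - g h p)"
    using bigo_on_add[OF G(2) g(2)] g(1) by auto
qed

lemma approx_cong:
  assumes "approx B P F" "\<forall>\<^sub>F h in at_right 0. \<forall>p\<in>P h. F h p = G h p"
  shows "approx B P G"
proof (rule approx_limit)
  fix N
  have "bigo_on P N (\<lambda>h p. G h p - F h p)"
    by (rule bigo_on_cong[OF bigo_on_zero], use assms(2) in eventually_elim) auto
  then show "\<exists>F. approx B P F \<and> bigo_on P N (\<lambda>h p. G h p - F h p)" using assms(1) by blast
qed

lemma approx_mult:
  assumes B: "gauge_basis B P" and F: "approx B P F" and G: "approx B P G"
  shows "approx B P (\<lambda>h p. F h p * G h p)"
  unfolding approx_def
proof
  fix N
  obtain s where s: "bigo_on P s G" using approx_moderate[OF B G] by blast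
  obtain f where f: "f \<in> lin B" "bigo_on P (N - s) (\<lambda>h p. F h p - f h p)"
    using F by (auto simp: approx_def)
  \<comment> \<open>The order of \<open>f\<close> depends on the approximant chosen, so the
    precision of \<open>g\<close> can only be fixed after it.\<close>
  obtain r where r: "bigo_on P r f" using lin_moderate[OF B f(1)] by blast
  obtain g where g: "g \<in> lin B" "bigo_on P (N - r) (\<lambda>h p. G h p - g h p)"
    using G by (auto simp: approx_def)
  have "bigo_on P N (\<lambda>h p. (F h p - f h p) * G h p + f h p * (G h p - g h p))"
    using bigo_on_mult[OF f(2) s] bigo_on_mult[OF r g(2)] by (intro bigo_on_add) auto
  then show "\<exists>g\<in>lin B. bigo_on P N (\<lambda>h p. F h p * G h p - g h p)"
    using lin_mult[OF B f(1) g(1)]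
    by (intro bexI[of _ "\<lambda>h p. f h p * g h p"]) (auto simp: algebra_simps)
qed

lemma approx_const:
  assumes "gauge_basis B P"
  shows "approx B P (\<lambda>h p. c)"
proof -
  obtain e where e: "e \<in> B" "\<forall>\<^sub>F h in at_right 0. \<forall>p\<in>P h. e h p = 1"
    and "\<forall>f\<in>B. (\<lambda>h p. c * f h p) \<in> B"
    using assms unfolding gauge_basis_def by blast
  then have "approx B P (\<lambda>h p. c * e h p)" by (blast intro: approx_base)
  then show ?thesis
    by (rule approx_cong) (use e(2) in eventually_elim, auto)
qed

lemma approx_cmult: "gauge_basis B P \<Longrightarrow> approx B P F \<Longrightarrow> approx B P (\<lambda>h p. c * F h p)"
  by (rule approx_mult[OF _ approx_const])

lemma approx_diff:
  assumes "gauge_basis B P" "approx B P F" "approx B P G"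
  shows "approx B P (\<lambda>h p. F h p - G h p)"
  using approx_add[OF assms(2) approx_cmult[OF assms(1,3), of "-1"]] by simp

lemma approx_sum:
  "finite I \<Longrightarrow> (\<And>i. i \<in> I \<Longrightarrow> approx B P (F i)) \<Longrightarrow> approx B P (\<lambda>h p. \<Sum>i\<in>I. F i h p)"
  by (induction I rule: finite_induct) (auto intro: approx_zero approx_add)

lemma approx_power:
  assumes "gauge_basis B P" "approx B P F"
  shows "approx B P (\<lambda>h p. F h p ^ n)"
  by (induction n) (use approx_const[OF assms(1), of 1] approx_mult[OF assms] in auto)

section \<open>Composition of expansions with holomorphic functions\<close>

lemma holomorphic_taylor_bound:
  assumes "\<phi> holomorphic_on ball 0 r" "r > 0"
  obtains a C where
    "\<And>z. norm z \<le> r/2 \<Longrightarrow> norm (\<phi> z - (\<Sum>i\<le>n. a i * z ^ i)) \<le> C * norm z ^ Suc n"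
proof -
  let ?f = "\<lambda>i. (deriv ^^ i) \<phi>"
  \<comment> \<open>On the closed ball of half the radius compactness bounds the derivative of order
    \<open>Suc n\<close>.\<close>
  let ?S = "cball (0::complex) (r/2)"
  have sub: "?S \<subseteq> ball 0 r" using assms(2) by auto
  have "continuous_on ?S (?f (Suc n))"
    using holomorphic_higher_deriv[OF assms(1) open_ball] sub
    by (meson continuous_on_subset holomorphic_on_imp_continuous_on)
  then have "bounded (?f (Suc n) ` ?S)"
    by (intro compact_imp_bounded compact_continuous_image) auto
  then obtain B where B: "\<And>z. z \<in> ?S \<Longrightarrow> norm (?f (Suc n) z) \<le> B"
    unfolding bounded_iff by blast
  have der: "(?f i has_field_derivative ?f (Suc i) z) (at z within ?S)" if "z \<in> ?S" for i z
    using has_field_derivative_higher_deriv[OF assms(1) open_ball] sub that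
    by (meson has_field_derivative_at_within subsetD)
  have "norm (\<phi> z - (\<Sum>i\<le>n. (?f i 0 / fact i) * z ^ i)) \<le> (B / fact n) * norm z ^ Suc n"
    if "norm z \<le> r/2" for z
  proof -
    have "norm (?f 0 z - (\<Sum>i\<le>n. ?f i 0 * (z - 0) ^ i / fact i)) \<le> B * cmod (z - 0) ^ Suc n / fact n"
      by (rule complex_Taylor[OF convex_cball[of 0 "r/2"], where f = ?f and w = 0])
        (use der B that assms(2) in \<open>auto simp del: funpow.simps\<close>)
    then show ?thesis by (simp add: mult.commute)
  qed
  then show ?thesis by (rule that)
qed

text \<open>Because \<open>Q\<close> has the positive order \<open>\<kappa>\<close>, the Taylor
  remainder after degree \<open>n\<close> has order \<open>\<kappa> * (n + 1)\<close>. A Taylor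
  polynomial of sufficiently high degree, which is a polynomial in an approximable function,
  therefore reaches any prescribed order.\<close>

lemma approx_compose:
  assumes B: "gauge_basis B P" and Q: "approx B P Q" "bigo_on P \<kappa> Q" "\<kappa> > 0"
    and \<phi>: "\<phi> holomorphic_on ball 0 r" "r > 0"
  shows "approx B P (\<lambda>h p. \<phi> (Q h p))"
proof (rule approx_limit)
  fix N
  define n where "n = nat \<lceil>N / \<kappa>\<rceil>"
  have n: "N \<le> \<kappa> * real (Suc n)"
  proof -
    have "N / \<kappa> \<le> real (Suc n)" unfolding n_def by linarith
    then show ?thesis using Q(3) by (simp add: field_simps)
  qed
  obtain a C where aC:
    "\<And>z. norm z \<le> r/2 \<Longrightarrow> norm (\<phi> z - (\<Sum>i\<le>n. a i * z ^ i)) \<le> C * norm z ^ Suc n"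
    using holomorphic_taylor_bound[OF \<phi>, of n] by blast
  have "approx B P (\<lambda>h p. \<Sum>i\<le>n. a i * Q h p ^ i)"
    by (intro approx_sum approx_cmult[OF B] approx_power[OF B] Q) auto
  moreover have "bigo_on P N (\<lambda>h p. \<phi> (Q h p) - (\<Sum>i\<le>n. a i * Q h p ^ i))"
  proof (rule bigo_on_le)
    show "bigo_on P N (\<lambda>h p. of_real C * Q h p ^ Suc n)"
      by (intro bigo_on_cmult bigo_on_mono[OF bigo_on_power[OF Q(2)] n])
    show "\<forall>\<^sub>F h in at_right 0. \<forall>p\<in>P h.
       norm (\<phi> (Q h p) - (\<Sum>i\<le>n. a i * Q h p ^ i)) \<le> norm (of_real C * Q h p ^ Suc n)"
      using bigo_on_small[OF Q(2,3) half_gt_zero[OF \<phi>(2)]]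
    proof (rule eventually_mono)
      fix h assume h: "\<forall>p\<in>P h. norm (Q h p) \<le> r/2"
      show "\<forall>p\<in>P h. norm (\<phi> (Q h p) - (\<Sum>i\<le>n. a i * Q h p ^ i)) \<le> norm (of_real C * Q h p ^ Suc n)"
      proof
        fix p assume "p \<in> P h"
        then have "norm (\<phi> (Q h p) - (\<Sum>i\<le>n. a i * Q h p ^ i)) \<le> C * norm (Q h p) ^ Suc n"
          using aC h by blast
        also have "\<dots> \<le> \<bar>C\<bar> * norm (Q h p) ^ Suc n" by (intro mult_right_mono) auto
        finally show "norm (\<phi> (Q h p) - (\<Sum>i\<le>n. a i * Q h p ^ i)) \<le> norm (of_real C * Q h p ^ Suc n)"
          by (simp add: norm_mult norm_power)
      qed
    qed
  qed
  ultimately show "\<exists>G. approx B P G \<and> bigo_on P N (\<lambda>h p. \<phi> (Q h p) - G h p)" by blast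
qed

lemma bigo_on_compose:
  assumes Q: "bigo_on P \<kappa> Q" "\<kappa> > 0"
    and \<phi>: "\<phi> holomorphic_on ball 0 r" "r > 0"
  shows "bigo_on P \<kappa> (\<lambda>h p. \<phi> (Q h p) - \<phi> 0)"
proof -
  obtain a C where aC:
    "\<And>z. norm z \<le> r/2 \<Longrightarrow> norm (\<phi> z - (\<Sum>i\<le>0. a i * z ^ i)) \<le> C * norm z ^ Suc 0"
    using holomorphic_taylor_bound[OF \<phi>, of 0] by blast
  have a0: "a 0 = \<phi> 0" using aC[of 0] \<phi>(2) by simp
  show ?thesis
  proof (rule bigo_on_le)
    show "bigo_on P \<kappa> (\<lambda>h p. of_real C * Q h p)" by (intro bigo_on_cmult Q)
    show "\<forall>\<^sub>F h in at_right 0. \<forall>p\<in>P h. norm (\<phi> (Q h p) - \<phi> 0) \<le> norm (of_real C * Q h p)"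
      using bigo_on_small[OF Q(1,2) half_gt_zero[OF \<phi>(2)]]
    proof (rule eventually_mono)
      fix h assume h: "\<forall>p\<in>P h. norm (Q h p) \<le> r/2"
      show "\<forall>p\<in>P h. norm (\<phi> (Q h p) - \<phi> 0) \<le> norm (of_real C * Q h p)"
      proof
        fix p assume "p \<in> P h"
        then have "norm (\<phi> (Q h p) - \<phi> 0) \<le> C * norm (Q h p)"
          using aC[of "Q h p"] h a0 by auto
        also have "\<dots> \<le> \<bar>C\<bar> * norm (Q h p)" by (intro mult_right_mono) auto
        finally show "norm (\<phi> (Q h p) - \<phi> 0) \<le> norm (of_real C * Q h p)"
          by (simp add: norm_mult)
      qed
    qed
  qed
qed

lemma approx_cnj:
  assumes B: "\<And>f. f \<in> B \<Longrightarrow> (\<lambda>h p. cnj (f h p)) \<in> B" and F: "approx B P F"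
  shows "approx B P (\<lambda>h p. cnj (F h p))"
  unfolding approx_def
proof
  fix N
  obtain f where f: "f \<in> lin B" "bigo_on P N (\<lambda>h p. F h p - f h p)"
    using F by (auto simp: approx_def)
  have "(\<lambda>h p. cnj (f h p)) \<in> lin B" using f(1)
    by (induction f rule: lin.induct) (auto intro: lin_zero lin_plus B)
  moreover have "bigo_on P N (\<lambda>h p. cnj (F h p) - cnj (f h p))"
    by (rule bigo_on_le[OF f(2)]) (auto simp flip: complex_cnj_diff)
  ultimately show "\<exists>g\<in>lin B. bigo_on P N (\<lambda>h p. cnj (F h p) - g h p)"
    by (intro bexI[of _ "\<lambda>h p. cnj (f h p)"])
qed

section \<open>Oscillatory functions on the half line\<close>

lemma norm_diff_le_of_deriv:
  fixes f :: "real \<Rightarrow> complex" and g :: "real \<Rightarrow> real"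
  assumes "x \<le> y"
    and f: "\<And>t. t \<in> {x..y} \<Longrightarrow> (f has_vector_derivative f' t) (at t within {x..y})"
    and g: "\<And>t. t \<in> {x..y} \<Longrightarrow> (g has_real_derivative g' t) (at t within {x..y})"
    and le: "\<And>t. t \<in> {x..y} \<Longrightarrow> norm (f' t) \<le> g' t"
  shows "norm (f y - f x) \<le> g y - g x"
proof -
  have F: "(f' has_integral f y - f x) {x..y}"
    using assms by (intro fundamental_theorem_of_calculus) auto
  have G: "(g' has_integral g y - g x) {x..y}"
    using assms by (intro fundamental_theorem_of_calculus)
      (auto simp: has_real_derivative_iff_has_vector_derivative)
  have "norm (integral {x..y} f') \<le> integral {x..y} g'"
    using F G le by (intro integral_norm_bound_integral) (auto simp: has_integral_integrable)
  then show ?thesis using F G by (simp add: integral_unique)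
qed

text \<open>The tail bound at a single late point of the sequence gives the Cauchy property, and
  passing to the limit keeps the bound. This provides constants of integration together with a rate,
  both at infinity and at 0.\<close>

lemma limit_of_tail_bound:
  fixes f :: "real \<Rightarrow> complex" and \<psi> :: "real \<Rightarrow> real"
  assumes S: "\<And>n. X n \<in> S" and lim: "(\<lambda>n. \<psi> (X n)) \<longlonglongrightarrow> 0"
    and tail: "\<And>x. x \<in> S \<Longrightarrow> \<forall>\<^sub>F n in sequentially. norm (f (X n) - f x) \<le> \<psi> x"
  shows "\<exists>c. \<forall>x\<in>S. norm (f x - c) \<le> \<psi> x"
proof -
  have "Cauchy (\<lambda>n. f (X n))"
  proof (rule metric_CauchyI)
    fix e :: real assume "e > 0"
    then have "\<forall>\<^sub>F n in sequentially. \<psi> (X n) < e / 2"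
      by (intro order_tendstoD(2)[OF lim]) auto
    then obtain m where m: "\<psi> (X m) < e / 2" by (auto simp: eventually_sequentially)
    obtain M where M: "\<And>n. n \<ge> M \<Longrightarrow> norm (f (X n) - f (X m)) \<le> \<psi> (X m)"
      using tail[OF S] by (auto simp: eventually_sequentially)
    show "\<exists>M. \<forall>i\<ge>M. \<forall>j\<ge>M. dist (f (X i)) (f (X j)) < e"
    proof (intro exI allI impI)
      fix i j assume "i \<ge> M" "j \<ge> M"
      have "dist (f (X i)) (f (X j)) \<le> norm (f (X i) - f (X m)) + norm (f (X j) - f (X m))"
        using norm_triangle_ineq4[of "f (X i) - f (X m)" "f (X j) - f (X m)"] by (simp add: dist_norm)
      also have "\<dots> < e" using M[OF \<open>i \<ge> M\<close>] M[OF \<open>j \<ge> M\<close>] m by linarith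
      finally show "dist (f (X i)) (f (X j)) < e" .
    qed
  qed
  then obtain c where c: "(\<lambda>n. f (X n)) \<longlonglongrightarrow> c"
    using Cauchy_convergent convergent_def by blast
  have "norm (f x - c) \<le> \<psi> x" if "x \<in> S" for x
  proof -
    have "(\<lambda>n. norm (f (X n) - f x)) \<longlonglongrightarrow> norm (c - f x)" by (intro tendsto_intros c)
    then have "norm (c - f x) \<le> \<psi> x"
      by (rule tendsto_upperbound) (use tail[OF that] in auto)
    then show ?thesis by (simp add: norm_minus_commute)
  qed
  then show ?thesis by blast
qed

lemma limit_at_top_of_deriv_bound:
  fixes d :: "real \<Rightarrow> complex"
  assumes "r > 0"
    and der: "\<And>x. x \<ge> 1 \<Longrightarrow> (d has_vector_derivative e x) (at x within {1..})"
    and bd: "\<And>x. x \<ge> 1 \<Longrightarrow> norm (e x) \<le> C * x powr (- r - 1)"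
  shows "\<exists>c. \<forall>x\<ge>1. norm (d x - c) \<le> C / r * x powr (- r)"
proof -
  have C: "C \<ge> 0" using bd[of 1] norm_ge_zero[of "e 1"] by (simp del: norm_ge_zero)
  have diff: "norm (d y - d x) \<le> C / r * x powr (- r)" if "1 \<le> x" "x \<le> y" for x y
  proof -
    have "norm (d y - d x) \<le> (- (C/r) * y powr (- r)) - (- (C/r) * x powr (-r))"
    proof (rule norm_diff_le_of_deriv[OF that(2), where f' = e and g' = "\<lambda>t. C * t powr (-r-1)"])
      fix t assume t: "t \<in> {x..y}"
      show "(d has_vector_derivative e t) (at t within {x..y})"
        by (rule has_vector_derivative_within_subset[OF der]) (use t that in auto)
      have "((\<lambda>t. - (C/r) * t powr (- r)) has_real_derivative
          - (C/r) * (- r * t powr (- r - 1))) (at t within {x..y})"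
        using t that by (auto intro!: derivative_eq_intros)
      then show "((\<lambda>t. - (C/r) * t powr (- r)) has_real_derivative
          C * t powr (- r - 1)) (at t within {x..y})"
        using assms(1) by simp
      show "norm (e t) \<le> C * t powr (- r - 1)" using bd t that by auto
    qed
    moreover have "0 \<le> C / r * y powr (- r)" using C assms(1) by simp
    ultimately show ?thesis by simp
  qed
  have "\<exists>c. \<forall>x\<in>{1..}. norm (d x - c) \<le> C / r * x powr (- r)"
  proof (rule limit_of_tail_bound)
    show "real (Suc n) \<in> {1..}" for n by simp
    have "filterlim (\<lambda>n. real (Suc n)) at_top sequentially"
      by (rule filterlim_compose[OF filterlim_real_sequentially filterlim_Suc])
    then have "(\<lambda>n. real (Suc n) powr (- r)) \<longlonglongrightarrow> 0"
      using assms(1) by (intro tendsto_neg_powr) auto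
    then show "(\<lambda>n. C / r * real (Suc n) powr (- r)) \<longlonglongrightarrow> 0"
      using tendsto_mult_right_zero by blast
    fix x :: real assume x: "x \<in> {1..}"
    show "\<forall>\<^sub>F n in sequentially. norm (d (real (Suc n)) - d x) \<le> C / r * x powr (- r)"
      unfolding eventually_sequentially
    proof (intro exI allI impI)
      fix n assume "nat \<lceil>x\<rceil> \<le> n"
      then have "x \<le> real (Suc n)" by linarith
      then show "norm (d (real (Suc n)) - d x) \<le> C / r * x powr (- r)" using diff x by auto
    qed
  qed
  then show ?thesis by auto
qed

lemma limit_at_0_of_deriv_bound:
  fixes d :: "real \<Rightarrow> complex"
  assumes "r > 0" "x0 > 0"
    and der: "\<And>x. x \<in> {0<..x0} \<Longrightarrow> (d has_vector_derivative e x) (at x within {0<..x0})"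
    and bd: "\<And>x. x \<in> {0<..x0} \<Longrightarrow> norm (e x) \<le> C * x powr (r - 1)"
  shows "\<exists>c. \<forall>x\<in>{0<..x0}. norm (d x - c) \<le> C / r * x powr r"
proof -
  have "0 \<le> C * x0 powr (r-1)" using bd[of x0] assms(2) norm_ge_zero[of "e x0"] by (simp del: norm_ge_zero)
  then have C: "C \<ge> 0" using assms(2) by (simp add: zero_le_mult_iff)
  have diff: "norm (d x - d y) \<le> C / r * x powr r" if "0 < y" "y \<le> x" "x \<le> x0" for x y
  proof -
    have "norm (d x - d y) \<le> (C/r) * x powr r - (C/r) * y powr r"
    proof (rule norm_diff_le_of_deriv[OF that(2), where f' = e and g' = "\<lambda>t. C * t powr (r-1)"])
      fix t assume t: "t \<in> {y..x}"
      show "(d has_vector_derivative e t) (at t within {y..x})"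
        by (rule has_vector_derivative_within_subset[OF der]) (use t that in auto)
      have "((\<lambda>t. (C/r) * t powr r) has_real_derivative
          (C/r) * (r * t powr (r - 1))) (at t within {y..x})"
        using t that by (auto intro!: derivative_eq_intros)
      then show "((\<lambda>t. (C/r) * t powr r) has_real_derivative
          C * t powr (r - 1)) (at t within {y..x})"
        using assms(1) by simp
      show "norm (e t) \<le> C * t powr (r - 1)" using bd t that by auto
    qed
    moreover have "0 \<le> C / r * y powr r" using C assms(1) by simp
    ultimately show ?thesis by simp
  qed
  show ?thesis
  proof (rule limit_of_tail_bound)
    show "x0 / real (Suc n) \<in> {0<..x0}" for n using assms(2) by (auto simp: field_simps)
    have *: "(\<lambda>n. x0 / real (Suc n)) \<longlonglongrightarrow> 0"
      by (rule LIMSEQ_Suc, rule lim_const_over_n)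
    have "(\<lambda>n. (x0 / real (Suc n)) powr r) \<longlonglongrightarrow> 0 powr r"
      by (rule tendsto_powr2[OF * tendsto_const]) (use assms in auto)
    then show "(\<lambda>n. C / r * (x0 / real (Suc n)) powr r) \<longlonglongrightarrow> 0"
      using tendsto_mult_right_zero[of "\<lambda>n. (x0 / real (Suc n)) powr r" sequentially "C / r"] by simp
    fix x assume x: "x \<in> {0<..x0}"
    have "\<forall>\<^sub>F n in sequentially. x0 / real (Suc n) < x"
      by (rule order_tendstoD(2)[OF *]) (use x in auto)
    then show "\<forall>\<^sub>F n in sequentially. norm (d (x0 / real (Suc n)) - d x) \<le> C / r * x powr r"
    proof eventually_elim
      case (elim n)
      have "0 < x0 / real (Suc n)" using assms(2) by simp
      then show ?case using diff[of "x0 / real (Suc n)" x] elim x by (simp add: norm_minus_commute)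
    qed
  qed
qed

section \<open>Functions of the stretched variable with oscillating power expansions at
  infinity\<close>

definition exps :: "real \<Rightarrow> nat \<Rightarrow> real set" where
  "exps \<gamma> j = {real m * \<gamma> + real_of_int n | m n. m \<ge> j}"

text \<open>The frequencies are even because \<open>Lop\<close> brings in
  \<open>cis (- 2 * t)\<close>. The integer part of an exponent may have either sign, since
  integration by parts lowers it, whereas the multiple of \<open>\<gamma>\<close> counts the factors
  of the potential.\<close>

inductive_set oscspan :: "real \<Rightarrow> nat \<Rightarrow> (real \<Rightarrow> complex) set" for \<gamma> j where
  osc_zero: "(\<lambda>t. 0) \<in> oscspan \<gamma> j"
| osc_plus: "\<alpha> \<in> exps \<gamma> j \<Longrightarrow> g \<in> oscspan \<gamma> j \<Longrightarrow>
    (\<lambda>t. c * (of_real (t powr \<alpha>) * cis (2 * of_int l * t)) + g t) \<in> oscspan \<gamma> j"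

text \<open>The index \<open>j = 1\<close> forbids integer exponents, so that primitives contain no logarithm.\<close>
definition osc :: "real \<Rightarrow> nat \<Rightarrow> (real \<Rightarrow> complex) \<Rightarrow> bool" where
  "osc \<gamma> j f \<longleftrightarrow> continuous_on {0..} f \<and>
     (\<forall>N. \<exists>g\<in>oscspan \<gamma> j. \<exists>C. \<forall>t\<ge>1. norm (f t - g t) \<le> C * t powr (- N))"

lemma oscspan_add:
  "f \<in> oscspan \<gamma> j \<Longrightarrow> g \<in> oscspan \<gamma> j \<Longrightarrow> (\<lambda>t. f t + g t) \<in> oscspan \<gamma> j"
  by (induction f rule: oscspan.induct) (auto simp: add.assoc intro: oscspan.intros)

lemma oscspan_term:
  "\<alpha> \<in> exps \<gamma> j \<Longrightarrow> (\<lambda>t. c * (of_real (t powr \<alpha>) * cis (2 * of_int l * t))) \<in> oscspan \<gamma> j"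
  using osc_plus[OF _ osc_zero, of \<alpha> \<gamma> j c l] by simp

lemma oscspan_cmult: "f \<in> oscspan \<gamma> j \<Longrightarrow> (\<lambda>t. c * f t) \<in> oscspan \<gamma> j"
proof (induction f rule: oscspan.induct)
  case osc_zero then show ?case by (simp add: oscspan.osc_zero)
next
  case (osc_plus \<alpha> g d l)
  from oscspan.osc_plus[OF osc_plus(1) osc_plus.IH, of "c * d" l]
  show ?case by (simp add: algebra_simps)
qed

lemma oscspan_cnj: "f \<in> oscspan \<gamma> j \<Longrightarrow> (\<lambda>t. cnj (f t)) \<in> oscspan \<gamma> j"
proof (induction f rule: oscspan.induct)
  case osc_zero then show ?case by (simp add: oscspan.osc_zero)
next
  case (osc_plus \<alpha> g d l)
  from oscspan.osc_plus[OF osc_plus(1) osc_plus.IH, of "cnj d" "- l"]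
  show ?case by (simp add: cis_cnj)
qed

lemma oscspan_cis: "f \<in> oscspan \<gamma> j \<Longrightarrow> (\<lambda>t. cis (2 * of_int k * t) * f t) \<in> oscspan \<gamma> j"
proof (induction f rule: oscspan.induct)
  case osc_zero then show ?case by (simp add: oscspan.osc_zero)
next
  case (osc_plus \<alpha> g d l)
  have "cis (2 * of_int (k + l) * t) = cis (2 * of_int k * t) * cis (2 * of_int l * t)" for t
    by (simp add: cis_mult algebra_simps)
  with oscspan.osc_plus[OF osc_plus(1) osc_plus.IH, of d "k + l"]
  show ?case by (simp add: algebra_simps)
qed

lemma oscspan_powr:
  assumes "f \<in> oscspan \<gamma> 0" "e \<in> exps \<gamma> 1"
  shows "\<exists>g\<in>oscspan \<gamma> 1. \<forall>t\<ge>1. of_real (t powr e) * f t = g t"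
  using assms(1)
proof (induction f rule: oscspan.induct)
  case osc_zero then show ?case by (intro bexI[OF _ oscspan.osc_zero]) auto
next
  case (osc_plus \<alpha> f d l)
  then obtain g where g: "g \<in> oscspan \<gamma> 1" "\<And>t. t \<ge> 1 \<Longrightarrow> of_real (t powr e) * f t = g t" by blast
  obtain m n m' n' where "\<alpha> = real m * \<gamma> + real_of_int n" "e = real m' * \<gamma> + real_of_int n'" "m' \<ge> 1"
    using osc_plus(1) assms(2) by (auto simp: exps_def)
  then have "e + \<alpha> = real (m' + m) * \<gamma> + real_of_int (n' + n)" "m' + m \<ge> 1"
    by (auto simp: algebra_simps)
  then have "e + \<alpha> \<in> exps \<gamma> 1" unfolding exps_def by blast
  from oscspan.osc_plus[OF this g(1), of d l] show ?case
    by (rule bexI[rotated]) (auto simp: powr_add algebra_simps g(2)[symmetric])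
qed

lemma osc_add: 
  assumes "osc \<gamma> j f" "osc \<gamma> j g" shows "osc \<gamma> j (\<lambda>t. f t + g t)"
  unfolding osc_def
proof (intro conjI allI)
  show "continuous_on {0..} (\<lambda>t. f t + g t)"
    using assms by (auto simp: osc_def intro: continuous_on_add)
  fix N
  obtain f1 C where f1: "f1 \<in> oscspan \<gamma> j" "\<And>t. t\<ge>1 \<Longrightarrow> norm (f t - f1 t) \<le> C * t powr (- N)"
    using assms(1) unfolding osc_def by blast
  obtain g1 D where g1: "g1 \<in> oscspan \<gamma> j" "\<And>t. t\<ge>1 \<Longrightarrow> norm (g t - g1 t) \<le> D * t powr (- N)"
    using assms(2) unfolding osc_def by blast
  have "norm (f t + g t - (f1 t + g1 t)) \<le> (C + D) * t powr (- N)" if "t \<ge> 1" for t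
    using f1(2)[OF that] g1(2)[OF that] norm_triangle_ineq[of "f t - f1 t" "g t - g1 t"]
    by (simp add: algebra_simps)
  then show "\<exists>h\<in>oscspan \<gamma> j. \<exists>C. \<forall>t\<ge>1. norm (f t + g t - h t) \<le> C * t powr (- N)"
    using oscspan_add[OF f1(1) g1(1)] by (intro bexI[of _ "\<lambda>t. f1 t + g1 t"] exI[of _ "C + D"]) auto
qed

lemma osc_cmult: 
  assumes "osc \<gamma> j f" shows "osc \<gamma> j (\<lambda>t. c * f t)"
  unfolding osc_def
proof (intro conjI allI)
  show "continuous_on {0..} (\<lambda>t. c * f t)"
    using assms by (auto simp: osc_def intro!: continuous_intros)
  fix N
  obtain f1 C where f1: "f1 \<in> oscspan \<gamma> j" "\<And>t. t\<ge>1 \<Longrightarrow> norm (f t - f1 t) \<le> C * t powr (- N)"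
    using assms(1) unfolding osc_def by blast
  have "norm (c * f t - (c * f1 t)) \<le> (norm c * C) * t powr (- N)" if "t \<ge> 1" for t
  proof -
    have "norm (c * f t - c * f1 t) = norm c * norm (f t - f1 t)"
      by (simp add: norm_mult flip: right_diff_distrib)
    then show ?thesis using mult_left_mono[OF f1(2)[OF that], of "norm c"] by simp
  qed
  then show "\<exists>h\<in>oscspan \<gamma> j. \<exists>C. \<forall>t\<ge>1. norm (c * f t - h t) \<le> C * t powr (- N)"
    using oscspan_cmult[OF f1(1)]
    by (intro bexI[of _ "\<lambda>t. c * f1 t"] exI[of _ "norm c * C"]) auto
qed

lemma osc_cnj: 
  assumes "osc \<gamma> j f" shows "osc \<gamma> j (\<lambda>t. cnj (f t))"
  unfolding osc_def
proof (intro conjI allI)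
  show "continuous_on {0..} (\<lambda>t. cnj (f t))"
    using assms by (auto simp: osc_def intro!: continuous_intros)
  fix N
  obtain f1 C where f1: "f1 \<in> oscspan \<gamma> j" "\<And>t. t\<ge>1 \<Longrightarrow> norm (f t - f1 t) \<le> C * t powr (- N)"
    using assms(1) unfolding osc_def by blast
  have "norm (cnj (f t) - cnj (f1 t)) \<le> C * t powr (- N)" if "t \<ge> 1" for t
    using f1(2)[OF that] by (simp flip: complex_cnj_diff)
  then show "\<exists>h\<in>oscspan \<gamma> j. \<exists>C. \<forall>t\<ge>1. norm (cnj (f t) - h t) \<le> C * t powr (- N)"
    using oscspan_cnj[OF f1(1)] by (intro bexI[of _ "\<lambda>t. cnj (f1 t)"] exI[of _ C]) auto
qed

lemma osc_cis: 
  assumes "osc \<gamma> j f" shows "osc \<gamma> j (\<lambda>t. cis (2 * of_int k * t) * f t)"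
  unfolding osc_def
proof (intro conjI allI)
  show "continuous_on {0..} (\<lambda>t. cis (2 * of_int k * t) * f t)"
    using assms by (auto simp: osc_def intro!: continuous_intros)
  fix N
  obtain f1 C where f1: "f1 \<in> oscspan \<gamma> j" "\<And>t. t\<ge>1 \<Longrightarrow> norm (f t - f1 t) \<le> C * t powr (- N)"
    using assms(1) unfolding osc_def by blast
  have "norm (cis (2 * of_int k * t) * f t - cis (2 * of_int k * t) * f1 t) \<le> C * t powr (- N)"
    if "t \<ge> 1" for t
    using f1(2)[OF that] by (simp add: norm_mult flip: right_diff_distrib)
  then show "\<exists>h\<in>oscspan \<gamma> j. \<exists>C. \<forall>t\<ge>1.
      norm (cis (2 * of_int k * t) * f t - h t) \<le> C * t powr (- N)"
    using oscspan_cis[OF f1(1)]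
    by (intro bexI[of _ "\<lambda>t. cis (2 * of_int k * t) * f1 t"] exI[of _ C]) auto
qed

text \<open>One half of the loop that keeps the Picard iterates in the class: a factor of the
  potential raises the index from 0 to 1, and \<open>osc_integral\<close> leads back to 0.
  Positivity of \<open>e\<close> is for continuity at \<open>t = 0\<close>.\<close>

lemma osc_powr: 
  assumes "osc \<gamma> 0 f" "e \<in> exps \<gamma> 1" "e > 0"
  shows "osc \<gamma> 1 (\<lambda>t. of_real (t powr e) * f t)"
  unfolding osc_def
proof (intro conjI allI)
  show "continuous_on {0..} (\<lambda>t. of_real (t powr e) * f t)"
    using assms by (auto simp: osc_def intro!: continuous_on_mult continuous_on_of_real continuous_on_powr' continuous_on_id continuous_on_const)
  fix N
  obtain f1 C where f1: "f1 \<in> oscspan \<gamma> 0" "\<And>t. t\<ge>1 \<Longrightarrow> norm (f t - f1 t) \<le> C * t powr (- (N+e))"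
    using assms(1) unfolding osc_def by blast
  obtain g where g: "g \<in> oscspan \<gamma> 1" "\<And>t. t \<ge> 1 \<Longrightarrow> of_real (t powr e) * f1 t = g t"
    using oscspan_powr[OF f1(1) assms(2)] by blast
  have "norm (of_real (t powr e) * f t - g t) \<le> C * t powr (- N)" if "t \<ge> 1" for t
  proof -
    have "norm (of_real (t powr e) * f t - g t) = t powr e * norm (f t - f1 t)"
      using that by (simp add: g(2)[symmetric] norm_mult flip: right_diff_distrib)
    also have "\<dots> \<le> t powr e * (C * t powr (- (N+e)))"
      using f1(2)[OF that] by (intro mult_left_mono) auto
    also have "\<dots> = C * (t powr e * t powr (- (N+e)))" by simp
    also have "\<dots> = C * t powr (- N)" by (simp flip: powr_add)
    finally show ?thesis .
  qed
  then show "\<exists>h\<in>oscspan \<gamma> 1. \<exists>C. \<forall>t\<ge>1. norm (of_real (t powr e) * f t - h t) \<le> C * t powr (- N)"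
    using g(1) by blast
qed

lemma osc_const: "osc \<gamma> 0 (\<lambda>t. c)"
  unfolding osc_def
proof (intro conjI allI bexI exI impI)
  have "0 \<in> exps \<gamma> 0" unfolding exps_def by (rule CollectI, rule exI[of _ 0], rule exI[of _ 0]) auto
  then show "(\<lambda>t. c * (of_real (t powr 0) * cis (2 * of_int 0 * t))) \<in> oscspan \<gamma> 0"
    by (rule oscspan_term)
  show "norm (c - c * (of_real (t powr 0) * cis (2 * of_int 0 * t))) \<le> 0 * t powr - N" if "1 \<le> t" for N t
    using that by simp
qed auto

lemma exps_plus_int: "\<alpha> \<in> exps \<gamma> j \<Longrightarrow> \<alpha> + of_int k \<in> exps \<gamma> j"
proof -
  assume "\<alpha> \<in> exps \<gamma> j"
  then obtain m n where "\<alpha> = real m * \<gamma> + real_of_int n" "m \<ge> j" by (auto simp: exps_def)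
  then have "\<alpha> + of_int k = real m * \<gamma> + real_of_int (n + k)" by simp
  with \<open>m \<ge> j\<close> show ?thesis unfolding exps_def by blast
qed

lemma exps_mono: "exps \<gamma> 1 \<subseteq> exps \<gamma> 0"
  by (auto simp: exps_def)

lemma exps_1_not_int:
  assumes "\<gamma> \<notin> \<rat>" "\<alpha> \<in> exps \<gamma> 1" shows "\<alpha> \<noteq> of_int k"
proof
  assume "\<alpha> = of_int k"
  then obtain m n where m: "real m * \<gamma> + real_of_int n = of_int k" "m \<ge> 1"
    using assms(2) by (auto simp: exps_def)
  then have "\<gamma> = of_int (k - n) / of_int (int m)" by (simp add: field_simps)
  also have "\<dots> \<in> \<rat>" by (intro Rats_divide Rats_of_int)
  finally show False using assms(1) by blast
qed

text \<open>Integration by parts lowers the exponent of an oscillating term; a non-oscillating one has an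
  exact primitive because its exponent is not \<open>-1\<close>.\<close>
lemma osc_term_primitive:
  assumes "\<gamma> \<notin> \<rat>" "\<alpha> \<in> exps \<gamma> 1" "\<alpha> \<le> - N + real s"
  shows "\<exists>G\<in>oscspan \<gamma> 0. \<exists>e C. \<forall>t\<ge>1.
    (G has_vector_derivative of_real (t powr \<alpha>) * cis (2 * of_int l * t) + e t) (at t within {1..}) \<and>
    norm (e t) \<le> C * t powr (- N)"
proof (cases "l = 0")
  case True
  have ne: "\<alpha> + 1 \<noteq> 0" using exps_1_not_int[OF assms(1,2), of "-1"] by auto
  let ?G = "\<lambda>t. of_real (1 / (\<alpha> + 1)) * (of_real (t powr (\<alpha> + 1)) * cis (2 * of_int 0 * t))"
  have "\<alpha> + of_int 1 \<in> exps \<gamma> 0" using assms(2) exps_mono by (intro exps_plus_int) auto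
  then have "?G \<in> oscspan \<gamma> 0" by (intro oscspan_term) auto
  moreover have "(?G has_vector_derivative of_real (t powr \<alpha>) * cis (2 * of_int l * t) + 0) (at t within {1..})"
    if "t \<ge> 1" for t
  proof -
    have "((\<lambda>t. t powr (\<alpha>+1) / (\<alpha>+1)) has_real_derivative t powr \<alpha>) (at t within {1..})"
      using that ne by (auto intro!: derivative_eq_intros)
    then have "((\<lambda>t. complex_of_real (t powr (\<alpha>+1) / (\<alpha>+1))) has_vector_derivative of_real (t powr \<alpha>))
      (at t within {1..})"
      by (intro has_vector_derivative_of_real)
        (simp add: has_real_derivative_iff_has_vector_derivative)
    then show ?thesis using True by simp
  qed
  ultimately show ?thesis
    by (intro bexI[of _ ?G] exI[of _ "\<lambda>t. 0"] exI[of _ 0]) auto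
next
  case l: False
  show ?thesis using assms(2,3)
  \<comment> \<open>\<open>s\<close> counts the integrations by parts still to be done; for
    \<open>s = 0\<close> the whole term is already below the required order and is declared to be
    error.\<close>
  proof (induction s arbitrary: \<alpha>)
    case 0
    show ?case
    proof (intro bexI[OF _ osc_zero] exI[of _ "\<lambda>t. - (of_real (t powr \<alpha>) * cis (2 * of_int l * t))"] 
        exI[of _ 1] allI impI conjI)
      fix t :: real assume "t \<ge> 1"
      then show "norm (- (of_real (t powr \<alpha>) * cis (2 * of_int l * t))) \<le> 1 * t powr - N"
        using 0 by (simp add: norm_mult powr_mono)
    qed auto
  next
    case (Suc s)
    have "\<alpha> + of_int (-1) \<in> exps \<gamma> 1" by (rule exps_plus_int[OF Suc.prems(1)])
    then have "\<alpha> - 1 \<in> exps \<gamma> 1" by simp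
    moreover have "\<alpha> - 1 \<le> - N + real s" using Suc.prems by simp
    ultimately obtain G e C where G: "G \<in> oscspan \<gamma> 0"
      "\<And>t. t \<ge> 1 \<Longrightarrow> (G has_vector_derivative of_real (t powr (\<alpha> - 1)) * cis (2 * of_int l * t) + e t) (at t within {1..})"
      "\<And>t. t \<ge> 1 \<Longrightarrow> norm (e t) \<le> C * t powr (- N)"
      using Suc.IH[of "\<alpha> - 1"] by blast
    define w where "w = 1 / (\<i> * of_int (2 * l))"
    let ?H = "\<lambda>t. w * (of_real (t powr \<alpha>) * cis (2 * of_int l * t)) + (- (w * of_real \<alpha>)) * G t"
    have "?H \<in> oscspan \<gamma> 0"
      using Suc.prems(1) exps_mono by (intro oscspan.osc_plus oscspan_cmult G) auto
    moreover have "(?H has_vector_derivative of_real (t powr \<alpha>) * cis (2 * of_int l * t) + (- (w * of_real \<alpha>)) * e t) (at t within {1..})"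
      if t: "t \<ge> 1" for t
    proof -
      have w: "w * (\<i> * of_int (2 * l)) = 1" using l by (simp add: w_def)
      have "((\<lambda>t. t powr \<alpha>) has_real_derivative \<alpha> * t powr (\<alpha> - 1)) (at t within {1..})"
        using t by (auto intro!: derivative_eq_intros)
      then have 1: "((\<lambda>t. complex_of_real (t powr \<alpha>)) has_vector_derivative of_real (\<alpha> * t powr (\<alpha> - 1))) (at t within {1..})"
        by (intro has_vector_derivative_of_real)
          (simp add: has_real_derivative_iff_has_vector_derivative)
      have 2: "((\<lambda>t. cis (2 * of_int l * t)) has_vector_derivative (2 * of_int l) *\<^sub>R (\<i> * cis (2 * of_int l * t))) (at t within {1..})"
      proof -
        have "((\<lambda>z. exp (\<i> * of_real (2 * of_int l) * z)) has_field_derivative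
            \<i> * of_real (2 * of_int l) * exp (\<i> * of_real (2 * of_int l) * of_real t)) (at (of_real t))"
          by (auto intro!: derivative_eq_intros)
        from has_vector_derivative_real_field[OF this, of "{1..}"] show ?thesis
          by (simp add: cis_conv_exp scaleR_conv_of_real mult_ac)
      qed
      have "(?H has_vector_derivative
          w * (of_real (t powr \<alpha>) * ((2 * of_int l) *\<^sub>R (\<i> * cis (2 * of_int l * t))) + of_real (\<alpha> * t powr (\<alpha> - 1)) * cis (2 * of_int l * t))
          + (- (w * of_real \<alpha>)) * (of_real (t powr (\<alpha> - 1)) * cis (2 * of_int l * t) + e t)) (at t within {1..})"
        by (intro has_vector_derivative_add has_vector_derivative_mult_right has_vector_derivative_mult 1 2 G t)
      also have "w * (of_real (t powr \<alpha>) * ((2 * of_int l) *\<^sub>R (\<i> * cis (2 * of_int l * t))) + of_real (\<alpha> * t powr (\<alpha> - 1)) * cis (2 * of_int l * t))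
          + (- (w * of_real \<alpha>)) * (of_real (t powr (\<alpha> - 1)) * cis (2 * of_int l * t) + e t)
        = (w * (\<i> * of_int (2 * l))) * (of_real (t powr \<alpha>) * cis (2 * of_int l * t)) + (- (w * of_real \<alpha>)) * e t"
        by (simp add: scaleR_conv_of_real algebra_simps)
      finally show ?thesis using w by simp
    qed
    moreover have "norm ((- (w * of_real \<alpha>)) * e t) \<le> (norm (w * of_real \<alpha>) * C) * t powr (- N)" if "t \<ge> 1" for t
      using mult_left_mono[OF G(3)[OF that], of "norm (w * of_real \<alpha>)"] by (simp add: norm_mult mult_ac)
    ultimately show ?case
      by (intro bexI[of _ ?H] exI[of _ "\<lambda>t. (- (w * of_real \<alpha>)) * e t"]
        exI[of _ "norm (w * of_real \<alpha>) * C"]) auto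
  qed
qed

lemma oscspan_primitive:
  assumes "\<gamma> \<notin> \<rat>" "g \<in> oscspan \<gamma> 1"
  shows "\<exists>G\<in>oscspan \<gamma> 0. \<exists>e C. \<forall>t\<ge>1.
    (G has_vector_derivative g t + e t) (at t within {1..}) \<and> norm (e t) \<le> C * t powr (- N)"
  using assms(2)
proof (induction g rule: oscspan.induct)
  case osc_zero
  show ?case by (intro bexI[OF _ oscspan.osc_zero] exI[of _ "\<lambda>t. 0"] exI[of _ 0]) auto
next
  case (osc_plus \<alpha> g c l)
  then obtain G e C where G: "G \<in> oscspan \<gamma> 0"
    "\<And>t. t\<ge>1 \<Longrightarrow> (G has_vector_derivative g t + e t) (at t within {1..})"
    "\<And>t. t\<ge>1 \<Longrightarrow> norm (e t) \<le> C * t powr (- N)" by blast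
  have "\<alpha> \<le> - N + real (nat \<lceil>\<alpha> + N\<rceil>)" by linarith
  from osc_term_primitive[OF assms(1) osc_plus(1) this, of l]
  obtain H e' D where H: "H \<in> oscspan \<gamma> 0"
    "\<And>t. t\<ge>1 \<Longrightarrow> (H has_vector_derivative of_real (t powr \<alpha>) * cis (2 * of_int l * t) + e' t) (at t within {1..})"
    "\<And>t. t\<ge>1 \<Longrightarrow> norm (e' t) \<le> D * t powr (- N)" by blast
  have "(\<lambda>t. c * H t + G t) \<in> oscspan \<gamma> 0" by (intro oscspan_add oscspan_cmult G H)
  moreover have "((\<lambda>t. c * H t + G t) has_vector_derivative
     c * (of_real (t powr \<alpha>) * cis (2 * of_int l * t)) + g t + (c * e' t + e t)) (at t within {1..})" if "t \<ge> 1" for t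
    using has_vector_derivative_add[OF has_vector_derivative_mult_right[OF H(2)[OF that], of c] G(2)[OF that]]
    by (simp add: algebra_simps)
  moreover have "norm (c * e' t + e t) \<le> (norm c * D + C) * t powr (- N)" if "t \<ge> 1" for t
    using norm_triangle_ineq[of "c * e' t" "e t"] mult_left_mono[OF H(3)[OF that], of "norm c"] G(3)[OF that]
    by (simp add: norm_mult algebra_simps)
  ultimately show ?case
    by (intro bexI[of _ "\<lambda>t. c * H t + G t"] exI[of _ "\<lambda>t. c * e' t + e t"]
      exI[of _ "norm c * D + C"]) auto
qed

text \<open>Subtracting a primitive of the approximant leaves a function with integrable derivative,
  which has a limit at infinity. This limit is a term of exponent 0, and for this reason the index
  drops from 1 to 0.\<close>

lemma osc_integral:
  assumes "\<gamma> \<notin> \<rat>" "osc \<gamma> 1 f"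
  shows "osc \<gamma> 0 (\<lambda>t. integral {0..t} f)"
  unfolding osc_def
proof (intro conjI allI)
  have cont: "continuous_on {0..x} f" for x
    using assms(2) unfolding osc_def by (auto elim: continuous_on_subset)
  have der: "((\<lambda>t. integral {0..t} f) has_vector_derivative f t) (at t within {0..})" if "t \<ge> 0" for t
  proof -
    have "((\<lambda>t. integral {0..t} f) has_vector_derivative f t) (at t within {0..t+1})"
      by (rule integral_has_vector_derivative[OF cont]) (use that in auto)
    moreover have "at t within {0..t+1} = at t within {0..}"
      by (rule at_within_nhd[where S = "{..<t+1}"]) auto
    ultimately show ?thesis by simp
  qed
  then show "continuous_on {0..} (\<lambda>t. integral {0..t} f)"
    by (meson atLeast_iff continuous_on_eq_continuous_within has_vector_derivative_continuous)
  fix N :: real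
  \<comment> \<open>A positive rate is needed for the remainder to be integrable at infinity,
    whatever \<open>N\<close> is.\<close>
  define r where "r = max N 1"
  obtain g C where g: "g \<in> oscspan \<gamma> 1" "\<And>t. t\<ge>1 \<Longrightarrow> norm (f t - g t) \<le> C * t powr (- (r + 1))"
    using assms(2) unfolding osc_def by blast
  obtain G e D where G: "G \<in> oscspan \<gamma> 0"
    "\<And>t. t\<ge>1 \<Longrightarrow> (G has_vector_derivative g t + e t) (at t within {1..})"
    "\<And>t. t\<ge>1 \<Longrightarrow> norm (e t) \<le> D * t powr (- (r + 1))"
    using oscspan_primitive[OF assms(1) g(1), of "r + 1"] by blast
  have "\<exists>c. \<forall>t\<ge>1. norm (integral {0..t} f - G t - c) \<le> (C + D) / r * t powr (- r)"
  proof (rule limit_at_top_of_deriv_bound)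
    fix t :: real assume t: "t \<ge> 1"
    show "((\<lambda>t. integral {0..t} f - G t) has_vector_derivative f t - (g t + e t)) (at t within {1..})"
      by (intro has_vector_derivative_diff G t has_vector_derivative_within_subset[OF der]) (use t in auto)
    have "norm (f t - (g t + e t)) \<le> norm (f t - g t) + norm (e t)"
      using norm_triangle_ineq4[of "f t - g t" "e t"] by (simp add: algebra_simps)
    then show "norm (f t - (g t + e t)) \<le> (C + D) * t powr (- r - 1)"
      using g(2)[OF t] G(3)[OF t] by (simp add: distrib_right)
  qed (simp add: r_def)
  then obtain c where c: "\<And>t. t\<ge>1 \<Longrightarrow> norm (integral {0..t} f - G t - c) \<le> (C + D) / r * t powr (- r)" by blast
  have "0 \<in> exps \<gamma> 0" unfolding exps_def by (rule CollectI, rule exI[of _ 0], rule exI[of _ 0]) auto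
  from osc_plus[OF this G(1), of c 0]
  have "(\<lambda>t. c * (of_real (t powr 0) * cis (2 * of_int 0 * t)) + G t) \<in> oscspan \<gamma> 0" .
  moreover have "norm (integral {0..t} f - (c * (of_real (t powr 0) * cis (2 * of_int 0 * t)) + G t))
      \<le> (\<bar>C + D\<bar> / r) * t powr (- N)" if t: "t \<ge> 1" for t
  proof -
    have "norm (integral {0..t} f - (c * (of_real (t powr 0) * cis (2 * of_int 0 * t)) + G t))
       = norm (integral {0..t} f - G t - c)" using t by (simp add: algebra_simps)
    also have "\<dots> \<le> (C + D) / r * t powr (- r)" by (rule c[OF t])
    also have "\<dots> \<le> (\<bar>C + D\<bar> / r) * t powr (- N)"
      using t by (intro mult_mono divide_right_mono powr_mono) (auto simp: r_def)
    finally show ?thesis .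
  qed
  ultimately show "\<exists>g\<in>oscspan \<gamma> 0. \<exists>C. \<forall>t\<ge>1. norm (integral {0..t} f - g t) \<le> C * t powr - N"
    by (intro bexI[of _ "\<lambda>t. c * (of_real (t powr 0) * cis (2 * of_int 0 * t)) + G t"]
      exI[of _ "\<bar>C + D\<bar> / r"]) auto
qed

section \<open>Picard iteration for the amplitude\<close>

text \<open>With \<open>u = Im (cis t * A)\<close> and \<open>u' = Re (cis t * A)\<close>, the equation \<open>u'' + u = v * u\<close> becomes
  \<open>A' = v * Lop t A\<close>.\<close>
definition Lop :: "real \<Rightarrow> complex \<Rightarrow> complex" where
  "Lop t z = (z - cis (- 2 * t) * cnj z) / (2 * \<i>)"

lemma norm_Lop: "norm (Lop t z) \<le> norm z"
proof -
  have "norm (z - cis (- 2 * t) * cnj z) \<le> norm z + norm z"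
    using norm_triangle_ineq4[of z "cis (- 2 * t) * cnj z"] by (simp add: norm_mult)
  then show ?thesis by (simp add: Lop_def norm_divide norm_mult)
qed

lemma Lop_add: "Lop t (z + w) = Lop t z + Lop t w"
  unfolding Lop_def by (subst add_divide_distrib[symmetric]) (simp add: algebra_simps)

lemma Lop_diff: "Lop t (z - w) = Lop t z - Lop t w"
  unfolding Lop_def by (subst diff_divide_distrib[symmetric]) (simp add: algebra_simps)

lemma Lop_0 [simp]: "Lop t 0 = 0"
  by (simp add: Lop_def)

lemma Lop_of_real_mult: "Lop t (of_real c * z) = of_real c * Lop t z"
  unfolding Lop_def by (subst times_divide_eq_right) (simp add: algebra_simps)

lemma Lop_sum: "Lop t (sum f I) = (\<Sum>i\<in>I. Lop t (f i))"
  by (induction I rule: infinite_finite_induct) (auto simp: Lop_add)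

lemma continuous_on_Lop [continuous_intros]:
  "continuous_on S f \<Longrightarrow> continuous_on S (\<lambda>t. Lop t (f t))"
  unfolding Lop_def by (intro continuous_intros) auto

lemma cis_mult_Lop: "cis t * Lop t z = of_real (Im (cis t * z))"
proof -
  have "cis t * cis (- 2 * t) = cnj (cis t)" by (simp add: cis_mult cis_cnj)
  then have "cis t * Lop t z = (cis t * z - cnj (cis t * z)) / (2 * \<i>)"
    by (simp add: Lop_def right_diff_distrib flip: mult.assoc)
  also have "\<dots> = of_real (Im (cis t * z))"
  proof -
    have "complex_of_real (2 * m) * \<i> / (2 * \<i>) = of_real m" for m by (simp add: complex_eq_iff)
    then show ?thesis unfolding complex_diff_cnj .
  qed
  finally show ?thesis .
qed

text \<open>\<open>picard v m\<close> is the \<open>m\<close>-th term of the series, homogeneous of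
  degree \<open>m\<close> in \<open>v\<close>, and not the \<open>m\<close>-th partial sum. Each
  term thus gains one more factor of the small potential.\<close>

primrec picard :: "(real \<Rightarrow> real) \<Rightarrow> nat \<Rightarrow> real \<Rightarrow> complex" where
  "picard v 0 = (\<lambda>s. 1)"
| "picard v (Suc m) = (\<lambda>s. integral {0..s} (\<lambda>t. of_real (v t) * Lop t (picard v m t)))"

definition picard_sum :: "(real \<Rightarrow> real) \<Rightarrow> real \<Rightarrow> complex" where
  "picard_sum v s = (\<Sum>m. picard v m s)"

context
  fixes v :: "real \<Rightarrow> real" and L :: real
  assumes v: "continuous_on {0..L} v"
begin

lemma picard_deriv_and_cont:
  shows "continuous_on {0..L} (picard v m)"
    and "s \<in> {0..L} \<Longrightarrow> (picard v (Suc m) has_vector_derivative of_real (v s) * Lop s (picard v m s)) (at s within {0..L})"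
proof (induction m arbitrary: s)
  case 0
  { case 1 show ?case by simp }
  { case 2 
    have "continuous_on {0..L} (\<lambda>t. of_real (v t) * Lop t (picard v 0 t))"
      by (intro continuous_intros v) auto
    from integral_has_vector_derivative[OF this 2] show ?case by simp }
next
  case (Suc m)
  { case 1 
    show ?case using Suc.IH(2) by (meson continuous_on_eq_continuous_within has_vector_derivative_continuous) }
  note c = this
  { case 2
    have "continuous_on {0..L} (\<lambda>t. of_real (v t) * Lop t (picard v (Suc m) t))"
      by (intro continuous_intros v c)
    from integral_has_vector_derivative[OF this 2] show ?case by simp }
qed

lemma picard_bound:
  assumes s: "s \<le> L" and c: "\<And>t. t \<in> {0..s} \<Longrightarrow> \<bar>v t\<bar> \<le> c"
  shows "t \<in> {0..s} \<Longrightarrow> norm (picard v m t) \<le> (c * t) ^ m / fact m"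
proof (induction m arbitrary: t)
  case 0 then show ?case by simp
next
  case (Suc m)
  have "norm (picard v (Suc m) t - picard v (Suc m) 0) \<le> (c * t) ^ Suc m / fact (Suc m) - (c * 0) ^ Suc m / fact (Suc m)"
  proof (rule norm_diff_le_of_deriv)
    fix x assume x: "x \<in> {0..t}"
    show "(picard v (Suc m) has_vector_derivative of_real (v x) * Lop x (picard v m x)) (at x within {0..t})"
      by (rule has_vector_derivative_within_subset[OF picard_deriv_and_cont(2)]) (use x s Suc.prems in auto)
    have eq: "real (Suc m) * (c * x) ^ m * c / fact (Suc m) = c * ((c * x) ^ m / fact m)"
      unfolding fact_Suc by (simp del: of_nat_Suc)
    show "((\<lambda>t. (c * t) ^ Suc m / fact (Suc m)) has_real_derivative c * ((c * x) ^ m / fact m)) (at x within {0..t})"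
      unfolding eq[symmetric] by (rule derivative_eq_intros refl | simp)+
    have "norm (of_real (v x) * Lop x (picard v m x)) \<le> c * norm (picard v m x)"
      unfolding norm_mult using c[of x] x Suc.prems norm_Lop by (intro mult_mono) auto
    also have "\<dots> \<le> c * ((c * x) ^ m / fact m)"
      using Suc.IH[of x] c[of x] x Suc.prems by (intro mult_left_mono) auto
    finally show "norm (of_real (v x) * Lop x (picard v m x)) \<le> c * ((c * x) ^ m / fact m)" .
  qed (use Suc.prems in auto)
  then show ?case by simp
qed

lemma picard_sum_bound:
  assumes s: "s \<le> L" and c: "\<And>t. t \<in> {0..s} \<Longrightarrow> \<bar>v t\<bar> \<le> c" and t: "t \<in> {0..s}"
  shows "summable (\<lambda>m. picard v m t)"
    and "norm (picard_sum v t - (\<Sum>m<n. picard v m t)) \<le> (c * t) ^ n / fact n * exp (c * t)"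
proof -
  have ct: "0 \<le> c * t" using c[of t] t by (auto intro!: mult_nonneg_nonneg)
  have exps: "(\<lambda>m. (c * t) ^ m / fact m) sums exp (c * t)"
    using exp_converges[of "c * t"] by (simp add: field_simps)
  have nb: "norm (picard v m t) \<le> (c * t) ^ m / fact m" for m
    by (rule picard_bound[OF s c t])
  show sm: "summable (\<lambda>m. picard v m t)"
    by (rule summable_comparison_test'[OF sums_summable[OF exps], of 0]) (use nb in auto)
  have le: "norm (picard v (m + n) t) \<le> (c * t) ^ n / fact n * ((c * t) ^ m / fact m)" for m
  proof -
    \<comment> \<open>This bounds the tail of the exponential series from index \<open>n\<close> on
      by its \<open>n\<close>-th term times the whole series.\<close>
    have "(fact n * fact m :: real) \<le> fact (m + n)"
    proof -
      have "(fact n * fact m :: nat) \<le> fact (m + n)"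
        using fact_fact_dvd_fact[of n m] by (intro dvd_imp_le) (auto simp: add.commute)
      then have "real (fact n * fact m) \<le> real (fact (m + n))" by (rule of_nat_mono)
      then show ?thesis by simp
    qed
    then have "(c * t) ^ (m + n) / fact (m + n) \<le> (c * t) ^ (m + n) / (fact n * fact m)"
      using ct by (intro divide_left_mono) auto
    then show ?thesis using nb[of "m + n"] by (simp add: power_add mult_ac)
  qed
  have sm2: "summable (\<lambda>m. (c * t) ^ n / fact n * ((c * t) ^ m / fact m))"
    by (intro summable_mult sums_summable[OF exps])
  have "picard_sum v t - (\<Sum>m<n. picard v m t) = (\<Sum>m. picard v (m + n) t)"
    unfolding picard_sum_def by (simp add: suminf_minus_initial_segment[OF sm])
  also have "norm \<dots> \<le> (\<Sum>m. (c * t) ^ n / fact n * ((c * t) ^ m / fact m))"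
    by (rule norm_suminf_le[OF le sm2])
  also have "\<dots> = (c * t) ^ n / fact n * exp (c * t)"
    using sums_unique[OF sums_mult[OF exps]] by metis
  finally show "norm (picard_sum v t - (\<Sum>m<n. picard v m t)) \<le> (c * t) ^ n / fact n * exp (c * t)" .
qed

lemma picard_sum_0: "picard_sum v 0 = 1"
proof -
  have "(\<lambda>m. picard v m 0) sums (\<Sum>m\<in>{0}. picard v m 0)"
  proof (rule sums_finite)
    fix m :: nat assume "m \<notin> {0}" 
    then obtain k where "m = Suc k" by (cases m) auto
    then show "picard v m 0 = 0" by simp
  qed auto
  then show ?thesis by (simp add: picard_sum_def sums_iff)
qed

lemma picard_sum_deriv:
  assumes s: "s \<in> {0..L}"
  shows "(picard_sum v has_vector_derivative of_real (v s) * Lop s (picard_sum v s)) (at s within {0..L})"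
proof -
  have "bounded (v ` {0..L})" by (intro compact_imp_bounded compact_continuous_image v) auto
  then obtain c where c: "\<And>t. t \<in> {0..L} \<Longrightarrow> \<bar>v t\<bar> \<le> c"
    unfolding bounded_iff real_norm_def by blast
  have c0: "c \<ge> 0" using c[OF s] by linarith
  \<comment> \<open>The derivative of term \<open>Suc m\<close> is expressed by term
    \<open>m\<close>, so the first \<open>n\<close> derivatives add up to \<open>Lop\<close> of the
    partial sum with \<open>n - 1\<close> terms; the value 0 in the first case belongs to the
    constant term.\<close>
  define f' where "f' = (\<lambda>n x (h::real). h *\<^sub>R (case n of 0 \<Rightarrow> 0 | Suc m \<Rightarrow> of_real (v x) * Lop x (picard v m x)))"
  define g' where "g' = (\<lambda>x (h::real). h *\<^sub>R (of_real (v x) * Lop x (picard_sum v x)))"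
  have "\<exists>g. \<forall>x\<in>{0..L}. (\<lambda>n. picard v n x) sums g x \<and> (g has_derivative g' x) (at x within {0..L})"
  proof (rule has_derivative_series)
    show "(picard v n has_derivative f' n x) (at x within {0..L})" if "x \<in> {0..L}" for n x
      using picard_deriv_and_cont(2)[OF that, of "n - 1"]
      by (cases n) (auto simp: f'_def has_vector_derivative_def)
    show "0 \<in> {0..L}" using s by auto
    show "(\<lambda>n. picard v n 0) sums picard_sum v 0"
      using picard_sum_bound(1)[OF order_refl c, of 0] s
      by (simp add: picard_sum_def summable_sums)
    fix e :: real assume "e > 0"
    have "(\<lambda>n. exp (c * L) * c * ((c * L) ^ n / fact n)) \<longlonglongrightarrow> exp (c * L) * c * 0"
      by (intro tendsto_mult tendsto_const)
        (use summable_LIMSEQ_zero[OF summable_exp, of "c * L"] in \<open>simp add: field_simps\<close>)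
    then have "\<forall>\<^sub>F n in sequentially. exp (c * L) * c * ((c * L) ^ n / fact n) < e"
      using \<open>e > 0\<close> by (intro order_tendstoD(2)) auto
    then obtain M where M: "\<And>n. n \<ge> M \<Longrightarrow> exp (c * L) * c * ((c * L) ^ n / fact n) < e"
      by (auto simp: eventually_sequentially)
    show "\<forall>\<^sub>F n in sequentially. \<forall>x\<in>{0..L}. \<forall>h. norm ((\<Sum>i<n. f' i x h) - g' x h) \<le> e * norm h"
      unfolding eventually_sequentially
    proof (intro exI allI impI ballI)
      fix n x and h :: real assume n: "Suc M \<le> n" and x: "x \<in> {0..L}"
      then obtain m where m: "n = Suc m" "m \<ge> M" by (cases n) auto
      have "(\<Sum>i<n. f' i x h) = (\<Sum>i<m. h *\<^sub>R (of_real (v x) * Lop x (picard v i x)))"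
        unfolding m(1) sum.lessThan_Suc_shift by (simp add: f'_def)
      also have "\<dots> = h *\<^sub>R (of_real (v x) * Lop x (\<Sum>i<m. picard v i x))"
        by (simp add: Lop_sum sum_distrib_left scaleR_sum_right)
      finally have "norm ((\<Sum>i<n. f' i x h) - g' x h) =
          \<bar>h\<bar> * (\<bar>v x\<bar> * norm (Lop x (picard_sum v x - (\<Sum>i<m. picard v i x))))"
        unfolding g'_def scaleR_diff_right[symmetric] right_diff_distrib[symmetric] Lop_diff[symmetric]
        by (simp add: norm_mult norm_minus_commute[of "picard_sum v x"] Lop_diff norm_minus_commute[of "Lop x (picard_sum v x)"] flip: right_diff_distrib scaleR_diff_right)
      also have "\<dots> \<le> \<bar>h\<bar> * (c * ((c * L) ^ m / fact m * exp (c * L)))"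
      proof (intro mult_left_mono mult_mono)
        have "norm (Lop x (picard_sum v x - (\<Sum>i<m. picard v i x))) \<le> (c * x) ^ m / fact m * exp (c * x)"
          using norm_Lop picard_sum_bound(2)[OF order_refl c x] by (meson order_trans)
        also have "\<dots> \<le> (c * L) ^ m / fact m * exp (c * L)"
          using x c0 by (intro mult_mono divide_right_mono power_mono) (auto intro: mult_left_mono)
        finally show "norm (Lop x (picard_sum v x - (\<Sum>i<m. picard v i x))) \<le> (c * L) ^ m / fact m * exp (c * L)" .
      qed (use c x c0 in auto)
      also have "\<dots> \<le> \<bar>h\<bar> * e" using M[OF m(2)] by (intro mult_left_mono) (auto simp: mult_ac)
      finally show "norm ((\<Sum>i<n. f' i x h) - g' x h) \<le> e * norm h" by (simp add: mult.commute)
    qed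
  qed auto
  then obtain g where g: "\<And>x. x \<in> {0..L} \<Longrightarrow> (\<lambda>n. picard v n x) sums g x"
    "\<And>x. x \<in> {0..L} \<Longrightarrow> (g has_derivative g' x) (at x within {0..L})" by blast
  have "g x = picard_sum v x" if "x \<in> {0..L}" for x
    using g(1)[OF that] by (simp add: picard_sum_def sums_iff)
  then have "(picard_sum v has_derivative g' s) (at s within {0..L})"
    using has_derivative_transform[OF s _ g(2)[OF s]] by metis
  then show ?thesis by (simp add: has_vector_derivative_def g'_def)
qed

end

lemma bounded_times:
  fixes c d :: "'a \<Rightarrow> 'b::real_normed_algebra"
  assumes "bounded (c ` S)" "bounded (d ` S)"
  shows "bounded ((\<lambda>E. c E * d E) ` S)"
proof -
  obtain A B where "\<And>E. E \<in> S \<Longrightarrow> norm (c E) \<le> A" "\<And>E. E \<in> S \<Longrightarrow> norm (d E) \<le> B"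
    using assms by (auto simp: bounded_iff)
  then have "norm (c E * d E) \<le> A * B" if "E \<in> S" for E
    using that norm_mult_ineq[of "c E" "d E"] 
    by (meson mult_mono norm_ge_zero order_trans)
  then show ?thesis unfolding bounded_iff by auto
qed

lemma bounded_const: "bounded ((\<lambda>E. c) ` S)"
  by (rule finite_imp_bounded) (auto intro: finite_subset[of _ "{c}"])

section \<open>The inner region\<close>

lemma lin_sum:
  assumes "finite I" "\<And>i. i \<in> I \<Longrightarrow> F i \<in> lin B" shows "(\<lambda>h p. \<Sum>i\<in>I. F i h p) \<in> lin B"
  using assms by (induction I rule: finite_induct) (auto intro: lin_zero lin_add)

text \<open>\<open>D 0\<close> is the smooth factor \<open>W\<close> and \<open>D n\<close> its
  \<open>n\<close>-th derivative. Carrying the whole family along names the Taylor coefficients at 0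
  and allows derivatives of all orders to occur in the WKB terms.\<close>

locale bohr_sommerfeld =
  fixes \<gamma> b \<delta>\<^sub>0 :: real and V :: "real \<Rightarrow> real" and D :: "nat \<Rightarrow> real \<Rightarrow> real" and K :: "real set"
  assumes gamma_pos: "\<gamma> > 0" and gamma_irrat: "\<gamma> \<notin> \<rat>" and b_pos: "b > 0"
    and V_cont: "continuous_on {0..b} V"
    and V_mono: "mono_on {0<..b} V"
    and V_eq: "\<And>x. x \<in> {0..b} \<Longrightarrow> V x = x powr \<gamma> * D 0 x"
    and D_deriv: "\<And>n x. x \<in> {0..b} \<Longrightarrow> (D n has_real_derivative D (Suc n) x) (at x within {0..b})"
    and K_bounded: "bounded K"
    and delta_pos: "\<delta>\<^sub>0 > 0"
    and gap: "\<And>E x. E \<in> K \<Longrightarrow> x \<in> {0..b} \<Longrightarrow> E - V x \<ge> \<delta>\<^sub>0"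
begin

text \<open>The potential is perturbative for \<open>0 \<le> t \<le> h powr (- \<kappa>)\<close> in the inner variable
  \<open>t = sqrt E * x / h\<close>: there \<open>h powr \<gamma> * t powr (\<gamma> + 1)\<close> is at most \<open>h powr (\<gamma> / 2)\<close>.\<close>
definition "\<kappa> = \<gamma> / (2 * (\<gamma> + 1))"

lemma kappa: "\<kappa> > 0" "\<kappa> < 1 / 2" "\<kappa> * (\<gamma> + 1) = \<gamma> / 2"
  using gamma_pos by (auto simp: \<kappa>_def field_simps)

lemma V_0: "V 0 = 0"
  using V_eq[of 0] b_pos by simp

lemma E_ge: "E \<in> K \<Longrightarrow> E \<ge> \<delta>\<^sub>0"
  using gap[of E 0] b_pos V_0 by simp

lemma E_pos: "E \<in> K \<Longrightarrow> E > 0"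
  using E_ge[of E] delta_pos by simp

lemma E_le: obtains M where "M > 0" "\<And>E. E \<in> K \<Longrightarrow> E \<le> M"
proof -
  obtain B where B: "\<And>E. E \<in> K \<Longrightarrow> norm E \<le> B" using K_bounded by (auto simp: bounded_iff)
  have "E \<le> max B 1" if "E \<in> K" for E using B[OF that] by simp
  then show ?thesis using that[of "max B 1"] by auto
qed

lemma bounded_E_powr: "bounded ((\<lambda>E. E powr a) ` K)"
proof -
  obtain M where M: "M > 0" "\<And>E. E \<in> K \<Longrightarrow> E \<le> M" using E_le by blast
  have "norm (E powr a) \<le> M powr a + \<delta>\<^sub>0 powr a" if "E \<in> K" for E
  proof (cases "a \<ge> 0")
    case True
    then have "E powr a \<le> M powr a" using M(2) E_pos that by (intro powr_mono2) (auto simp: less_imp_le)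
    then show ?thesis by (simp add: add_increasing2)
  next
    case False
    then have "E powr a \<le> \<delta>\<^sub>0 powr a" using E_ge[OF that] delta_pos by (intro powr_mono2') auto
    then show ?thesis by (simp add: add_increasing)
  qed
  then show ?thesis unfolding bounded_iff by auto
qed

lemma D_bounded: obtains B where "B \<ge> 0" "\<And>x. x \<in> {0..b} \<Longrightarrow> \<bar>D n x\<bar> \<le> B"
proof -
  have "continuous_on {0..b} (D n)"
    using D_deriv by (meson DERIV_continuous continuous_on_eq_continuous_within)
  then have "bounded (D n ` {0..b})" by (intro compact_imp_bounded compact_continuous_image) auto
  then obtain B where "\<And>x. x \<in> {0..b} \<Longrightarrow> \<bar>D n x\<bar> \<le> B"
    unfolding bounded_iff real_norm_def by blast
  then show ?thesis using that[of "max B 0"] by fastforce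
qed

lemma D_taylor:
  obtains C where "C \<ge> 0" "\<And>x. x \<in> {0..b} \<Longrightarrow> \<bar>D i x - (\<Sum>j\<le>J. D (i + j) 0 / fact j * x ^ j)\<bar> \<le> C * x ^ Suc J"
proof -
  obtain B where B: "B \<ge> 0" "\<And>x. x \<in> {0..b} \<Longrightarrow> \<bar>D (i + Suc J) x\<bar> \<le> B"
    using D_bounded by blast
  have "\<bar>D i x - (\<Sum>j\<le>J. D (i + j) 0 / fact j * x ^ j)\<bar> \<le> B / fact J * x ^ Suc J" if x: "x \<in> {0..b}" for x
  proof -
    have "norm (D (i + 0) x - (\<Sum>j\<le>J. D (i + j) 0 * (x - 0) ^ j / fact j)) \<le> B * norm (x - 0) ^ Suc J / fact J"
      by (rule field_Taylor[where S = "{0..b}" and f = "\<lambda>j. D (i + j)"])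
        (use x B D_deriv b_pos in auto)
    then show ?thesis using x by simp
  qed
  then show ?thesis using B that[of "B / fact J"] by simp
qed

text \<open>The substitution \<open>x = h * t / sqrt E\<close> turns the eigenvalue equation into
  \<open>u'' + u = vpot h E * u\<close>, with derivatives in \<open>t\<close>.\<close>

definition "vpot h E t = V (h * t / sqrt E) / E"

definition Pin :: "real \<Rightarrow> (real \<times> real) set" where
  "Pin h = {p. fst p \<in> K \<and> 0 \<le> snd p \<and> snd p \<le> h powr (- \<kappa>)}"

text \<open>The functions \<open>f\<close> of the stretched variable are universal: \<open>h\<close>
  and the energy enter only through the scalar factor. This separation makes it possible to expand
  \<open>f\<close> at infinity once and for all.\<close>

definition inB :: "(real \<Rightarrow> real \<times> real \<Rightarrow> complex) set" where
  "inB = {\<lambda>h p. of_real (c (fst p) * h powr (real m * \<gamma> + real n)) * f (snd p) |c m n f.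
            bounded (c ` K) \<and> osc \<gamma> 0 f}"

lemma Pin_ht_small:
  assumes "e > 0"
  shows "\<forall>\<^sub>F h in at_right 0. \<forall>p\<in>Pin h. h * snd p / sqrt (fst p) \<in> {0..e} \<and> 0 < h \<and>
     h * snd p \<in> {0..h powr (1 - \<kappa>)}"
proof -
  have "\<forall>\<^sub>F h in at_right 0. h powr (1 - \<kappa>) \<le> e * sqrt \<delta>\<^sub>0"
    using kappa delta_pos assms by (intro eventually_powr_le) auto
  then show ?thesis using eventually_small[OF zero_less_one]
  proof eventually_elim
    case (elim h)
    show ?case
    proof
      fix p assume p: "p \<in> Pin h"
      then have E: "sqrt \<delta>\<^sub>0 \<le> sqrt (fst p)" using E_ge by (auto simp: Pin_def)
      have "h * snd p \<le> h powr 1 * h powr (- \<kappa>)" using p elim by (auto simp: Pin_def intro: mult_left_mono)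
      also have "\<dots> = h powr (1 - \<kappa>)" by (subst powr_add[symmetric]) simp
      finally have 1: "h * snd p \<le> h powr (1 - \<kappa>)" .
      also have "\<dots> \<le> e * sqrt \<delta>\<^sub>0" by (rule elim(1))
      also have "\<dots> \<le> e * sqrt (fst p)" using E assms by simp
      finally have "h * snd p / sqrt (fst p) \<le> e"
        using E delta_pos by (simp add: divide_le_eq)
      then show "h * snd p / sqrt (fst p) \<in> {0..e} \<and> 0 < h \<and> h * snd p \<in> {0..h powr (1 - \<kappa>)}"
        using 1 p elim E_pos by (auto simp: Pin_def less_imp_le)
    qed
  qed
qed

lemma vpot_bound:
  obtains C where "C \<ge> 0" "\<forall>\<^sub>F h in at_right 0. \<forall>p\<in>Pin h. \<bar>vpot h (fst p) (snd p)\<bar> \<le> C * (h * snd p) powr \<gamma>"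
proof -
  obtain B where B: "B \<ge> 0" "\<And>x. x \<in> {0..b} \<Longrightarrow> \<bar>D 0 x\<bar> \<le> B" using D_bounded by blast
  define C where "C = B * ((1 / sqrt \<delta>\<^sub>0) powr \<gamma> / \<delta>\<^sub>0)"
  have "\<forall>\<^sub>F h in at_right 0. \<forall>p\<in>Pin h. \<bar>vpot h (fst p) (snd p)\<bar> \<le> C * (h * snd p) powr \<gamma>"
    using Pin_ht_small[OF b_pos]
  proof eventually_elim
    case (elim h)
    show ?case
    proof
      fix p assume p: "p \<in> Pin h"
      define E t where "E = fst p" and "t = snd p"
      have E: "E \<in> K" "E \<ge> \<delta>\<^sub>0" "E > 0" using p E_ge E_pos by (auto simp: Pin_def E_def)
      have x: "h * t / sqrt E \<in> {0..b}" "0 < h" "0 \<le> h * t" using elim p by (auto simp: E_def t_def)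
      have "\<bar>vpot h E t\<bar> = (h * t / sqrt E) powr \<gamma> * \<bar>D 0 (h * t / sqrt E)\<bar> / E"
        using E by (simp add: vpot_def V_eq[OF x(1)] abs_mult)
      also have "\<dots> \<le> (h * t / sqrt \<delta>\<^sub>0) powr \<gamma> * B / \<delta>\<^sub>0"
        using x E delta_pos gamma_pos B(1)
        by (intro frac_le mult_mono powr_mono2 B(2) divide_left_mono) auto
      also have "\<dots> = C * (h * t) powr \<gamma>"
        using powr_mult[of "h * t" "1 / sqrt \<delta>\<^sub>0" \<gamma>] by (simp add: C_def)
      finally show "\<bar>vpot h (fst p) (snd p)\<bar> \<le> C * (h * snd p) powr \<gamma>" by (simp add: E_def t_def)
    qed
  qed
  moreover have "C \<ge> 0" using B delta_pos by (simp add: C_def)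
  ultimately show ?thesis by (rule that[rotated])
qed

text \<open>The coefficient of \<open>(h * t) powr (\<gamma> + j)\<close> in the expansion of
  \<open>vpot\<close>: the power of \<open>E\<close> stems from \<open>x = h * t / sqrt E\<close>,
  the last division by \<open>E\<close> from the normalization of the equation.\<close>

definition "omg j E = D j 0 / fact j * (E powr (- (\<gamma> + real j) / 2) / E)"

lemma bounded_omg: "bounded (omg j ` K)"
proof -
  have "bounded ((\<lambda>E. D j 0 / fact j * (E powr (- (\<gamma> + real j) / 2) * E powr (-1))) ` K)"
    by (intro bounded_times bounded_E_powr bounded_const)
  also have "(\<lambda>E. D j 0 / fact j * (E powr (- (\<gamma> + real j) / 2) * E powr (-1))) ` K = omg j ` K"
    by (rule image_cong) (auto simp: omg_def E_pos powr_minus_divide dest: E_pos)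
  finally show ?thesis .
qed

definition "vtay J h E t = (\<Sum>j\<le>J. omg j E * (h * t) powr (\<gamma> + real j))"

lemma vpot_taylor:
  obtains C where "C \<ge> 0" "\<forall>\<^sub>F h in at_right 0. \<forall>p\<in>Pin h.
    \<bar>vpot h (fst p) (snd p) - vtay J h (fst p) (snd p)\<bar> \<le> C * (h * snd p) powr (\<gamma> + real (Suc J))"
proof -
  obtain B where B: "B \<ge> 0" "\<And>x. x \<in> {0..b} \<Longrightarrow> \<bar>D 0 x - (\<Sum>j\<le>J. D (0 + j) 0 / fact j * x ^ j)\<bar> \<le> B * x ^ Suc J"
    using D_taylor by blast
  define C where "C = B * ((1 / sqrt \<delta>\<^sub>0) powr (\<gamma> + real (Suc J)) / \<delta>\<^sub>0)"
  have "\<forall>\<^sub>F h in at_right 0. \<forall>p\<in>Pin h.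
    \<bar>vpot h (fst p) (snd p) - vtay J h (fst p) (snd p)\<bar> \<le> C * (h * snd p) powr (\<gamma> + real (Suc J))"
    using Pin_ht_small[OF b_pos]
  proof eventually_elim
    case (elim h)
    show ?case
    proof
      fix p assume p: "p \<in> Pin h"
      define E t where "E = fst p" and "t = snd p"
      define x where "x = h * t / sqrt E"
      have E: "E \<in> K" "E \<ge> \<delta>\<^sub>0" "E > 0" using p E_ge E_pos by (auto simp: Pin_def E_def)
      have x: "x \<in> {0..b}" "0 < h" "0 \<le> h * t" using elim p by (auto simp: E_def t_def x_def)
      have pw: "x powr (\<gamma> + real j) = x powr \<gamma> * x ^ j" for j
        using x by (cases "x = 0") (auto simp: powr_add powr_realpow)
      have xe: "x powr (\<gamma> + real j) = E powr (- (\<gamma> + real j) / 2) * (h * t) powr (\<gamma> + real j)" for j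
      proof -
        have "x powr (\<gamma> + real j) = (h * t) powr (\<gamma> + real j) * (E powr (-1/2)) powr (\<gamma> + real j)"
          unfolding x_def using E x(3) by (simp add: powr_divide powr_half_sqrt[symmetric] powr_powr powr_minus_divide)
        also have "(E powr (-1/2)) powr (\<gamma> + real j) = E powr (- (\<gamma> + real j) / 2)"
        proof -
          have "- 1 / 2 * (\<gamma> + real j) = - (\<gamma> + real j) / 2" by linarith
          then show ?thesis unfolding powr_powr by (rule arg_cong)
        qed
        finally show ?thesis by simp
      qed
      have "vtay J h E t = (\<Sum>j\<le>J. D j 0 / fact j * x powr (\<gamma> + real j)) / E"
        unfolding vtay_def omg_def xe by (simp add: sum_divide_distrib mult_ac)
      also have "\<dots> = x powr \<gamma> * (\<Sum>j\<le>J. D (0 + j) 0 / fact j * x ^ j) / E"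
        unfolding pw by (simp add: sum_distrib_left mult_ac)
      finally have "\<bar>vpot h E t - vtay J h E t\<bar> = \<bar>x powr \<gamma> * (D 0 x - (\<Sum>j\<le>J. D (0 + j) 0 / fact j * x ^ j)) / E\<bar>"
        by (simp add: vpot_def V_eq[OF x(1)] right_diff_distrib diff_divide_distrib flip: x_def)
      also have "\<dots> = x powr \<gamma> * \<bar>D 0 x - (\<Sum>j\<le>J. D (0 + j) 0 / fact j * x ^ j)\<bar> / E"
        using E by (simp add: abs_mult)
      also have "\<dots> \<le> x powr \<gamma> * (B * x ^ Suc J) / E"
        using E B(2)[OF x(1)] by (intro divide_right_mono mult_left_mono) auto
      also have "\<dots> = B * (x powr (\<gamma> + real (Suc J)) / E)" by (simp only: pw mult_ac times_divide_eq_right)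
      also have "\<dots> \<le> B * ((h * t / sqrt \<delta>\<^sub>0) powr (\<gamma> + real (Suc J)) / \<delta>\<^sub>0)"
        unfolding x_def using x E delta_pos gamma_pos B(1)
        by (intro mult_left_mono frac_le powr_mono2 divide_left_mono) auto
      also have "\<dots> = C * (h * t) powr (\<gamma> + real (Suc J))"
        using powr_mult[of "h * t" "1 / sqrt \<delta>\<^sub>0" "\<gamma> + real (Suc J)"] by (simp add: C_def)
      finally show "\<bar>vpot h (fst p) (snd p) - vtay J h (fst p) (snd p)\<bar> \<le> C * (h * snd p) powr (\<gamma> + real (Suc J))"
        by (simp add: E_def t_def)
    qed
  qed
  moreover have "C \<ge> 0" using B delta_pos by (simp add: C_def)
  ultimately show ?thesis by (rule that[rotated])
qed

end

lemma bigo_on_const_le: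
  assumes "bigo_on P r F"
  obtains C where "C > 0" "\<forall>\<^sub>F h in at_right 0. \<forall>p\<in>P h. norm (F h p) \<le> C * h powr r"
proof -
  obtain C where C: "C \<ge> 0" "\<forall>\<^sub>F h in at_right 0. \<forall>p\<in>P h. norm (F h p) \<le> C * h powr r"
    using assms by (rule bigo_onE)
  have "\<forall>\<^sub>F h in at_right 0. \<forall>p\<in>P h. norm (F h p) \<le> (C + 1) * h powr r"
    using C(2) by eventually_elim (auto simp: distrib_right intro: add_increasing2)
  with C(1) show ?thesis using that[of "C + 1"] by auto
qed

context bohr_sommerfeld
begin

lemma osc_Lop: "osc \<gamma> 0 f \<Longrightarrow> osc \<gamma> 0 (\<lambda>t. Lop t (f t))"
proof -
  assume f: "osc \<gamma> 0 f"
  have "osc \<gamma> 0 (\<lambda>t. 1 / (2 * \<i>) * (f t + (- 1) * (cis (2 * of_int (-1) * t) * cnj (f t))))"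
    by (intro osc_cmult osc_add osc_cis osc_cnj f)
  then show ?thesis by (simp add: Lop_def)
qed

lemma osc_inner_integral:
  assumes "osc \<gamma> 0 f"
  shows "osc \<gamma> 0 (\<lambda>s. integral {0..s} (\<lambda>t. of_real (t powr (\<gamma> + real j)) * Lop t (f t)))"
proof (intro osc_integral gamma_irrat osc_powr osc_Lop assms)
  show "\<gamma> + real j \<in> exps \<gamma> 1"
    unfolding exps_def by (rule CollectI, rule exI[of _ 1], rule exI[of _ "int j"]) auto
qed (use gamma_pos in auto)

lemma inB_I: "bounded (c ` K) \<Longrightarrow> osc \<gamma> 0 f \<Longrightarrow>
   (\<lambda>h p. of_real (c (fst p) * h powr (real m * \<gamma> + real n)) * f (snd p)) \<in> inB"
  unfolding inB_def by blast

text \<open>For the truncated potential the Picard step involves no further error. Each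
  \<open>(h * t) powr (\<gamma> + j)\<close> splits into a power of \<open>h\<close>, which raises
  the indices \<open>(m, n)\<close> to \<open>(m + 1, n + j)\<close>, and a power of
  \<open>t\<close> whose integral against an oscillating function is oscillating again.\<close>

lemma inner_integral_lin:
  assumes "g \<in> lin inB"
  shows "\<exists>G\<in>lin inB. \<forall>h>0. \<forall>E\<in>K. continuous_on {0..} (\<lambda>t. g h (E, t)) \<and> (\<forall>s\<ge>0.
     ((\<lambda>t. of_real (vtay J h E t) * Lop t (g h (E, t))) has_integral G h (E, s)) {0..s})"
  using assms
proof (induction g rule: lin.induct)
  case lin_zero
  show ?case by (rule bexI[OF _ lin.lin_zero]) auto
next
  case (lin_plus f g)
  from lin_plus.IH obtain G where G: "G \<in> lin inB"
    and G': "\<forall>h>0. \<forall>E\<in>K. continuous_on {0..} (\<lambda>t. g h (E, t)) \<and> (\<forall>s\<ge>0.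
     ((\<lambda>t. of_real (vtay J h E t) * Lop t (g h (E, t))) has_integral G h (E, s)) {0..s})" by blast
  obtain c m n q where f: "f = (\<lambda>h p. of_real (c (fst p) * h powr (real m * \<gamma> + real n)) * q (snd p))"
    "bounded (c ` K)" "osc \<gamma> 0 q" using lin_plus(1) unfolding inB_def by blast
  define I where "I = (\<lambda>j s. integral {0..s} (\<lambda>t. of_real (t powr (\<gamma> + real j)) * Lop t (q t)))"
  have qc: "continuous_on {0..s} q" for s
    using f(3) unfolding osc_def by (auto elim: continuous_on_subset)
  have I: "((\<lambda>t. of_real (t powr (\<gamma> + real j)) * Lop t (q t)) has_integral I j s) {0..s}" for j s
    unfolding I_def using gamma_pos
    by (intro integrable_integral integrable_continuous_real continuous_on_mult continuous_on_of_real
        continuous_on_Lop qc continuous_on_powr' continuous_on_id continuous_on_const) auto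
  define H where "H = (\<lambda>j h p. of_real ((omg j (fst p) * c (fst p)) * h powr (real (m+1) * \<gamma> + real (n + j))) * I j (snd p))"
  have H: "H j \<in> lin inB" for j
    unfolding H_def by (intro lin_base inB_I bounded_times bounded_omg f)
      (unfold I_def, rule osc_inner_integral[OF f(3)])
  show ?case
  proof (intro bexI[of _ "\<lambda>h p. (\<Sum>j\<le>J. H j h p) + G h p"] allI impI ballI conjI)
    fix h E :: real assume h: "0 < h" and E: "E \<in> K"
    have "continuous_on {0..} q" using f(3) by (simp add: osc_def)
    then show "continuous_on {0..} (\<lambda>t. f h (E, t) + g h (E, t))"
      unfolding f(1) fst_conv snd_conv by (intro continuous_intros G'[rule_format, OF h E, THEN conjunct1])
    fix s :: real assume s: "0 \<le> s"
    have "((\<lambda>t. \<Sum>j\<le>J. of_real (omg j E * c E * h powr (real (m+1) * \<gamma> + real (n + j))) *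
       (of_real (t powr (\<gamma> + real j)) * Lop t (q t))) has_integral (\<Sum>j\<le>J. H j h (E, s))) {0..s}"
      unfolding H_def fst_conv snd_conv by (intro has_integral_sum has_integral_mult_right I) auto
    from has_integral_add[OF this conjunct2[OF G'[rule_format, OF h E], rule_format, OF s]]
    show "((\<lambda>t. of_real (vtay J h E t) * Lop t (f h (E, t) + g h (E, t))) has_integral (\<Sum>j\<le>J. H j h (E, s)) + G h (E, s)) {0..s}"
    proof (rule has_integral_eq[rotated])
      fix t assume "t \<in> {0..s}"
      then have t: "0 \<le> t" by simp
      have "(h * t) powr (\<gamma> + real j) * h powr (real m * \<gamma> + real n) = h powr (real (m+1) * \<gamma> + real (n + j)) * t powr (\<gamma> + real j)" for j
      proof -
        have e: "real (m+1) * \<gamma> + real (n + j) = (\<gamma> + real j) + (real m * \<gamma> + real n)"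
          by (simp add: algebra_simps)
        show ?thesis
          unfolding e powr_add[of h "\<gamma> + real j"] using h t by (simp add: powr_mult)
      qed
      then have eq: "complex_of_real ((h * t) powr (\<gamma> + real j)) * of_real (h powr (real m * \<gamma> + real n)) = of_real (h powr (real (m+1) * \<gamma> + real (n + j))) * of_real (t powr (\<gamma> + real j))" for j
        by (metis of_real_mult)
      have "of_real (vtay J h E t) * Lop t (f h (E, t)) =
        (\<Sum>j\<le>J. of_real (omg j E) * of_real (c E) * (of_real ((h * t) powr (\<gamma> + real j)) * of_real (h powr (real m * \<gamma> + real n))) * Lop t (q t))"
        unfolding f(1) fst_conv snd_conv Lop_of_real_mult vtay_def
        by (simp add: sum_distrib_right sum_distrib_left mult_ac)
      also have "\<dots> = (\<Sum>j\<le>J. of_real (omg j E * c E * h powr (real (m+1) * \<gamma> + real (n + j))) *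
       (of_real (t powr (\<gamma> + real j)) * Lop t (q t)))"
        unfolding eq by (simp only: of_real_mult mult_ac)
      finally show "(\<Sum>j\<le>J. of_real (omg j E * c E * h powr (real (m+1) * \<gamma> + real (n + j))) *
       (of_real (t powr (\<gamma> + real j)) * Lop t (q t))) + of_real (vtay J h E t) * Lop t (g h (E, t))
         = of_real (vtay J h E t) * Lop t (f h (E, t) + g h (E, t))"
        by (simp only: Lop_add distrib_left)
    qed
  qed (intro lin_add lin_sum H G finite_atMost)
qed

lemma vtay_bound: "bigo_on Pin 0 (\<lambda>h p. of_real (vtay J h (fst p) (snd p)))"
proof -
  have "bigo_on Pin 0 (\<lambda>h p. of_real (omg j (fst p) * (h * snd p) powr (\<gamma> + real j)))" for j
  proof -
    obtain C where C: "\<And>E. E \<in> K \<Longrightarrow> \<bar>omg j E\<bar> \<le> C" using bounded_omg[of j]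
      unfolding bounded_iff real_norm_def by blast
    show ?thesis
    proof (rule bigo_onI[of _ _ "\<bar>C\<bar>"], use Pin_ht_small[OF b_pos] eventually_small[OF zero_less_one] in eventually_elim)
      case (elim h)
      show ?case
      proof
        fix p assume p: "p \<in> Pin h"
        have "h * snd p \<le> h powr (1 - \<kappa>)" using elim p by auto
        also have "\<dots> \<le> 1 powr (1 - \<kappa>)" using elim kappa by (intro powr_mono2) auto
        finally have "(h * snd p) powr (\<gamma> + real j) \<le> 1 powr (\<gamma> + real j)" using elim p gamma_pos
          by (intro powr_mono2) auto
        moreover have "\<bar>omg j (fst p)\<bar> \<le> \<bar>C\<bar>" using C[of "fst p"] p by (auto simp: Pin_def)
        ultimately have "\<bar>omg j (fst p)\<bar> * (h * snd p) powr (\<gamma> + real j) \<le> \<bar>C\<bar> * 1"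
          by (intro mult_mono) auto
        then show "norm (complex_of_real (omg j (fst p) * (h * snd p) powr (\<gamma> + real j))) \<le> \<bar>C\<bar> * h powr 0"
          using elim by (simp add: norm_mult abs_mult)
      qed
    qed
  qed
  from bigo_on_sum[OF finite_atMost[of J] this] show ?thesis
    unfolding vtay_def of_real_sum by simp
qed

lemma vpot_cont:
  "\<forall>\<^sub>F h in at_right 0. \<forall>E\<in>K. continuous_on {0..h powr (- \<kappa>)} (vpot h E)"
  using Pin_ht_small[OF b_pos]
proof eventually_elim
  case (elim h)
  show ?case
  proof
    fix E assume E: "E \<in> K"
    have "continuous_on {0..h powr (- \<kappa>)} (\<lambda>t. V (h * t / sqrt E))"
    proof (rule continuous_on_compose2[OF V_cont])
      show "(\<lambda>t. h * t / sqrt E) ` {0..h powr - \<kappa>} \<subseteq> {0..b}"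
        using elim E by (auto simp: Pin_def)
    qed (intro continuous_intros, use E_pos[OF E] in auto)
    then show "continuous_on {0..h powr (- \<kappa>)} (vpot h E)"
      unfolding vpot_def using E_pos[OF E] by (intro continuous_intros) auto
  qed
qed

lemma approx_inner_step:
  assumes F: "approx inB Pin (\<lambda>h p. F h (fst p) (snd p))"
    and cont: "\<forall>\<^sub>F h in at_right 0. \<forall>E\<in>K. continuous_on {0..h powr (- \<kappa>)} (F h E)"
    and bd: "bigo_on Pin 0 (\<lambda>h p. F h (fst p) (snd p))"
  shows "approx inB Pin (\<lambda>h p. integral {0..snd p} (\<lambda>t. of_real (vpot h (fst p) t) * Lop t (F h (fst p) t)))"
proof (unfold approx_def, rule allI)
  fix N :: real
  \<comment> \<open>Integration over a length of up to \<open>h powr (- \<kappa>)\<close> costs the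
    order \<open>\<kappa>\<close>, so the integrand is needed up to order
    \<open>abs N + \<kappa>\<close>. Since \<open>h * t\<close> is at most
    \<open>h powr (1 - \<kappa>)\<close> on \<open>Pin\<close>, this \<open>J\<close> brings the
    Taylor remainder to that order.\<close>
  define J where "J = nat \<lceil>(\<bar>N\<bar> + \<kappa>) / (1 - \<kappa>)\<rceil>"
  have "(\<bar>N\<bar> + \<kappa>) / (1 - \<kappa>) \<le> \<gamma> + real (Suc J)" unfolding J_def using gamma_pos by linarith
  then have J: "\<bar>N\<bar> + \<kappa> \<le> (1 - \<kappa>) * (\<gamma> + real (Suc J))"
    using kappa by (simp add: pos_divide_le_eq mult.commute)
  obtain g where g: "g \<in> lin inB" "bigo_on Pin (\<bar>N\<bar> + \<kappa>) (\<lambda>h p. F h (fst p) (snd p) - g h p)"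
    using F unfolding approx_def by blast
  obtain G where G: "G \<in> lin inB"
    and G': "\<forall>h>0. \<forall>E\<in>K. continuous_on {0..} (\<lambda>t. g h (E, t)) \<and> (\<forall>s\<ge>0.
     ((\<lambda>t. of_real (vtay J h E t) * Lop t (g h (E, t))) has_integral G h (E, s)) {0..s})"
    using inner_integral_lin[OF g(1), of J] by blast
  obtain C1 where C1: "C1 \<ge> 0" "\<forall>\<^sub>F h in at_right 0. \<forall>p\<in>Pin h.
    \<bar>vpot h (fst p) (snd p) - vtay J h (fst p) (snd p)\<bar> \<le> C1 * (h * snd p) powr (\<gamma> + real (Suc J))"
    by (rule vpot_taylor)
  obtain C2 where C2: "C2 > 0" "\<forall>\<^sub>F h in at_right 0. \<forall>p\<in>Pin h. norm (F h (fst p) (snd p)) \<le> C2 * h powr 0"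
    by (rule bigo_on_const_le[OF bd])
  obtain C3 where C3: "C3 > 0" "\<forall>\<^sub>F h in at_right 0. \<forall>p\<in>Pin h. norm (F h (fst p) (snd p) - g h p) \<le> C3 * h powr (\<bar>N\<bar> + \<kappa>)"
    by (rule bigo_on_const_le[OF g(2)])
  obtain C4 where C4: "C4 > 0" "\<forall>\<^sub>F h in at_right 0. \<forall>p\<in>Pin h. norm (complex_of_real (vtay J h (fst p) (snd p))) \<le> C4 * h powr 0"
    by (rule bigo_on_const_le[OF vtay_bound])
  have "bigo_on Pin \<bar>N\<bar> (\<lambda>h p. integral {0..snd p} (\<lambda>t. of_real (vpot h (fst p) t) * Lop t (F h (fst p) t)) - G h p)"
  proof (rule bigo_onI[of _ _ "C1 * C2 + C4 * C3"],
      use Pin_ht_small[OF b_pos] eventually_small[OF zero_less_one] C1(2) C2(2) C3(2) C4(2) cont vpot_cont in eventually_elim)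
    case (elim h)
    show ?case
    proof
      fix p assume p: "p \<in> Pin h"
      obtain E s where ps: "p = (E, s)" by fastforce
      have E: "E \<in> K" and s: "0 \<le> s" "s \<le> h powr (- \<kappa>)" using p by (auto simp: ps Pin_def)
      let ?f = "\<lambda>t. of_real (vpot h E t) * Lop t (F h E t)"
      let ?g = "\<lambda>t. of_real (vtay J h E t) * Lop t (g h (E, t))"
      have h: "0 < h" "h < 1" using elim by auto
      have "continuous_on {0..s} (vpot h E)" "continuous_on {0..s} (F h E)"
        using bspec[OF elim(8) E] bspec[OF elim(7) E] s
        by (meson atLeastatMost_subset_iff continuous_on_subset order_refl)+
      then have "?f integrable_on {0..s}"
        by (intro integrable_continuous_real continuous_intros)
      then have fi: "(?f has_integral integral {0..s} ?f) {0..s}" by (rule integrable_integral)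
      have "norm (integral {0..s} ?f - G h (E, s)) \<le> ((C1 * C2 + C4 * C3) * h powr (\<bar>N\<bar> + \<kappa>)) * measure lborel {0..s}"
      proof (rule has_integral_bound_real[OF _ finite.emptyI has_integral_diff[OF fi conjunct2[OF G'[rule_format, OF h(1) E], rule_format, OF s(1)]]])
        show "0 \<le> (C1 * C2 + C4 * C3) * h powr (\<bar>N\<bar> + \<kappa>)" using C1 C2 C3 C4 by simp
        fix t assume t: "t \<in> {0..s} - {}"
        then have pt: "(E, t) \<in> Pin h" using s E by (auto simp: Pin_def)
        have ht: "h * t \<in> {0..h powr (1 - \<kappa>)}" using elim pt by fastforce
        have "(h * t) powr (\<gamma> + real (Suc J)) \<le> (h powr (1 - \<kappa>)) powr (\<gamma> + real (Suc J))"
          using ht gamma_pos by (intro powr_mono2) auto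
        also have "\<dots> \<le> h powr (\<bar>N\<bar> + \<kappa>)"
          unfolding powr_powr using J h by (intro powr_mono') auto
        finally have "C1 * (h * t) powr (\<gamma> + real (Suc J)) \<le> C1 * h powr (\<bar>N\<bar> + \<kappa>)"
          using C1 by (intro mult_left_mono) auto
        then have 1: "\<bar>vpot h E t - vtay J h E t\<bar> \<le> C1 * h powr (\<bar>N\<bar> + \<kappa>)"
          using elim(3) pt by fastforce
        have 2: "norm (F h E t) \<le> C2" using elim(4) pt h by fastforce
        have 3: "norm (F h E t - g h (E, t)) \<le> C3 * h powr (\<bar>N\<bar> + \<kappa>)" using elim(5) pt by fastforce
        have 4: "\<bar>vtay J h E t\<bar> \<le> C4" using elim(6) pt h by fastforce
        have "?f t - ?g t = of_real (vpot h E t - vtay J h E t) * Lop t (F h E t) + of_real (vtay J h E t) * Lop t (F h E t - g h (E, t))"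
          unfolding Lop_diff of_real_diff left_diff_distrib right_diff_distrib by simp
        also have "norm \<dots> \<le> \<bar>vpot h E t - vtay J h E t\<bar> * norm (F h E t) + \<bar>vtay J h E t\<bar> * norm (F h E t - g h (E, t))"
          by (rule norm_triangle_le, unfold norm_mult norm_of_real)
            (intro add_mono mult_left_mono norm_Lop abs_ge_zero)
        also have "\<dots> \<le> (C1 * h powr (\<bar>N\<bar> + \<kappa>)) * C2 + C4 * (C3 * h powr (\<bar>N\<bar> + \<kappa>))"
          using 1 2 3 4 C1 C4 by (intro add_mono mult_mono) auto
        finally show "norm (?f t - ?g t) \<le> (C1 * C2 + C4 * C3) * h powr (\<bar>N\<bar> + \<kappa>)"
          by (simp add: algebra_simps)
      qed
      also have "\<dots> \<le> ((C1 * C2 + C4 * C3) * h powr (\<bar>N\<bar> + \<kappa>)) * h powr (- \<kappa>)"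
        using s C1 C2 C3 C4 by (intro mult_left_mono) auto
      also have "\<dots> = (C1 * C2 + C4 * C3) * (h powr (\<bar>N\<bar> + \<kappa>) * h powr (- \<kappa>))" by simp
      also have "h powr (\<bar>N\<bar> + \<kappa>) * h powr (- \<kappa>) = h powr \<bar>N\<bar>" by (subst powr_add[symmetric]) simp
      finally show "norm (integral {0..snd p} (\<lambda>t. of_real (vpot h (fst p) t) * Lop t (F h (fst p) t)) - G h p)
          \<le> (C1 * C2 + C4 * C3) * h powr \<bar>N\<bar>" by (simp add: ps)
    qed
  qed
  from bigo_on_mono[OF this abs_ge_self] show "\<exists>G\<in>lin inB. bigo_on Pin N (\<lambda>h p. integral {0..snd p} (\<lambda>t. of_real (vpot h (fst p) t) * Lop t (F h (fst p) t)) - G h p)"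
    using G by blast
qed

text \<open>A bound for the potential times the length of the interval is the quantity that controls
  the Picard series; the bound may depend on the point \<open>p\<close>, only the product has to be
  uniform.\<close>

lemma vpot_integral_small:
  obtains C where "C > 0" "\<forall>\<^sub>F h in at_right 0. \<forall>p\<in>Pin h. \<exists>c\<ge>0.
     (\<forall>t\<in>{0..snd p}. \<bar>vpot h (fst p) t\<bar> \<le> c) \<and> c * snd p \<le> C * h powr (\<gamma> / 2)"
proof -
  obtain C where C: "C \<ge> 0" "\<forall>\<^sub>F h in at_right 0. \<forall>p\<in>Pin h. \<bar>vpot h (fst p) (snd p)\<bar> \<le> C * (h * snd p) powr \<gamma>"
    by (rule vpot_bound)
  have "\<forall>\<^sub>F h in at_right 0. \<forall>p\<in>Pin h. \<exists>c\<ge>0.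
     (\<forall>t\<in>{0..snd p}. \<bar>vpot h (fst p) t\<bar> \<le> c) \<and> c * snd p \<le> (C + 1) * h powr (\<gamma> / 2)"
    using C(2) Pin_ht_small[OF b_pos]
  proof eventually_elim
    case (elim h)
    show ?case
    proof (intro ballI exI[of _ "C * (h * snd p) powr \<gamma>" for p] conjI)
      fix p assume p: "p \<in> Pin h"
      have h: "h > 0" using elim p by blast
      show "0 \<le> C * (h * snd p) powr \<gamma>" using C by simp
      { fix t assume t: "t \<in> {0..snd p}"
        then have "(fst p, t) \<in> Pin h" using p by (auto simp: Pin_def)
        then have "\<bar>vpot h (fst p) t\<bar> \<le> C * (h * t) powr \<gamma>" using elim(1) by fastforce
        also have "\<dots> \<le> C * (h * snd p) powr \<gamma>" using t h C gamma_pos by (intro mult_left_mono powr_mono2) auto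
        finally show "\<bar>vpot h (fst p) t\<bar> \<le> C * (h * snd p) powr \<gamma>" . }
      have s: "0 \<le> snd p" "snd p \<le> h powr (- \<kappa>)" using p by (auto simp: Pin_def)
      have "h \<ge> 0" using h by simp
      have "C * (h * snd p) powr \<gamma> * snd p = C * (h powr \<gamma> * (snd p powr \<gamma> * snd p))"
        using h s by (simp add: powr_mult)
      also have "\<dots> \<le> (C + 1) * (h powr \<gamma> * ((h powr (- \<kappa>)) powr \<gamma> * h powr (- \<kappa>)))"
        using C s gamma_pos h by (intro mult_mono powr_mono2) auto
      also have "h powr \<gamma> * ((h powr (- \<kappa>)) powr \<gamma> * h powr (- \<kappa>)) = h powr (\<gamma> - \<kappa> * (\<gamma> + 1))"
        unfolding powr_powr powr_add[symmetric] by (simp add: algebra_simps)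
      also have "\<gamma> - \<kappa> * (\<gamma> + 1) = \<gamma> / 2" using kappa(3) by simp
      finally show "C * (h * snd p) powr \<gamma> * snd p \<le> (C + 1) * h powr (\<gamma> / 2)" .
    qed
  qed
  then show ?thesis using C that[of "C + 1"] by auto
qed

text \<open>Every Picard term gains the order \<open>\<gamma> / 2\<close>, so partial sums reach any
  order; the exponential in the tail estimate is bounded because its argument is eventually at most
  1.\<close>

lemma picard_inner_small: "bigo_on Pin (\<gamma> / 2 * real n) (\<lambda>h p. picard_sum (vpot h (fst p)) (snd p) - (\<Sum>m<n. picard (vpot h (fst p)) m (snd p)))"
  and picard_inner_bounded: "bigo_on Pin 0 (\<lambda>h p. picard (vpot h (fst p)) m (snd p))"
proof -
  obtain C where C: "C > 0" "\<forall>\<^sub>F h in at_right 0. \<forall>p\<in>Pin h. \<exists>c\<ge>0.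
     (\<forall>t\<in>{0..snd p}. \<bar>vpot h (fst p) t\<bar> \<le> c) \<and> c * snd p \<le> C * h powr (\<gamma> / 2)"
    by (rule vpot_integral_small)
  have "\<forall>\<^sub>F h in at_right 0. h powr (\<gamma> / 2) \<le> 1 / C"
    using C gamma_pos by (intro eventually_powr_le) auto
  with C(2) vpot_cont eventually_small[OF zero_less_one] have ev: "\<forall>\<^sub>F h in at_right 0. \<forall>p\<in>Pin h.
      norm (picard (vpot h (fst p)) m (snd p)) \<le> 1 \<and>
      norm (picard_sum (vpot h (fst p)) (snd p) - (\<Sum>m<n. picard (vpot h (fst p)) m (snd p))) \<le> (C ^ n * exp 1) * h powr (\<gamma> / 2 * real n)"
    for n m
  proof eventually_elim
    case (elim h)
    show ?case
    proof
      fix p assume p: "p \<in> Pin h"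
      then obtain c where c: "c \<ge> 0" "\<And>t. t\<in>{0..snd p} \<Longrightarrow> \<bar>vpot h (fst p) t\<bar> \<le> c" "c * snd p \<le> C * h powr (\<gamma> / 2)"
        using elim by blast
      have s: "0 \<le> snd p" "snd p \<le> h powr (- \<kappa>)" "fst p \<in> K" using p by (auto simp: Pin_def)
      have h: "h > 0" using elim by simp
      have cs: "0 \<le> c * snd p" using c s by simp
      have vc: "continuous_on {0..h powr (- \<kappa>)} (vpot h (fst p))" using elim s by auto
      have "C * h powr (\<gamma> / 2) \<le> C * (1 / C)" using elim C by (intro mult_left_mono) auto
      then have cs1: "c * snd p \<le> 1" using c(3) C by simp
      have "norm (picard (vpot h (fst p)) m (snd p)) \<le> (c * snd p) ^ m / fact m"
        using picard_bound[OF vc s(2) c(2), of "snd p"] s by simp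
      also have "\<dots> \<le> 1 / 1" using cs cs1 by (intro frac_le power_le_one) auto
      finally have 1: "norm (picard (vpot h (fst p)) m (snd p)) \<le> 1" by simp
      have "norm (picard_sum (vpot h (fst p)) (snd p) - (\<Sum>m<n. picard (vpot h (fst p)) m (snd p))) \<le> (c * snd p) ^ n / fact n * exp (c * snd p)"
        using picard_sum_bound(2)[OF vc s(2) c(2), of "snd p"] s by simp
      also have "\<dots> \<le> (C * h powr (\<gamma> / 2)) ^ n / 1 * exp 1"
        using power_mono[OF c(3) cs, of n] cs cs1 C by (intro mult_mono frac_le) auto
      also have "\<dots> = (C ^ n * exp 1) * h powr (\<gamma> / 2 * real n)"
        using h by (simp add: power_mult_distrib powr_powr powr_realpow[symmetric])
      finally show "norm (picard (vpot h (fst p)) m (snd p)) \<le> 1 \<and>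
      norm (picard_sum (vpot h (fst p)) (snd p) - (\<Sum>m<n. picard (vpot h (fst p)) m (snd p))) \<le> (C ^ n * exp 1) * h powr (\<gamma> / 2 * real n)"
        using 1 by blast
    qed
  qed
  show "bigo_on Pin (\<gamma> / 2 * real n) (\<lambda>h p. picard_sum (vpot h (fst p)) (snd p) - (\<Sum>m<n. picard (vpot h (fst p)) m (snd p)))"
    by (rule bigo_onI[of _ _ "C ^ n * exp 1"], use ev[of 0 n] in eventually_elim) auto
  show "bigo_on Pin 0 (\<lambda>h p. picard (vpot h (fst p)) m (snd p))"
    by (rule bigo_onI[of _ _ 1], use ev[of m 0] eventually_small[OF zero_less_one] in eventually_elim) auto
qed

lemma approx_picard: "approx inB Pin (\<lambda>h p. picard (vpot h (fst p)) m (snd p))"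
proof (induction m)
  case 0
  have "(\<lambda>h p. of_real ((\<lambda>E. 1) (fst p) * h powr (real 0 * \<gamma> + real 0)) * (\<lambda>t. 1) (snd p)) \<in> inB"
    by (intro inB_I bounded_const osc_const)
  from approx_base[OF this] show ?case
  proof (rule approx_cong)
    show "\<forall>\<^sub>F h in at_right 0. \<forall>p\<in>Pin h. of_real ((\<lambda>E. 1) (fst p) * h powr (real 0 * \<gamma> + real 0)) * (\<lambda>t. 1) (snd p) = picard (vpot h (fst p)) 0 (snd p)"
      using eventually_small[OF zero_less_one] by eventually_elim auto
  qed
next
  case (Suc m)
  have "approx inB Pin (\<lambda>h p. integral {0..snd p} (\<lambda>t. of_real (vpot h (fst p) t) * Lop t (picard (vpot h (fst p)) m t)))"
  proof (rule approx_inner_step[where F = "\<lambda>h E. picard (vpot h E) m"])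
    show "\<forall>\<^sub>F h in at_right 0. \<forall>E\<in>K. continuous_on {0..h powr - \<kappa>} (picard (vpot h E) m)"
      using vpot_cont by eventually_elim (auto intro: picard_deriv_and_cont)
  qed (use Suc picard_inner_bounded in auto)
  then show ?case by simp
qed

lemma approx_picard_sum: "approx inB Pin (\<lambda>h p. picard_sum (vpot h (fst p)) (snd p))"
proof (rule approx_limit)
  fix N :: real
  define n where "n = nat \<lceil>N / (\<gamma> / 2)\<rceil>"
  have "N / (\<gamma> / 2) \<le> real n" unfolding n_def by linarith
  then have "N \<le> \<gamma> / 2 * real n" using gamma_pos by (simp add: field_simps)
  then have "bigo_on Pin N (\<lambda>h p. picard_sum (vpot h (fst p)) (snd p) - (\<Sum>m<n. picard (vpot h (fst p)) m (snd p)))"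
    by (rule bigo_on_mono[OF picard_inner_small])
  then show "\<exists>G. approx inB Pin G \<and> bigo_on Pin N (\<lambda>h p. picard_sum (vpot h (fst p)) (snd p) - G h p)"
    by (intro exI conjI) (auto intro!: approx_sum approx_picard)
qed

text \<open>The matching point is \<open>t = pi * n\<close>, where all oscillating factors \<open>cis (2 * l * t)\<close> equal \<open>1\<close>;
  \<open>Pmix\<close> is the range of \<open>n\<close> in which the inner and the outer approximation are both valid.\<close>
definition mixB :: "(real \<Rightarrow> real \<times> nat \<Rightarrow> complex) set" where
  "mixB = {\<lambda>h p. c (fst p) * of_real (h powr (real m * \<gamma> + real n) * real (snd p) powr \<alpha>) |c m n \<alpha>.
     bounded (c ` K)}"

definition Pmix :: "real \<Rightarrow> (real \<times> nat) set" where
  "Pmix h = {p. fst p \<in> K \<and> h powr (- \<kappa> / 4) \<le> real (snd p) \<and> real (snd p) \<le> h powr (- \<kappa> / 2)}"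

lemma mixB_I: "bounded (c ` K) \<Longrightarrow>
   (\<lambda>h p. c (fst p) * of_real (h powr (real m * \<gamma> + real n) * real (snd p) powr \<alpha>)) \<in> mixB"
  unfolding mixB_def by blast

lemma n_powr_bigo: "\<exists>r. bigo_on Pmix r (\<lambda>h p. of_real (real (snd p) powr \<alpha>))"
proof (intro exI bigo_onI[of _ _ 1])
  show "\<forall>\<^sub>F h in at_right 0. \<forall>p\<in>Pmix h. norm (complex_of_real (real (snd p) powr \<alpha>)) \<le> 1 * h powr (- \<kappa> / 2 * \<bar>\<alpha>\<bar>)"
    using eventually_small[OF zero_less_one]
  proof eventually_elim
    case (elim h)
    show ?case
    proof
      fix p assume p: "p \<in> Pmix h"
      have "h powr 0 \<le> h powr (- \<kappa> / 4)" using elim kappa by (intro powr_mono') auto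
      then have n: "1 \<le> real (snd p)" using p elim by (auto simp: Pmix_def)
      then have "real (snd p) powr \<alpha> \<le> real (snd p) powr \<bar>\<alpha>\<bar>" by (intro powr_mono) auto
      also have "\<dots> \<le> (h powr (- \<kappa> / 2)) powr \<bar>\<alpha>\<bar>" using p n by (intro powr_mono2) (auto simp: Pmix_def)
      finally show "norm (complex_of_real (real (snd p) powr \<alpha>)) \<le> 1 * h powr (- \<kappa> / 2 * \<bar>\<alpha>\<bar>)" by (simp add: powr_powr)
    qed
  qed
qed

lemma bigo_on_coeff:
  assumes "bounded (c ` K)" "\<And>h p. p \<in> P h \<Longrightarrow> fst p \<in> K"
  shows "bigo_on P 0 (\<lambda>h p. c (fst p) :: complex)"
proof -
  obtain B where B: "\<And>E. E \<in> K \<Longrightarrow> norm (c E) \<le> B" using assms(1) unfolding bounded_iff by blast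
  show ?thesis
    by (rule bigo_onI[of _ _ B], use eventually_small[OF zero_less_one] in eventually_elim)
      (use B assms in auto)
qed

lemma bigo_on_h_powr: "bigo_on P r (\<lambda>h p. of_real (h powr r))"
  by (rule bigo_onI[of _ _ 1]) auto

lemma Pmix_K: "p \<in> Pmix h \<Longrightarrow> fst p \<in> K"
  by (simp add: Pmix_def)

lemma gauge_mix: "gauge_basis mixB Pmix"
  unfolding gauge_basis_def
proof (intro conjI ballI allI)
  show "\<exists>e\<in>mixB. \<forall>\<^sub>F h in at_right 0. \<forall>p\<in>Pmix h. e h p = 1"
  proof (rule bexI)
    show "(\<lambda>h p. (\<lambda>E. 1) (fst p) * of_real (h powr (real 0 * \<gamma> + real 0) * real (snd p) powr 0)) \<in> mixB"
      by (rule mixB_I[OF bounded_const])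
    show "\<forall>\<^sub>F h in at_right 0. \<forall>p\<in>Pmix h.
       (\<lambda>E. 1) (fst p) * complex_of_real (h powr (real 0 * \<gamma> + real 0) * real (snd p) powr 0) = 1"
      using eventually_small[OF zero_less_one]
    proof eventually_elim
      case (elim h)
      have "h powr (- \<kappa> / 4) > 0" using elim by simp
      then show ?case using elim by (auto simp: Pmix_def)
    qed
  qed
  fix f assume "f \<in> mixB"
  then obtain c m n \<alpha> where f: "f = (\<lambda>h p. c (fst p) * of_real (h powr (real m * \<gamma> + real n) * real (snd p) powr \<alpha>))"
    and c: "bounded (c ` K)" unfolding mixB_def by blast
  obtain r where r: "bigo_on Pmix r (\<lambda>h p. of_real (real (snd p) powr \<alpha>))" using n_powr_bigo by blast
  have "bigo_on Pmix (0 + (real m * \<gamma> + real n) + r)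
     (\<lambda>h p. c (fst p) * of_real (h powr (real m * \<gamma> + real n)) * of_real (real (snd p) powr \<alpha>))"
    by (intro bigo_on_mult bigo_on_coeff c Pmix_K bigo_on_h_powr r)
  then show "\<exists>r. bigo_on Pmix r f" unfolding f of_real_mult mult.assoc[symmetric] by blast
  { fix d :: complex
    have "(\<lambda>h p. (d * c (fst p)) * of_real (h powr (real m * \<gamma> + real n) * real (snd p) powr \<alpha>)) \<in> mixB"
      by (rule mixB_I[OF bounded_times[OF bounded_const c]])
    then show "(\<lambda>h p. d * f h p) \<in> mixB" by (simp add: f mult.assoc) }
  fix g assume "g \<in> mixB"
  then obtain d k l \<beta> where g: "g = (\<lambda>h p. d (fst p) * of_real (h powr (real k * \<gamma> + real l) * real (snd p) powr \<beta>))"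
    and d: "bounded (d ` K)" unfolding mixB_def by blast
  have "(\<lambda>h p. (c (fst p) * d (fst p)) * of_real (h powr (real (m + k) * \<gamma> + real (n + l)) * real (snd p) powr (\<alpha> + \<beta>))) \<in> mixB"
    by (rule mixB_I[OF bounded_times[OF c d]])
  also have "(\<lambda>h p. (c (fst p) * d (fst p)) * of_real (h powr (real (m + k) * \<gamma> + real (n + l)) * real (snd p) powr (\<alpha> + \<beta>)))
     = (\<lambda>h p. f h p * g h p)"
  proof (intro ext)
    fix h :: real and p :: "real \<times> nat"
    have "real (m + k) * \<gamma> + real (n + l) = (real m * \<gamma> + real n) + (real k * \<gamma> + real l)"
      by (simp add: algebra_simps)
    then show "(c (fst p) * d (fst p)) * of_real (h powr (real (m + k) * \<gamma> + real (n + l)) * real (snd p) powr (\<alpha> + \<beta>)) = f h p * g h p"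
      unfolding f g by (simp only: powr_add of_real_mult mult_ac)
  qed
  finally show "(\<lambda>h p. f h p * g h p) \<in> mixB" .
qed

section \<open>Elimination of the matching point\<close>

lemma Pmix_large:
  "\<forall>\<^sub>F h in at_right 0. \<forall>p\<in>Pmix h. c \<le> real (snd p)"
proof -
  define m where "m = max c 1"
  have m: "c \<le> m" "1 \<le> m" by (auto simp: m_def)
  have "\<forall>\<^sub>F h in at_right 0. h powr (\<kappa> / 4) \<le> 1 / m"
    using kappa m by (intro eventually_powr_le) auto
  then show ?thesis using eventually_small[OF zero_less_one]
  proof eventually_elim
    case (elim h)
    have "m \<le> 1 / h powr (\<kappa> / 4)" using elim m by (simp add: field_simps)
    also have "\<dots> = h powr (- \<kappa> / 4)" by (simp add: powr_minus_divide)
    finally have "c \<le> h powr (- \<kappa> / 4)" using m by linarith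
    then show ?case by (auto simp: Pmix_def)
  qed
qed

text \<open>\<open>Pmix\<close> ends at \<open>h powr (- \<kappa> / 2)\<close> instead of
  \<open>h powr (- \<kappa>)\<close>; the spare half of the exponent absorbs the factor
  \<open>pi\<close>.\<close>

lemma Pmix_Pin:
  "\<forall>\<^sub>F h in at_right 0. \<forall>p\<in>Pmix h. (fst p, pi * real (snd p)) \<in> Pin h"
proof -
  have "\<forall>\<^sub>F h in at_right 0. h powr (\<kappa> / 2) \<le> 1 / pi"
    using kappa by (intro eventually_powr_le) auto
  then show ?thesis using eventually_small[OF zero_less_one]
  proof eventually_elim
    case (elim h)
    show ?case
    proof
      fix p assume p: "p \<in> Pmix h"
      have "pi \<le> 1 / h powr (\<kappa> / 2)" using elim by (simp add: field_simps)
      also have "\<dots> = h powr (- \<kappa> / 2)" by (simp add: powr_minus_divide)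
      finally have "pi * real (snd p) \<le> h powr (- \<kappa> / 2) * h powr (- \<kappa> / 2)"
        using p by (intro mult_mono) (auto simp: Pmix_def)
      also have "\<dots> = h powr (- \<kappa>)" by (subst powr_add[symmetric]) simp
      finally show "(fst p, pi * real (snd p)) \<in> Pin h" using p by (auto simp: Pin_def Pmix_def)
    qed
  qed
qed

lemma approx_Pin_Pmix:
  assumes "approx inB Pin F"
  shows "approx mixB Pmix (\<lambda>h p. F h (fst p, pi * real (snd p)))"
proof -
  note sub = Pmix_Pin
  have base: "approx mixB Pmix (\<lambda>h p. f h (fst p, pi * real (snd p)))" if f: "f \<in> inB" for f
  proof -
    obtain c m n q where f: "f = (\<lambda>h p. of_real (c (fst p) * h powr (real m * \<gamma> + real n)) * q (snd p))"
      and c: "bounded (c ` K)" and q: "osc \<gamma> 0 q" using f unfolding inB_def by blast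
    have c': "bounded ((\<lambda>E. complex_of_real (c E)) ` K)" using c by (simp add: bounded_iff)
    have "approx mixB Pmix (\<lambda>h p. q (pi * real (snd p)))"
    proof (rule approx_limit)
      fix N :: real
      \<comment> \<open>On \<open>Pmix\<close> one has
        \<open>t \<ge> n \<ge> h powr (- \<kappa> / 4)\<close>, so a decay
        \<open>t powr (- r)\<close> is worth \<open>h powr (r * \<kappa> / 4)\<close>. This explains
        the exponent \<open>abs N * 4 / \<kappa>\<close>.\<close>
      obtain g C where g: "g \<in> oscspan \<gamma> 0" and C: "\<And>t. t\<ge>1 \<Longrightarrow> norm (q t - g t) \<le> C * t powr (- (\<bar>N\<bar> * 4 / \<kappa>))"
        using q unfolding osc_def by blast
      \<comment> \<open>The approximable functions themselves serve as the base set: the sum is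
        built up term by term and then collapsed, because sums of approximable functions are
        approximable.\<close>
      have "(\<lambda>h p. g (pi * real (snd p))) \<in> lin {f. approx mixB Pmix f}" using g
      proof (induction g rule: oscspan.induct)
        case osc_zero then show ?case by (rule lin_zero)
      next
        case (osc_plus \<alpha> g d l)
        have "approx mixB Pmix (\<lambda>h p. d * (of_real ((pi * real (snd p)) powr \<alpha>) * cis (2 * of_int l * (pi * real (snd p)))))"
        proof (rule approx_cong[OF approx_base])
          show "(\<lambda>h p. (\<lambda>E. d * of_real (pi powr \<alpha>)) (fst p) * of_real (h powr (real 0 * \<gamma> + real 0) * real (snd p) powr \<alpha>)) \<in> mixB"
            by (rule mixB_I[OF bounded_const])
          show "\<forall>\<^sub>F h in at_right 0. \<forall>p\<in>Pmix h. (\<lambda>E. d * of_real (pi powr \<alpha>)) (fst p) * of_real (h powr (real 0 * \<gamma> + real 0) * real (snd p) powr \<alpha>) =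
             d * (of_real ((pi * real (snd p)) powr \<alpha>) * cis (2 * of_int l * (pi * real (snd p))))"
            using eventually_small[OF zero_less_one]
          proof eventually_elim
            case (elim h)
            have "cis (2 * of_int l * (pi * real n)) = 1" for n
            proof -
              have "2 * of_int l * (pi * real n) = 2 * pi * of_int (l * int n)" by simp
              then show ?thesis using cis_multiple_2pi[of "of_int (l * int n)"] by (metis Ints_of_int)
            qed
            then show ?case using elim by (auto simp: powr_mult)
          qed
        qed
        then show ?case by (intro lin_plus osc_plus) auto
      qed
      then have "approx mixB Pmix (\<lambda>h p. g (pi * real (snd p)))"
        by (induction rule: lin.induct) (auto intro: approx_zero approx_add)
      moreover have "bigo_on Pmix \<bar>N\<bar> (\<lambda>h p. q (pi * real (snd p)) - g (pi * real (snd p)))"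
      proof (rule bigo_onI[of _ _ "\<bar>C\<bar>"], use Pmix_large[of 1] eventually_small[OF zero_less_one] in eventually_elim)
        case (elim h)
        show ?case
        proof
          fix p assume p: "p \<in> Pmix h"
          then have n: "real (snd p) \<ge> 1" using elim by blast
          have pn: "1 * real (snd p) \<le> pi * real (snd p)" using pi_ge_two by (intro mult_right_mono) auto
          then have "norm (q (pi * real (snd p)) - g (pi * real (snd p))) \<le> C * (pi * real (snd p)) powr (- (\<bar>N\<bar> * 4 / \<kappa>))"
            using n by (intro C) linarith
          also have "\<dots> \<le> \<bar>C\<bar> * (h powr (- \<kappa> / 4)) powr (- (\<bar>N\<bar> * 4 / \<kappa>))"
          proof (intro mult_mono powr_mono2')
            show "- (\<bar>N\<bar> * 4 / \<kappa>) \<le> 0" using kappa by simp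
            show "h powr (- \<kappa> / 4) \<le> pi * real (snd p)" using pn p by (auto simp: Pmix_def)
          qed (use elim in auto)
          also have "(h powr (- \<kappa> / 4)) powr (- (\<bar>N\<bar> * 4 / \<kappa>)) = h powr \<bar>N\<bar>"
            unfolding powr_powr using kappa by simp
          finally show "norm (q (pi * real (snd p)) - g (pi * real (snd p))) \<le> \<bar>C\<bar> * h powr \<bar>N\<bar>" .
        qed
      qed
      ultimately show "\<exists>G. approx mixB Pmix G \<and> bigo_on Pmix N (\<lambda>h p. q (pi * real (snd p)) - G h p)"
        by (intro exI[of _ "\<lambda>h p. g (pi * real (snd p))"]) (auto elim: bigo_on_mono)
    qed
    moreover have "approx mixB Pmix (\<lambda>h p. of_real (c (fst p) * h powr (real m * \<gamma> + real n)))"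
    proof (rule approx_cong[OF approx_base[OF mixB_I[OF c', of m n 0]]])
      show "\<forall>\<^sub>F h in at_right 0. \<forall>p\<in>Pmix h. of_real (c (fst p)) * complex_of_real (h powr (real m * \<gamma> + real n) * real (snd p) powr 0) = of_real (c (fst p) * h powr (real m * \<gamma> + real n))"
        using Pmix_large[of 1] by eventually_elim auto
    qed
    ultimately show ?thesis unfolding f fst_conv snd_conv by (intro approx_mult[OF gauge_mix])
  qed
  have lin: "approx mixB Pmix (\<lambda>h p. f h (fst p, pi * real (snd p)))" if "f \<in> lin inB" for f
    using that by (induction f rule: lin.induct) (auto intro: approx_zero approx_add base)
  show ?thesis
  proof (rule approx_limit)
    fix N
    obtain g where g: "g \<in> lin inB" "bigo_on Pin N (\<lambda>h p. F h p - g h p)" using assms by (auto simp: approx_def)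
    obtain C where C: "\<forall>\<^sub>F h in at_right 0. \<forall>p\<in>Pin h. norm (F h p - g h p) \<le> C * h powr N"
      using g(2) by (auto simp: bigo_on_def)
    have "bigo_on Pmix N (\<lambda>h p. F h (fst p, pi * real (snd p)) - g h (fst p, pi * real (snd p)))"
      by (rule bigo_onI[of _ _ C], use C sub in eventually_elim) auto
    then show "\<exists>G. approx mixB Pmix G \<and> bigo_on Pmix N (\<lambda>h p. F h (fst p, pi * real (snd p)) - G h p)"
      using lin[OF g(1)] by blast
  qed
qed

lemma bigo_Pin_Pmix:
  assumes "bigo_on Pin r F"
  shows "bigo_on Pmix r (\<lambda>h p. F h (fst p, pi * real (snd p)))"
proof -
  note sub = Pmix_Pin
  obtain C where C: "\<forall>\<^sub>F h in at_right 0. \<forall>p\<in>Pin h. norm (F h p) \<le> C * h powr r"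
    using assms by (auto simp: bigo_on_def)
  show ?thesis
    by (rule bigo_onI[of _ _ C], use C sub in eventually_elim) auto
qed

text \<open>The target class, with coefficients bounded in \<open>E\<close>. It plays two parts: its
  small variable is \<open>h\<close> in the final expansion, and the position \<open>x\<close> when
  the WKB terms are expanded at the left end point.\<close>

definition powB :: "(real \<Rightarrow> real \<Rightarrow> complex) set" where
  "powB = {\<lambda>h E. c E * of_real (h powr (real m * \<gamma> + real n)) |c m n. bounded (c ` K)}"

lemma powB_I: "bounded (c ` K) \<Longrightarrow> (\<lambda>h E. c E * of_real (h powr (real m * \<gamma> + real n))) \<in> powB"
  unfolding powB_def by blast

abbreviation "PK \<equiv> \<lambda>h::real. K"

lemma bigo_on_coeff_K:
  assumes "bounded (c ` K)"
  shows "bigo_on PK 0 (\<lambda>h E. c E :: complex)"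
proof -
  obtain B where B: "\<And>E. E \<in> K \<Longrightarrow> norm (c E) \<le> B" using assms(1) unfolding bounded_iff by blast
  show ?thesis
    by (rule bigo_onI[of _ _ B], use eventually_small[OF zero_less_one] in eventually_elim)
      (use B in auto)
qed

lemma gauge_pow: "gauge_basis powB PK"
  unfolding gauge_basis_def
proof (intro conjI ballI allI)
  show "\<exists>e\<in>powB. \<forall>\<^sub>F h in at_right 0. \<forall>p\<in>K. e h p = 1"
  proof (rule bexI)
    show "(\<lambda>h E. (\<lambda>E. 1) E * of_real (h powr (real 0 * \<gamma> + real 0))) \<in> powB"
      by (rule powB_I[OF bounded_const])
    show "\<forall>\<^sub>F h in at_right 0. \<forall>E\<in>K. (\<lambda>E. 1) E * complex_of_real (h powr (real 0 * \<gamma> + real 0)) = 1"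
      using eventually_small[OF zero_less_one] by eventually_elim auto
  qed
  fix f assume "f \<in> powB"
  then obtain c m n where f: "f = (\<lambda>h E. c E * of_real (h powr (real m * \<gamma> + real n)))"
    and c: "bounded (c ` K)" unfolding powB_def by blast
  have "bigo_on PK (0 + (real m * \<gamma> + real n)) (\<lambda>h E. c E * of_real (h powr (real m * \<gamma> + real n)))"
    by (intro bigo_on_mult bigo_on_coeff_K c bigo_on_h_powr)
  then show "\<exists>r. bigo_on PK r f" unfolding f by blast
  { fix d :: complex
    have "(\<lambda>h E. (d * c E) * of_real (h powr (real m * \<gamma> + real n))) \<in> powB"
      by (rule powB_I[OF bounded_times[OF bounded_const c]])
    then show "(\<lambda>h p. d * f h p) \<in> powB" by (simp add: f mult.assoc) }
  fix g assume "g \<in> powB"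
  then obtain d k l where g: "g = (\<lambda>h E. d E * of_real (h powr (real k * \<gamma> + real l)))"
    and d: "bounded (d ` K)" unfolding powB_def by blast
  have "(\<lambda>h E. (c E * d E) * of_real (h powr (real (m + k) * \<gamma> + real (n + l)))) \<in> powB"
    by (rule powB_I[OF bounded_times[OF c d]])
  also have "(\<lambda>h E. (c E * d E) * of_real (h powr (real (m + k) * \<gamma> + real (n + l)))) = (\<lambda>h p. f h p * g h p)"
  proof (intro ext)
    fix h E :: real
    have "real (m + k) * \<gamma> + real (n + l) = (real m * \<gamma> + real n) + (real k * \<gamma> + real l)"
      by (simp add: algebra_simps)
    then show "(c E * d E) * of_real (h powr (real (m + k) * \<gamma> + real (n + l))) = f h E * g h E"
      unfolding f g by (simp only: powr_add of_real_mult mult_ac)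
  qed
  finally show "(\<lambda>h p. f h p * g h p) \<in> powB" .
qed

lemma lin_powB_bigo:
  assumes "f \<in> lin powB"
  shows "bigo_on PK 0 f"
  using assms
proof (induction f rule: lin.induct)
  case lin_zero then show ?case by (rule bigo_on_zero)
next
  case (lin_plus f g)
  then obtain c m n where f: "f = (\<lambda>h E. c E * of_real (h powr (real m * \<gamma> + real n)))"
    and c: "bounded (c ` K)" unfolding powB_def by blast
  have "bigo_on PK (0 + (real m * \<gamma> + real n)) f"
    unfolding f by (intro bigo_on_mult bigo_on_coeff_K c bigo_on_h_powr)
  then have "bigo_on PK 0 f" by (rule bigo_on_mono) (use gamma_pos in auto)
  then show ?case using lin_plus.IH by (rule bigo_on_add)
qed

lemma approx_powB_bigo: "approx powB PK F \<Longrightarrow> bigo_on PK 0 F"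
proof -
  assume "approx powB PK F"
  then obtain g where g: "g \<in> lin powB" "bigo_on PK 0 (\<lambda>h p. F h p - g h p)"
    unfolding approx_def by blast
  from bigo_on_add[OF g(2) lin_powB_bigo[OF g(1)]] show ?thesis by simp
qed

section \<open>Substitution of the matching point into expansions in the position\<close>

definition "node h E n = pi * h * real n / sqrt E"

lemma node_small:
  assumes "e > 0"
  shows "\<forall>\<^sub>F h in at_right 0. \<forall>p\<in>Pmix h. 0 < h \<and> 0 < node h (fst p) (snd p) \<and> node h (fst p) (snd p) < e
    \<and> node h (fst p) (snd p) \<le> pi / sqrt \<delta>\<^sub>0 * h powr (1 - \<kappa> / 2) \<and> 1 \<le> snd p"
proof -
  have "\<forall>\<^sub>F h in at_right 0. h powr (1 - \<kappa> / 2) \<le> e / 2 / (pi / sqrt \<delta>\<^sub>0)"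
    using kappa delta_pos assms by (intro eventually_powr_le) auto
  then show ?thesis using Pmix_large[of 1] eventually_small[OF zero_less_one]
  proof eventually_elim
    case (elim h)
    show ?case
    proof
      fix p assume p: "p \<in> Pmix h"
      have E: "\<delta>\<^sub>0 \<le> fst p" "fst p > 0" using E_ge E_pos p by (auto simp: Pmix_def)
      have n: "1 \<le> real (snd p)" "real (snd p) \<le> h powr (- \<kappa> / 2)" using elim p by (auto simp: Pmix_def)
      have "node h (fst p) (snd p) \<le> pi * h * h powr (- \<kappa> / 2) / sqrt \<delta>\<^sub>0"
        unfolding node_def using E n elim delta_pos by (intro frac_le mult_left_mono) auto
      also have "\<dots> = pi / sqrt \<delta>\<^sub>0 * (h powr 1 * h powr (- \<kappa> / 2))" using elim by simp
      also have "h powr 1 * h powr (- \<kappa> / 2) = h powr (1 - \<kappa> / 2)" by (subst powr_add[symmetric]) simp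
      finally have 1: "node h (fst p) (snd p) \<le> pi / sqrt \<delta>\<^sub>0 * h powr (1 - \<kappa> / 2)" .
      also have "\<dots> \<le> pi / sqrt \<delta>\<^sub>0 * (e / 2 / (pi / sqrt \<delta>\<^sub>0))"
        using elim delta_pos by (intro mult_left_mono) auto
      also have "\<dots> = e / 2" using delta_pos by simp
      finally have "node h (fst p) (snd p) < e" using assms by simp
      moreover have "0 < node h (fst p) (snd p)" unfolding node_def using elim n E by simp
      ultimately show "0 < h \<and> 0 < node h (fst p) (snd p) \<and> node h (fst p) (snd p) < e
          \<and> node h (fst p) (snd p) \<le> pi / sqrt \<delta>\<^sub>0 * h powr (1 - \<kappa> / 2) \<and> 1 \<le> snd p"
        using 1 elim n by auto
    qed
  qed
qed

text \<open>The matching point is at most a constant times \<open>h powr (1 - \<kappa> / 2)\<close>,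
  hence the factor by which the order shrinks; \<open>r \<ge> 0\<close> makes an upper bound for the
  point sufficient.\<close>

lemma bigo_node:
  assumes "bigo_on PK r F" "r \<ge> 0"
  shows "bigo_on Pmix ((1 - \<kappa> / 2) * r) (\<lambda>h p. F (node h (fst p) (snd p)) (fst p))"
proof -
  obtain C where C: "C \<ge> 0" "\<forall>\<^sub>F x in at_right 0. \<forall>E\<in>K. norm (F x E) \<le> C * x powr r"
    using assms(1) by (rule bigo_onE)
  then obtain e where e: "e > 0" "\<And>x E. 0 < x \<Longrightarrow> x < e \<Longrightarrow> E \<in> K \<Longrightarrow> norm (F x E) \<le> C * x powr r"
    unfolding eventually_at_right_field by blast
  show ?thesis
  proof (rule bigo_onI[of _ _ "C * (pi / sqrt \<delta>\<^sub>0) powr r"], use node_small[OF e(1)] in eventually_elim)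
    case (elim h)
    show ?case
    proof
      fix p assume p: "p \<in> Pmix h"
      let ?x = "node h (fst p) (snd p)"
      have x: "0 < ?x" "?x < e" "?x \<le> pi / sqrt \<delta>\<^sub>0 * h powr (1 - \<kappa> / 2)" "fst p \<in> K" using elim p Pmix_K by auto
      have "norm (F ?x (fst p)) \<le> C * ?x powr r" by (rule e(2)) (use x in auto)
      also have "\<dots> \<le> C * (pi / sqrt \<delta>\<^sub>0 * h powr (1 - \<kappa> / 2)) powr r"
        using x C assms(2) by (intro mult_left_mono powr_mono2) auto
      also have "\<dots> = C * (pi / sqrt \<delta>\<^sub>0) powr r * h powr ((1 - \<kappa> / 2) * r)"
        using delta_pos powr_mult[of "pi / sqrt \<delta>\<^sub>0" "h powr (1 - \<kappa> / 2)" r] by (simp add: powr_powr)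
      finally show "norm (F ?x (fst p)) \<le> C * (pi / sqrt \<delta>\<^sub>0) powr r * h powr ((1 - \<kappa> / 2) * r)" .
    qed
  qed
qed

text \<open>Inserting \<open>x = pi * h * n / sqrt E\<close> sends \<open>x powr s\<close> to
  \<open>h powr s * n powr s\<close> times a bounded function of \<open>E\<close>, and the pair of
  indices behind \<open>s\<close> is kept. Errors in \<open>x\<close> become errors in
  \<open>h\<close> by \<open>bigo_node\<close>, after the precision is raised to
  \<open>M\<close>.\<close>

lemma approx_node:
  assumes "approx powB PK F"
  shows "approx mixB Pmix (\<lambda>h p. F (node h (fst p) (snd p)) (fst p))"
proof -
  have lin: "approx mixB Pmix (\<lambda>h p. f (node h (fst p) (snd p)) (fst p))" if "f \<in> lin powB" for f
    using that
  proof (induction f rule: lin.induct)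
    case lin_zero then show ?case by (rule approx_zero)
  next
    case (lin_plus f g)
    then obtain c m n where f: "f = (\<lambda>h E. c E * of_real (h powr (real m * \<gamma> + real n)))"
      and c: "bounded (c ` K)" unfolding powB_def by blast
    define s where "s = real m * \<gamma> + real n"
    have "bounded ((\<lambda>E. E powr (- s / 2)) ` K)" by (rule bounded_E_powr)
    then have b: "bounded ((\<lambda>E. complex_of_real (E powr (- s / 2))) ` K)" by (simp add: bounded_iff)
    have "(\<lambda>h p. (\<lambda>E. c E * (of_real (pi powr s) * of_real (E powr (- s / 2)))) (fst p) * of_real (h powr (real m * \<gamma> + real n) * real (snd p) powr s)) \<in> mixB"
      by (intro mixB_I bounded_times c b bounded_const)
    from approx_base[OF this]
    have "approx mixB Pmix (\<lambda>h p. f (node h (fst p) (snd p)) (fst p))"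
    proof (rule approx_cong)
      show "\<forall>\<^sub>F h in at_right 0. \<forall>p\<in>Pmix h. (\<lambda>E. c E * (of_real (pi powr s) * of_real (E powr (- s / 2)))) (fst p) * of_real (h powr (real m * \<gamma> + real n) * real (snd p) powr s) = f (node h (fst p) (snd p)) (fst p)"
        using node_small[OF zero_less_one]
      proof eventually_elim
        case (elim h)
        show ?case
        proof
          fix p assume p: "p \<in> Pmix h"
          then have E: "fst p > 0" using E_pos Pmix_K by blast
          have h: "h > 0" using elim p by blast
          have "node h (fst p) (snd p) powr s = pi powr s * (h powr s * real (snd p) powr s) / sqrt (fst p) powr s"
            unfolding node_def using E h by (simp add: powr_divide powr_mult mult.assoc)
          also have "sqrt (fst p) powr s = fst p powr (s / 2)"
            using E by (simp add: powr_half_sqrt[symmetric] powr_powr)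
          finally have "node h (fst p) (snd p) powr s = pi powr s * fst p powr (- s / 2) * (h powr s * real (snd p) powr s)"
            by (simp add: powr_minus_divide)
          then show "(\<lambda>E. c E * (of_real (pi powr s) * of_real (E powr (- s / 2)))) (fst p) * of_real (h powr (real m * \<gamma> + real n) * real (snd p) powr s) = f (node h (fst p) (snd p)) (fst p)"
            unfolding f s_def[symmetric] by simp
        qed
      qed
    qed
    then show ?case using lin_plus.IH by (rule approx_add)
  qed
  show ?thesis
  proof (rule approx_limit)
    fix N :: real
    define M where "M = \<bar>N\<bar> / (1 - \<kappa> / 2)"
    have M: "M \<ge> 0" "(1 - \<kappa> / 2) * M = \<bar>N\<bar>" using kappa by (auto simp: M_def)
    obtain g where g: "g \<in> lin powB" "bigo_on PK M (\<lambda>h p. F h p - g h p)"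
      using assms unfolding approx_def by blast
    from bigo_node[OF g(2) M(1)] M(2)
    have "bigo_on Pmix N (\<lambda>h p. F (node h (fst p) (snd p)) (fst p) - g (node h (fst p) (snd p)) (fst p))"
      by (auto elim: bigo_on_mono)
    then show "\<exists>G. approx mixB Pmix G \<and> bigo_on Pmix N (\<lambda>h p. F (node h (fst p) (snd p)) (fst p) - G h p)"
      using lin[OF g(1)] by blast
  qed
qed

section \<open>Averaging over dyadic multiples of \<open>n\<close>\<close>

lemma exists_averaging_poly:
  assumes "finite A" "0 \<notin> A"
  shows "\<exists>q::real poly. poly q 1 = 1 \<and> (\<forall>\<alpha>\<in>A. poly q (2 powr \<alpha>) = 0)"
  using assms
proof (induction A rule: finite_induct)
  case empty
  show ?case by (intro exI[of _ 1]) auto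
next
  case (insert a A)
  then obtain q :: "real poly" where q: "poly q 1 = 1" "\<forall>\<alpha>\<in>A. poly q (2 powr \<alpha>) = 0" by auto
  \<comment> \<open>The new linear factor has the root \<open>2 powr a\<close> and is scaled to have
    the value 1 at 1, which is possible exactly because \<open>a\<close> is not 0.\<close>
  have "2 powr a \<noteq> 1" using insert.prems by simp
  then show ?case using q
    by (intro exI[of _ "[:- (2 powr a) / (1 - 2 powr a), 1 / (1 - 2 powr a):] * q"])
      (auto simp: field_simps)
qed

text \<open>Sampling at \<open>n, 2n, 4n, \<dots>\<close> turns the exponent \<open>\<alpha>\<close> of \<open>n\<close> into the
  eigenvalue \<open>2 powr \<alpha>\<close> of a shift, so that a polynomial in the shift annihilates finitely many
  of them while preserving \<open>\<alpha> = 0\<close>.\<close>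
lemma lin_mixB_averaging:
  assumes "L \<in> lin mixB"
  shows "\<exists>A G. finite A \<and> 0 \<notin> A \<and> G \<in> lin powB \<and>
    (\<forall>q::real poly. poly q 1 = 1 \<longrightarrow> (\<forall>\<alpha>\<in>A. poly q (2 powr \<alpha>) = 0) \<longrightarrow>
      (\<forall>h>0. \<forall>E. \<forall>n\<ge>1. (\<Sum>j\<le>degree q. of_real (coeff q j) * L h (E, 2 ^ j * n)) = G h E))"
  using assms
proof (induction L rule: lin.induct)
  case lin_zero
  show ?case by (intro exI[of _ "{}"] exI[of _ "\<lambda>h p. 0"]) (auto intro: lin.lin_zero)
next
  case (lin_plus f L)
  from lin_plus.IH obtain A G where A: "finite A" "0 \<notin> A" "G \<in> lin powB"
    and G': "\<forall>q::real poly. poly q 1 = 1 \<longrightarrow> (\<forall>\<alpha>\<in>A. poly q (2 powr \<alpha>) = 0) \<longrightarrow>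
      (\<forall>h>0. \<forall>E. \<forall>n\<ge>1. (\<Sum>j\<le>degree q. of_real (coeff q j) * L h (E, 2 ^ j * n)) = G h E)"
    by (elim exE conjE) (rule that)
  have G: "(\<Sum>j\<le>degree q. of_real (coeff q j) * L h (E, 2 ^ j * n)) = G h E"
    if "poly q (1::real) = 1" "\<forall>\<alpha>\<in>A. poly q (2 powr \<alpha>) = 0" "h > 0" "n \<ge> 1" for q h E n
    using G'[rule_format, OF that(1) _ that(3,4)] that(2) by blast
  obtain c m k \<alpha> where f: "f = (\<lambda>h p. c (fst p) * of_real (h powr (real m * \<gamma> + real k) * real (snd p) powr \<alpha>))"
    and c: "bounded (c ` K)" using lin_plus(1) unfolding mixB_def by blast
  have sf: "(\<Sum>j\<le>degree q. of_real (coeff q j) * f h (E, 2 ^ j * n)) =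
     c E * of_real (h powr (real m * \<gamma> + real k) * real n powr \<alpha> * poly q (2 powr \<alpha>))"
    if "n \<ge> 1" for q :: "real poly" and h E n
  proof -
    have "(2 ^ j) powr \<alpha> = (2 powr \<alpha>) ^ j" for j
      by (simp add: powr_realpow[symmetric] powr_powr mult.commute)
    then have "real (2 ^ j * n) powr \<alpha> = (2 powr \<alpha>) ^ j * real n powr \<alpha>" for j
      by (simp add: powr_mult)
    then show ?thesis unfolding f poly_altdef
      by (simp add: sum_distrib_left sum_distrib_right mult_ac)
  qed
  show ?case
  proof (cases "\<alpha> = 0")
    case True
    show ?thesis
    proof (intro exI[of _ A] exI[of _ "\<lambda>h E. c E * of_real (h powr (real m * \<gamma> + real k)) + G h E"] conjI A allI impI)
      show "(\<lambda>h E. c E * of_real (h powr (real m * \<gamma> + real k)) + G h E) \<in> lin powB"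
        by (intro lin.lin_plus powB_I c A)
      fix q :: "real poly" and h E :: real and n :: nat
      assume q: "poly q 1 = 1" "\<forall>\<alpha>\<in>A. poly q (2 powr \<alpha>) = 0" "h > 0" "n \<ge> 1"
      show "(\<Sum>j\<le>degree q. of_real (coeff q j) * (f h (E, 2 ^ j * n) + L h (E, 2 ^ j * n))) =
         c E * of_real (h powr (real m * \<gamma> + real k)) + G h E"
        using sf[OF q(4), of q h E] G[OF q] q True by (simp add: distrib_left sum.distrib)
    qed
  next
    case False
    show ?thesis
    proof (intro exI[of _ "insert \<alpha> A"] exI[of _ G] conjI allI impI)
      fix q :: "real poly" and h E :: real and n :: nat
      assume q: "poly q 1 = 1" "\<forall>\<alpha>\<in>insert \<alpha> A. poly q (2 powr \<alpha>) = 0" "h > 0" "n \<ge> 1"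
      show "(\<Sum>j\<le>degree q. of_real (coeff q j) * (f h (E, 2 ^ j * n) + L h (E, 2 ^ j * n))) = G h E"
        using sf[OF q(4), of q h E] G[OF q(1) _ q(3,4), of E] q by (simp add: distrib_left sum.distrib)
    qed (use A False in auto)
  qed
qed

lemma Pmix_nonempty:
  "\<forall>\<^sub>F h in at_right 0. \<exists>n\<ge>1. \<forall>j\<le>J. \<forall>E\<in>K. (E, 2 ^ j * n) \<in> Pmix h"
proof -
  have "\<forall>\<^sub>F h in at_right 0. h powr (\<kappa> / 4) \<le> 1 / (2 * 2 ^ J)"
    using kappa by (intro eventually_powr_le) auto
  then show ?thesis using eventually_small[OF zero_less_one]
  proof eventually_elim
    case (elim h)
    \<comment> \<open>\<open>n\<close> sits at the lower end of the window. The ratio of the two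
      ends is \<open>h powr (- \<kappa> / 4)\<close>, which eventually exceeds
      \<open>2 * 2 ^ J\<close>, so all the multiples fit in; the extra factor 2 covers the
      rounding.\<close>
    define n where "n = nat \<lceil>h powr (- \<kappa> / 4)\<rceil>"
    have "h powr 0 \<le> h powr (- \<kappa> / 4)" using elim kappa by (intro powr_mono') auto
    then have 1: "1 \<le> h powr (- \<kappa> / 4)" using elim by simp
    then have n: "h powr (- \<kappa> / 4) \<le> real n" "real n \<le> 2 * h powr (- \<kappa> / 4)" unfolding n_def by linarith+
    have "(E, 2 ^ j * n) \<in> Pmix h" if "E \<in> K" "j \<le> J" for E j
    proof -
      have "real n \<le> real (2 ^ j * n)"
        using mult_right_mono[of 1 "2 ^ j" "real n"] by simp
      then have "h powr (- \<kappa> / 4) \<le> real (2 ^ j * n)" using n by linarith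
      moreover have "real (2 ^ j * n) \<le> h powr (- \<kappa> / 2)"
      proof -
        have "real (2 ^ j * n) \<le> 2 ^ J * (2 * h powr (- \<kappa> / 4))"
          unfolding of_nat_mult using n that by (intro mult_mono) (auto intro: power_increasing)
        also have "\<dots> = (2 * 2 ^ J) * h powr (- \<kappa> / 4)" by simp
        also have "\<dots> \<le> (1 / h powr (\<kappa> / 4)) * h powr (- \<kappa> / 4)"
          using elim by (intro mult_right_mono) (auto simp: field_simps)
        also have "1 / h powr (\<kappa> / 4) = h powr (- \<kappa> / 4)" by (simp add: powr_minus_divide)
        also have "h powr (- \<kappa> / 4) * h powr (- \<kappa> / 4) = h powr (- \<kappa> / 2)" by (subst powr_add[symmetric]) simp
        finally show ?thesis .
      qed
      ultimately show ?thesis using that by (simp add: Pmix_def)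
    qed
    moreover have "n \<ge> 1" using n 1 by linarith
    ultimately show ?case by blast
  qed
qed

text \<open>The weights are the coefficients of a polynomial with value 1 at 1, so they sum to 1 and
  the average of \<open>g\<close> is \<open>g\<close> itself. The average of the approximant is free
  of \<open>n\<close>. The polynomial depends on the approximant but not on \<open>h\<close>, so the
  error grows only by a constant factor.\<close>

lemma approx_averaging:
  assumes "approx mixB Pmix (\<lambda>h p. g h (fst p))"
  shows "approx powB PK g"
  unfolding approx_def
proof
  fix N
  obtain L where L: "L \<in> lin mixB" "bigo_on Pmix N (\<lambda>h p. g h (fst p) - L h p)"
    using assms unfolding approx_def by blast
  from lin_mixB_averaging[OF L(1)] obtain A G where A: "finite A" "0 \<notin> A" "G \<in> lin powB"
    and G': "\<forall>q::real poly. poly q 1 = 1 \<longrightarrow> (\<forall>\<alpha>\<in>A. poly q (2 powr \<alpha>) = 0) \<longrightarrow>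
      (\<forall>h>0. \<forall>E. \<forall>n\<ge>1. (\<Sum>j\<le>degree q. of_real (coeff q j) * L h (E, 2 ^ j * n)) = G h E)"
    by (elim exE conjE) (rule that)
  have G: "(\<Sum>j\<le>degree q. of_real (coeff q j) * L h (E, 2 ^ j * n)) = G h E"
    if "poly q (1::real) = 1" "\<forall>\<alpha>\<in>A. poly q (2 powr \<alpha>) = 0" "h > 0" "n \<ge> 1" for q h E n
    using G'[rule_format, OF that(1) _ that(3,4)] that(2) by blast
  obtain q :: "real poly" where q: "poly q 1 = 1" "\<forall>\<alpha>\<in>A. poly q (2 powr \<alpha>) = 0"
    using exists_averaging_poly[OF A(1,2)] by blast
  obtain C where C: "C \<ge> 0" "\<forall>\<^sub>F h in at_right 0. \<forall>p\<in>Pmix h. norm (g h (fst p) - L h p) \<le> C * h powr N"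
    using L(2) by (rule bigo_onE)
  have "bigo_on PK N (\<lambda>h E. g h E - G h E)"
  proof (rule bigo_onI[of _ _ "(\<Sum>j\<le>degree q. \<bar>coeff q j\<bar> * C)"],
      use C(2) Pmix_nonempty[of "degree q"] eventually_small[OF zero_less_one] in eventually_elim)
    case (elim h)
    then obtain n where n: "n \<ge> 1" "\<And>j E. j \<le> degree q \<Longrightarrow> E \<in> K \<Longrightarrow> (E, 2 ^ j * n) \<in> Pmix h" by blast
    show ?case
    proof
      fix E assume E: "E \<in> K"
      have "(\<Sum>j\<le>degree q. coeff q j) = 1" using q(1) by (simp add: poly_altdef)
      then have "(\<Sum>j\<le>degree q. complex_of_real (coeff q j) * g h E) = g h E"
        by (simp flip: sum_distrib_right of_real_sum)
      then have "g h E - G h E = (\<Sum>j\<le>degree q. of_real (coeff q j) * (g h E - L h (E, 2 ^ j * n)))"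
        using G[OF q _ n(1), of h E] elim by (simp add: right_diff_distrib sum_subtractf)
      also have "norm \<dots> \<le> (\<Sum>j\<le>degree q. \<bar>coeff q j\<bar> * (C * h powr N))"
      proof (rule sum_norm_le)
        fix j assume "j \<in> {..degree q}"
        then have "norm (g h E - L h (E, 2 ^ j * n)) \<le> C * h powr N"
          using elim(1) n(2)[OF _ E, of j] by fastforce
        then show "norm (complex_of_real (coeff q j) * (g h E - L h (E, 2 ^ j * n))) \<le> \<bar>coeff q j\<bar> * (C * h powr N)"
          by (simp add: norm_mult mult_left_mono)
      qed
      finally show "norm (g h E - G h E) \<le> (\<Sum>j\<le>degree q. \<bar>coeff q j\<bar> * C) * h powr N"
        by (simp add: sum_distrib_right mult.assoc)
    qed
  qed
  then show "\<exists>G\<in>lin powB. bigo_on PK N (\<lambda>h p. g h p - G h p)" using A(3) by blast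
qed

lemma bigo_averaging:
  assumes "bigo_on Pmix r (\<lambda>h p. g h (fst p))"
  shows "bigo_on PK r g"
proof -
  obtain C where C: "\<forall>\<^sub>F h in at_right 0. \<forall>p\<in>Pmix h. norm (g h (fst p)) \<le> C * h powr r"
    using assms by (auto simp: bigo_on_def)
  show ?thesis
  proof (rule bigo_onI[of _ _ C], use C Pmix_nonempty[of 0] in eventually_elim)
    case (elim h)
    then obtain n where n: "\<forall>E\<in>K. (E, 2 ^ 0 * n) \<in> Pmix h" by blast
    show ?case using n elim(1) by fastforce
  qed
qed

end

section \<open>The terms of the WKB expansion\<close>

text \<open>Multiplied by \<open>x ^ n\<close>, the \<open>n\<close>-th WKB coefficient is a polynomial in \<open>E\<close>, \<open>x powr \<gamma>\<close>, the functions
  \<open>x ^ i * D i x\<close> and \<open>(E - V x) powr (-1/4)\<close>. Syntactic expressions make this class visibly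
  closed under \<open>th\<close>, which represents \<open>x * d/dx\<close>.\<close>
datatype wexp = Cst real | Par | Xg | Wd nat | Ka | Add wexp wexp | Mul wexp wexp

primrec th :: "real \<Rightarrow> wexp \<Rightarrow> wexp" where
  "th g (Cst c) = Cst 0"
| "th g Par = Cst 0"
| "th g Xg = Mul (Cst g) Xg"
| "th g (Wd i) = Add (Mul (Cst (real i)) (Wd i)) (Wd (Suc i))"
| "th g Ka = Mul (Mul (Cst (1/4)) (Mul (Mul Ka Ka) (Mul (Mul Ka Ka) Ka)))
     (Mul Xg (Add (Mul (Cst g) (Wd 0)) (Wd 1)))"
| "th g (Add e f) = Add (th g e) (th g f)"
| "th g (Mul e f) = Add (Mul (th g e) f) (Mul e (th g f))"

definition sumexp :: "wexp list \<Rightarrow> wexp" where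
  "sumexp es = foldr Add es (Cst 0)"

text \<open>For \<open>n \<ge> 1\<close> a factor \<open>x powr \<gamma>\<close> splits off; it keeps the exponents of the integrands
  away from \<open>-1\<close>. The equations solve \<open>r\<^sup>2 - q * r' = E - V\<close> for \<open>r = (\<Sum>n. q ^ n * wkb n)\<close>,
  where \<open>q = - \<i> * h\<close>.\<close>
fun wk :: "real \<Rightarrow> nat \<Rightarrow> wexp" where
  "wk g 0 = Cst 0"
| "wk g (Suc 0) = Mul (Cst (-1/4)) (Mul (Add (Mul (Cst g) (Wd 0)) (Wd 1)) (Mul (Mul Ka Ka) (Mul Ka Ka)))"
| "wk g (Suc (Suc m)) = Mul (Mul (Cst (1/2)) (Mul Ka Ka))
     (Add (Add (Mul (Cst (g - real (Suc m))) (wk g (Suc m))) (th g (wk g (Suc m))))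
       (Mul (Cst (-1)) (Mul Xg (sumexp (map (\<lambda>j. Mul (wk g j) (wk g (Suc (Suc m) - j))) [1..<Suc (Suc m)])))))"

declare wk.simps [simp del]

primrec wkb_exp :: "real \<Rightarrow> nat \<Rightarrow> wexp" where
  "wkb_exp g 0 = Mul (Mul Ka Ka) (Add Par (Mul (Cst (-1)) (Mul Xg (Wd 0))))"
| "wkb_exp g (Suc n) = Mul Xg (wk g (Suc n))"

context bohr_sommerfeld
begin

primrec ev :: "wexp \<Rightarrow> real \<Rightarrow> real \<Rightarrow> real" where
  "ev (Cst c) E x = c"
| "ev Par E x = E"
| "ev Xg E x = x powr \<gamma>"
| "ev (Wd i) E x = x ^ i * D i x"
| "ev Ka E x = (E - V x) powr (-1/4)"
| "ev (Add e f) E x = ev e E x + ev f E x"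
| "ev (Mul e f) E x = ev e E x * ev f E x"

lemma ev_sumexp: "ev (sumexp es) E x = (\<Sum>e\<leftarrow>es. ev e E x)"
  by (induction es) (auto simp: sumexp_def)

lemma gap_pos: "E \<in> K \<Longrightarrow> x \<in> {0..b} \<Longrightarrow> E - V x > 0"
  using gap[of E x] delta_pos by simp

lemma V_deriv:
  assumes "x \<in> {0<..b}"
  shows "(V has_real_derivative x powr \<gamma> * (\<gamma> * D 0 x + x * D 1 x) / x) (at x within {0<..b})"
proof -
  have "(D 0 has_real_derivative D 1 x) (at x within {0<..b})"
    using D_deriv[of x 0] assms by (auto intro: DERIV_subset)
  then have "((\<lambda>x. x powr \<gamma> * D 0 x) has_real_derivative x powr \<gamma> * (\<gamma> * D 0 x + x * D 1 x) / x) (at x within {0<..b})"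
    using assms by (auto intro!: derivative_eq_intros simp: powr_diff field_simps)
  then show ?thesis
    by (rule has_field_derivative_transform_within[OF _ zero_less_one assms]) (auto simp: V_eq)
qed

text \<open>The rules of \<open>th\<close> are elementary except the one for \<open>Ka\<close>. It
  combines \<open>x * V' = x powr \<gamma> * (\<gamma> * W + x * W')\<close>, where \<open>W\<close>
  is \<open>D 0\<close>, with \<open>Ka' = Ka ^ 5 * V' / 4\<close>.\<close>

lemma ev_deriv:
  assumes "E \<in> K" "x \<in> {0<..b}"
  shows "((\<lambda>x. ev e E x) has_real_derivative ev (th \<gamma> e) E x / x) (at x within {0<..b})"
proof (induction e)
  case Xg
  show ?case using assms by (auto intro!: derivative_eq_intros simp: powr_diff)
next
  case (Wd i)
  have "(D i has_real_derivative D (Suc i) x) (at x within {0<..b})"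
    using D_deriv[of x i] assms by (auto intro: DERIV_subset)
  from DERIV_mult'[OF DERIV_pow this, of i]
  have "((\<lambda>x. x ^ i * D i x) has_real_derivative x ^ i * D (Suc i) x + real i * x ^ (i - Suc 0) * D i x) (at x within {0<..b})"
    by simp
  moreover have "x ^ i * D (Suc i) x + real i * x ^ (i - Suc 0) * D i x = ev (th \<gamma> (Wd i)) E x / x"
    using assms by (cases i) (auto simp: field_simps)
  ultimately show ?case by simp
next
  case Ka
  have pos: "E - V x > 0" using gap_pos assms by auto
  have p5: "(E - V x) powr (-1/4 - 1) = ((E - V x) powr (-1/4)) ^ 5"
    using pos by (simp add: powr_power)
  have "((\<lambda>x. (E - V x) powr (-1/4)) has_real_derivative
     (-1/4) * (E - V x) powr (-1/4 - 1) * (- (x powr \<gamma> * (\<gamma> * D 0 x + x * D 1 x) / x))) (at x within {0<..b})"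
    using pos by (auto intro!: derivative_eq_intros V_deriv[OF assms(2)])
  then show ?case unfolding p5 using assms by (simp add: field_simps power_def eval_nat_numeral)
next
  case (Mul e f)
  show ?case using DERIV_mult'[OF Mul.IH] by (simp add: add_divide_distrib algebra_simps)
next
  case (Add e f)
  show ?case using DERIV_add[OF Add.IH] by (simp add: add_divide_distrib)
qed auto

text \<open>Boundedness down to \<open>x = 0\<close> is the point of pulling out
  \<open>x ^ n\<close>: the \<open>n\<close>-th WKB coefficient is at most as singular as
  \<open>1 / x ^ n\<close>, uniformly in the energy.\<close>

lemma ev_bounded: obtains B where "B \<ge> 0" "\<And>E x. E \<in> K \<Longrightarrow> x \<in> {0<..b} \<Longrightarrow> \<bar>ev e E x\<bar> \<le> B"
proof -
  have "\<exists>B\<ge>0. \<forall>E\<in>K. \<forall>x\<in>{0<..b}. \<bar>ev e E x\<bar> \<le> B"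
  proof (induction e)
    case (Cst c) then show ?case by (intro exI[of _ "\<bar>c\<bar>"]) auto
  next
    case Par
    obtain M where "M > 0" "\<And>E. E \<in> K \<Longrightarrow> E \<le> M" using E_le by blast
    then show ?case using E_pos by (intro exI[of _ M]) (auto simp: less_imp_le)
  next
    case Xg
    show ?case using gamma_pos by (intro exI[of _ "b powr \<gamma>"]) (auto intro!: powr_mono2)
  next
    case (Wd i)
    obtain B where B: "B \<ge> 0" "\<And>x. x \<in> {0..b} \<Longrightarrow> \<bar>D i x\<bar> \<le> B" using D_bounded by blast
    have "\<bar>x ^ i * D i x\<bar> \<le> b ^ i * B" if "x \<in> {0<..b}" for x
      unfolding abs_mult using B(2)[of x] that by (intro mult_mono) (auto simp: power_abs intro: power_mono)
    then show ?case using B b_pos by (intro exI[of _ "b ^ i * B"]) auto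
  next
    case Ka
    have "(E - V x) powr (-1/4) \<le> \<delta>\<^sub>0 powr (-1/4)" if "E \<in> K" "x \<in> {0<..b}" for E x
      using gap[of E x] that delta_pos by (intro powr_mono2') auto
    then show ?case by (intro exI[of _ "\<delta>\<^sub>0 powr (-1/4)"]) auto
  next
    case (Add e f)
    then obtain A B where "A \<ge> 0" "B \<ge> 0" "\<forall>E\<in>K. \<forall>x\<in>{0<..b}. \<bar>ev e E x\<bar> \<le> A" "\<forall>E\<in>K. \<forall>x\<in>{0<..b}. \<bar>ev f E x\<bar> \<le> B" by blast
    then show ?case
      by (intro exI[of _ "A + B"]) (auto intro!: order_trans[OF abs_triangle_ineq] add_mono)
  next
    case (Mul e f)
    then obtain A B where "A \<ge> 0" "B \<ge> 0" "\<forall>E\<in>K. \<forall>x\<in>{0<..b}. \<bar>ev e E x\<bar> \<le> A" "\<forall>E\<in>K. \<forall>x\<in>{0<..b}. \<bar>ev f E x\<bar> \<le> B" by blast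
    then show ?case
      by (intro exI[of _ "A * B"]) (auto simp: abs_mult intro!: mult_mono)
  qed
  then show ?thesis using that by blast
qed

section \<open>Expansions of the WKB terms at the left end point\<close>

lemma eventually_le_b: "\<forall>\<^sub>F x in at_right 0. x \<in> {0<..b}"
  by (rule eventually_at_right_0I[OF b_pos]) auto

lemma approx_x: "approx powB PK (\<lambda>x E. of_real x)"
proof (rule approx_cong[OF approx_base])
  show "(\<lambda>h E. (\<lambda>E. 1) E * of_real (h powr (real 0 * \<gamma> + real 1))) \<in> powB"
    by (rule powB_I[OF bounded_const])
  show "\<forall>\<^sub>F h in at_right 0. \<forall>E\<in>K. (\<lambda>E. 1) E * of_real (h powr (real 0 * \<gamma> + real 1)) = complex_of_real h"
    using eventually_small[OF zero_less_one] by eventually_elim auto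
qed

lemma approx_coeff: "bounded (c ` K) \<Longrightarrow> approx powB PK (\<lambda>x E. c E)"
proof (rule approx_cong[OF approx_base])
  assume "bounded (c ` K)"
  then show "(\<lambda>h E. c E * of_real (h powr (real 0 * \<gamma> + real 0))) \<in> powB"
    by (rule powB_I)
  show "\<forall>\<^sub>F h in at_right 0. \<forall>E\<in>K. c E * of_real (h powr (real 0 * \<gamma> + real 0)) = c E"
    using eventually_small[OF zero_less_one] by eventually_elim auto
qed

lemma approx_X: "approx powB PK (\<lambda>x E. of_real (x powr \<gamma>))"
  using approx_base[OF powB_I[OF bounded_const, of 1 1 0]] by simp

lemma bounded_of_real: "bounded (c ` K) \<Longrightarrow> bounded ((\<lambda>E. complex_of_real (c E)) ` K)"
  by (simp add: bounded_iff)

lemma approx_Wd: "approx powB PK (\<lambda>x E. of_real (x ^ i * D i x))"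
proof (rule approx_limit)
  fix N :: real
  define J where "J = nat \<lceil>N\<rceil>"
  have N: "N \<le> real (Suc J)" unfolding J_def by linarith
  obtain C where C: "C \<ge> 0" "\<And>x. x \<in> {0..b} \<Longrightarrow> \<bar>D i x - (\<Sum>j\<le>J. D (i + j) 0 / fact j * x ^ j)\<bar> \<le> C * x ^ Suc J"
    using D_taylor by blast
  let ?G = "\<lambda>x E. of_real x ^ i * (\<Sum>j\<le>J. of_real (D (i + j) 0 / fact j) * complex_of_real x ^ j)"
  have "approx powB PK ?G"
    by (intro approx_mult[OF gauge_pow] approx_sum approx_cmult[OF gauge_pow] approx_power[OF gauge_pow] approx_x) auto
  moreover have "bigo_on PK (real (Suc J)) (\<lambda>x E. of_real (x ^ i * D i x) - ?G x E)"
  proof (rule bigo_onI[of _ _ "b ^ i * C"], use eventually_le_b in eventually_elim)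
    case (elim x)
    have "complex_of_real (x ^ i * D i x) - ?G x E = of_real (x ^ i * (D i x - (\<Sum>j\<le>J. D (i + j) 0 / fact j * x ^ j)))" for E
      by (simp add: right_diff_distrib)
    then have "norm (complex_of_real (x ^ i * D i x) - ?G x E) = x ^ i * \<bar>D i x - (\<Sum>j\<le>J. D (i + j) 0 / fact j * x ^ j)\<bar>" for E
      using elim by (simp only: norm_of_real abs_mult) auto
    also have "\<dots> \<le> b ^ i * (C * x ^ Suc J)"
      using C(2)[of x] elim by (intro mult_mono power_mono) auto
    also have "\<dots> = b ^ i * C * x powr real (Suc J)"
      using elim by (subst powr_realpow) auto
    finally show ?case by blast
  qed
  ultimately show "\<exists>G. approx powB PK G \<and> bigo_on PK N (\<lambda>x E. of_real (x ^ i * D i x) - G x E)"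
    using bigo_on_mono[OF _ N] by blast
qed

lemma approx_E_powr: "approx powB PK (\<lambda>x E. of_real (E powr a))"
  by (rule approx_coeff[OF bounded_of_real[OF bounded_E_powr]])

definition "relV E x = V x / E"

lemma bigo_V: "bigo_on PK \<gamma> (\<lambda>x E. of_real (relV E x))"
proof -
  obtain B where B: "B \<ge> 0" "\<And>x. x \<in> {0..b} \<Longrightarrow> \<bar>D 0 x\<bar> \<le> B" using D_bounded by blast
  show ?thesis
  proof (rule bigo_onI[of _ _ "B / \<delta>\<^sub>0"], use eventually_le_b in eventually_elim)
    case (elim x)
    show ?case
    proof
      fix E assume E: "E \<in> K"
      have "\<bar>relV E x\<bar> = \<bar>D 0 x\<bar> * x powr \<gamma> / E" using E_pos[OF E] elim by (simp add: relV_def V_eq abs_mult mult.commute)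
      also have "\<dots> \<le> B * x powr \<gamma> / \<delta>\<^sub>0"
        using B(2)[of x] elim E_ge[OF E] delta_pos B(1) by (intro frac_le mult_right_mono) auto
      finally show "norm (complex_of_real (relV E x)) \<le> B / \<delta>\<^sub>0 * x powr \<gamma>" by simp
    qed
  qed
qed

lemma approx_V: "approx powB PK (\<lambda>x E. of_real (relV E x))"
proof (rule approx_cong)
  show "approx powB PK (\<lambda>x E. of_real (x powr \<gamma>) * (of_real (x ^ 0 * D 0 x) * of_real (E powr (-1))))"
    by (intro approx_mult[OF gauge_pow] approx_X approx_Wd approx_E_powr)
  show "\<forall>\<^sub>F x in at_right 0. \<forall>E\<in>K. complex_of_real (x powr \<gamma>) * (of_real (x ^ 0 * D 0 x) * of_real (E powr (-1))) = of_real (relV E x)"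
    using eventually_le_b
    proof eventually_elim
      case (elim x)
      then have "x powr \<gamma> * (x ^ 0 * D 0 x * E powr (-1)) = relV E x" if "E \<in> K" for E
        using E_pos[OF that] by (simp add: relV_def V_eq powr_minus_divide)
      then show ?case by (metis of_real_mult)
    qed
qed

text \<open>Pulling out the energy leaves a holomorphic function of the small quantity
  \<open>V / E\<close>, to which \<open>approx_compose\<close> applies. The bound
  \<open>1 / 2\<close> keeps the base of the complex power on the positive axis, where it agrees
  with the real one.\<close>

lemma Ka_factor:
  assumes "E \<in> K" "\<bar>relV E x\<bar> \<le> 1 / 2"
  shows "complex_of_real ((E - V x) powr (-1/4)) = of_real (E powr (-1/4)) * (1 - of_real (relV E x)) powr (-1/4)"
proof -
  have E: "E > 0" using E_pos assms by blast
  have v: "\<bar>relV E x\<bar> \<le> 1/2" by (rule assms(2))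
  have "E - V x = E * (1 - relV E x)" using E by (simp add: relV_def field_simps)
  then have "(E - V x) powr (-1/4) = E powr (-1/4) * (1 - relV E x) powr (-1/4)"
    using E v by (simp add: powr_mult)
  moreover have "complex_of_real ((1 - relV E x) powr (-1/4)) = (1 - of_real (relV E x)) powr (-1/4)"
    using powr_of_real[of "1 - relV E x" "-1/4"] v by simp
  ultimately show ?thesis by simp
qed

lemma holomorphic_one_minus_powr: "(\<lambda>z. (1 - z) powr c) holomorphic_on ball 0 1"
proof (intro holomorphic_intros)
  fix z :: complex assume "z \<in> ball 0 1"
  then have "norm z < 1" by simp
  then have "Re z < 1" using complex_Re_le_cmod[of z] by linarith
  then show "1 - z \<notin> \<real>\<^sub>\<le>\<^sub>0" by (auto simp: complex_nonpos_Reals_iff)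
qed

lemma approx_Ka: "approx powB PK (\<lambda>x E. of_real ((E - V x) powr (-1/4)))"
proof (rule approx_cong)
  show "approx powB PK (\<lambda>x E. of_real (E powr (-1/4)) * (1 - of_real (relV E x)) powr (-1/4))"
    by (intro approx_mult[OF gauge_pow] approx_E_powr
        approx_compose[OF gauge_pow approx_V bigo_V gamma_pos holomorphic_one_minus_powr]) auto
  show "\<forall>\<^sub>F x in at_right 0. \<forall>E\<in>K. complex_of_real (E powr (-1/4)) * (1 - of_real (relV E x)) powr (-1/4) = of_real ((E - V x) powr (-1/4))"
  proof -
    have "\<forall>\<^sub>F x in at_right 0. \<forall>E\<in>K. norm (complex_of_real (relV E x)) \<le> 1 / 2"
      using bigo_on_small[OF bigo_V gamma_pos, of "1/2"] by simp
    then show ?thesis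
    proof eventually_elim
      case (elim x)
      show ?case
      proof
        fix E assume E: "E \<in> K"
        show "complex_of_real (E powr (-1/4)) * (1 - of_real (relV E x)) powr (-1/4) = of_real ((E - V x) powr (-1/4))"
          using Ka_factor[OF E, of x] elim E by (simp add: norm_of_real)
      qed
    qed
  qed
qed

lemma bigo_Ka: "bigo_on PK \<gamma> (\<lambda>x E. of_real (E powr (1/4)) * of_real ((E - V x) powr (-1/4)) - 1)"
proof (rule bigo_on_cong)
  show "bigo_on PK \<gamma> (\<lambda>x E. (1 - of_real (relV E x)) powr (-1/4) - (1 - 0) powr (-1/4))"
    by (rule bigo_on_compose[OF bigo_V gamma_pos holomorphic_one_minus_powr]) auto
  have "\<forall>\<^sub>F x in at_right 0. \<forall>E\<in>K. norm (complex_of_real (relV E x)) \<le> 1 / 2"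
    using bigo_on_small[OF bigo_V gamma_pos, of "1/2"] by simp
  then show "\<forall>\<^sub>F x in at_right 0. \<forall>E\<in>K. (1 - of_real (relV E x)) powr (-1/4) - (1 - 0) powr (-1/4) = 
     complex_of_real (E powr (1/4)) * of_real ((E - V x) powr (-1/4)) - 1"
  proof eventually_elim
    case (elim x)
    show ?case
    proof
      fix E assume E: "E \<in> K"
      have "complex_of_real (E powr (1/4)) * of_real (E powr (-1/4)) = 1"
        using E_pos[OF E] by (simp flip: of_real_mult powr_add)
      then show "(1 - of_real (relV E x)) powr (-1/4) - (1 - 0) powr (-1/4) = 
     complex_of_real (E powr (1/4)) * of_real ((E - V x) powr (-1/4)) - 1"
        using Ka_factor[OF E, of x] elim E by (simp add: norm_of_real flip: mult.assoc)
    qed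
  qed
qed

text \<open>Taylor expansion of the smooth factor and holomorphic composition for \<open>Ka\<close>
  cover the atoms; sums and products follow since the approximable functions form an algebra. The
  small variable here is the position \<open>x\<close>.\<close>

lemma approx_ev: "approx powB PK (\<lambda>x E. of_real (ev e E x))"
proof (induction e)
  case (Cst c) show ?case by (simp add: approx_const[OF gauge_pow])
next
  case Par
  have "bounded (complex_of_real ` K)" using K_bounded by (simp add: bounded_iff)
  then show ?case using approx_coeff[of complex_of_real] by simp
next
  case Xg show ?case using approx_X by simp
next
  case (Wd i) show ?case using approx_Wd by simp
next
  case Ka show ?case using approx_Ka by simp
next
  case (Add e f) then show ?case by (simp add: approx_add)
next
  case (Mul e f) then show ?case by (simp add: approx_mult[OF gauge_pow])
qed

section \<open>The classical momentum and the Riccati recursion\<close>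

definition "mom E x = sqrt (E - V x)"

lemma mom_pos: "E \<in> K \<Longrightarrow> x \<in> {0..b} \<Longrightarrow> mom E x > 0"
  using gap_pos by (simp add: mom_def)

lemma Ka_mom:
  assumes "E \<in> K" "x \<in> {0..b}"
  shows "((E - V x) powr (-1/4)) ^ 2 * mom E x = 1" "mom E x ^ 2 = E - V x"
    "((E - V x) powr (-1/4)) ^ 2 * (E - V x) = mom E x"
proof -
  have pos: "E - V x > 0" using gap_pos assms by blast
  have a: "((E - V x) powr (-1/4)) ^ 2 = (E - V x) powr (-1/2)" using pos by (simp add: powr_power)
  have m: "mom E x = (E - V x) powr (1/2)" using pos by (simp add: mom_def powr_half_sqrt)
  show "((E - V x) powr (-1/4)) ^ 2 * mom E x = 1" unfolding a m using pos by (simp flip: powr_add)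
  show 2: "mom E x ^ 2 = E - V x" using pos by (simp add: mom_def)
  show "((E - V x) powr (-1/4)) ^ 2 * (E - V x) = mom E x"
    using \<open>((E - V x) powr (-1/4)) ^ 2 * mom E x = 1\<close> by (simp add: 2[symmetric] power2_eq_square flip: mult.assoc)
qed

definition "wkb n E x = ev (wkb_exp \<gamma> n) E x / x ^ n"
definition "dwkb n E x = (ev (th \<gamma> (wkb_exp \<gamma> n)) E x - real n * ev (wkb_exp \<gamma> n) E x) / x ^ Suc n"

lemma wkb_0:
  assumes "E \<in> K" "x \<in> {0<..b}"
  shows "wkb 0 E x = mom E x"
  using Ka_mom(3)[of E x] assms by (simp add: wkb_def V_eq power2_eq_square)

lemma wkb_deriv:
  assumes "E \<in> K" "x \<in> {0<..b}"
  shows "(wkb n E has_real_derivative dwkb n E x) (at x within {0<..b})"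
proof -
  have "((\<lambda>x. ev (wkb_exp \<gamma> n) E x / x ^ n) has_real_derivative
     (ev (th \<gamma> (wkb_exp \<gamma> n)) E x / x * x ^ n - ev (wkb_exp \<gamma> n) E x * (real n * x ^ (n - 1))) / (x ^ n * x ^ n)) (at x within {0<..b})"
    using assms by (intro DERIV_divide ev_deriv) (auto intro!: derivative_eq_intros)
  moreover have "(ev (th \<gamma> (wkb_exp \<gamma> n)) E x / x * x ^ n - ev (wkb_exp \<gamma> n) E x * (real n * x ^ (n - 1))) / (x ^ n * x ^ n) = dwkb n E x"
    using assms by (cases n) (auto simp: dwkb_def field_simps)
  moreover have "wkb n E = (\<lambda>x. ev (wkb_exp \<gamma> n) E x / x ^ n)" by (auto simp: wkb_def)
  ultimately show ?thesis by simp
qed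

text \<open>This is the coefficient of \<open>q\<close> in the Riccati equation, with the familiar
  solution \<open>- V' / (4 * (E - V))\<close> for \<open>wkb 1\<close>. The momentum enters as
  \<open>Ka ^ 2 * (E - V)\<close>, since \<open>Ka\<close> is the only root in the expression
  language.\<close>

lemma wkb_rec_0:
  assumes "E \<in> K" "x \<in> {0<..b}"
  shows "2 * wkb 0 E x * wkb (Suc 0) E x = dwkb 0 E x"
proof -
  define a where "a = (E - V x) powr (-1/4)"
  define u where "u = E - V x"
  define t where "t = x powr \<gamma> * (\<gamma> * D 0 x + x * D 1 x)"
  have "a\<^sup>2 * mom E x = 1" "u = (mom E x)\<^sup>2"
    using Ka_mom[of E x] assms unfolding a_def u_def by auto
  moreover have "a ^ 4 = (a\<^sup>2)\<^sup>2" by simp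
  ultimately have a4: "a ^ 4 * u = 1" by (metis power_mult_distrib power_one)
  have u: "E - x powr \<gamma> * D 0 x = u" using assms by (simp add: u_def V_eq)
  let ?P = "Add Par (Mul (Cst (-1)) (Mul Xg (Wd 0)))"
  have 1: "ev (th \<gamma> Ka) E x = 1/4 * (a ^ 4 * a) * t"
    by (simp add: a_def t_def power4_eq_xxxx)
  have 2: "ev ?P E x = u" using u by simp
  have 3: "ev (th \<gamma> ?P) E x = - t" by (simp add: t_def algebra_simps)
  have 4: "ev Ka E x = a" by (simp add: a_def)
  have "ev (th \<gamma> (wkb_exp \<gamma> 0)) E x = (ev (th \<gamma> Ka) E x * ev Ka E x + ev Ka E x * ev (th \<gamma> Ka) E x) * ev ?P E x
      + ev Ka E x * ev Ka E x * ev (th \<gamma> ?P) E x"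
    by (simp only: wkb_exp.simps th.simps(7) ev.simps(6,7))
  also have "\<dots> = 1/2 * (a ^ 4 * u) * a * a * t - a * a * t"
    unfolding 1 2 3 4 by (simp add: algebra_simps)
  finally have 5: "ev (th \<gamma> (wkb_exp \<gamma> 0)) E x = - (1/2) * a * a * t" unfolding a4 by simp
  have "ev (wkb_exp \<gamma> 0) E x = a * a * u" unfolding wkb_exp.simps ev.simps(7) 4 2[unfolded ev.simps(7)] using 2 4 by simp
  moreover have "ev (wkb_exp \<gamma> (Suc 0)) E x = - (1/4) * t * a ^ 4"
    by (simp add: wk.simps a_def t_def power4_eq_xxxx)
  ultimately have "2 * ev (wkb_exp \<gamma> 0) E x * ev (wkb_exp \<gamma> (Suc 0)) E x = - (1/2) * a * a * t * (a ^ 4 * u)"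
    by simp
  then have "2 * ev (wkb_exp \<gamma> 0) E x * ev (wkb_exp \<gamma> (Suc 0)) E x = ev (th \<gamma> (wkb_exp \<gamma> 0)) E x"
    unfolding 5 a4 by simp
  then show ?thesis unfolding wkb_def dwkb_def by simp
qed

lemma wkb_rec_Suc:
  assumes "E \<in> K" "x \<in> {0<..b}"
  shows "2 * wkb 0 E x * wkb (Suc (Suc m)) E x + (\<Sum>j=1..Suc m. wkb j E x * wkb (Suc (Suc m) - j) E x) = dwkb (Suc m) E x"
proof -
  let ?X = "x powr \<gamma>"
  let ?e = "\<lambda>j. ev (wk \<gamma> j) E x"
  let ?S = "\<Sum>j=1..Suc m. ?e j * ?e (Suc (Suc m) - j)"
  define a where "a = (E - V x) powr (-1/4)"
  have ap: "a\<^sup>2 * mom E x = 1" using Ka_mom(1)[of E x] assms by (simp add: a_def)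
  have sl: "(\<Sum>e\<leftarrow>map (\<lambda>j. Mul (wk \<gamma> j) (wk \<gamma> (Suc (Suc m) - j))) [1..<Suc (Suc m)]. ev e E x) = ?S"
    unfolding map_map comp_def ev.simps by (subst interv_sum_list_conv_sum_set_nat) (rule sum.cong, auto)
  have e: "?e (Suc (Suc m)) = (1/2 * a\<^sup>2) * ((\<gamma> - real (Suc m)) * ?e (Suc m) + ev (th \<gamma> (wk \<gamma> (Suc m))) E x - ?X * ?S)"
    unfolding wk.simps(3) ev.simps ev_sumexp sl by (simp add: a_def power2_eq_square)
  have "2 * mom E x * (?X * ?e (Suc (Suc m))) = (a\<^sup>2 * mom E x) * (?X * ((\<gamma> - real (Suc m)) * ?e (Suc m) + ev (th \<gamma> (wk \<gamma> (Suc m))) E x - ?X * ?S))"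
    unfolding e by (simp only: mult_ac)
  also have "\<dots> = ?X * ((\<gamma> - real (Suc m)) * ?e (Suc m) + ev (th \<gamma> (wk \<gamma> (Suc m))) E x) - ?X * ?X * ?S"
    unfolding ap by (simp only: mult_1 right_diff_distrib mult.assoc)
  finally have 1: "2 * mom E x * (?X * ?e (Suc (Suc m))) + ?X * ?X * ?S = ?X * ((\<gamma> - real (Suc m)) * ?e (Suc m) + ev (th \<gamma> (wk \<gamma> (Suc m))) E x)"
    by (simp only: eq_diff_eq)
  have x: "x > 0" using assms by simp
  have wj: "wkb j E x * wkb (Suc (Suc m) - j) E x = ?X * ?X * (?e j * ?e (Suc (Suc m) - j)) / x ^ Suc (Suc m)" if jm: "j \<in> {1..Suc m}" for j
  proof -
    obtain i where i: "j = Suc i" using jm by (cases j) auto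
    moreover obtain k where "Suc (Suc m) - j = Suc k" using jm by (cases "Suc (Suc m) - j") auto
    ultimately have ik: "j = Suc i" "Suc (Suc m) - j = Suc k" by auto
    have "Suc (Suc m) = j + (Suc (Suc m) - j)" using jm by simp
    then have "x ^ Suc (Suc m) = x ^ j * x ^ (Suc (Suc m) - j)" by (metis power_add)
    moreover have "ev (wkb_exp \<gamma> j) E x = ?X * ?e j" by (simp add: ik(1))
    moreover have "ev (wkb_exp \<gamma> (Suc (Suc m) - j)) E x = ?X * ?e (Suc (Suc m) - j)"
      by (simp only: ik(2) wkb_exp.simps ev.simps)
    ultimately show ?thesis unfolding wkb_def by (simp only: times_divide_times_eq mult_ac)
  qed
  have "(\<Sum>j=1..Suc m. wkb j E x * wkb (Suc (Suc m) - j) E x) =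
      (\<Sum>j=1..Suc m. ?X * ?X * (?e j * ?e (Suc (Suc m) - j)) / x ^ Suc (Suc m))"
    by (rule sum.cong[OF refl wj])
  then have s: "(\<Sum>j=1..Suc m. wkb j E x * wkb (Suc (Suc m) - j) E x) = ?X * ?X * ?S / x ^ Suc (Suc m)"
    by (simp only: sum_divide_distrib sum_distrib_left)
  have "2 * wkb 0 E x * wkb (Suc (Suc m)) E x + (\<Sum>j=1..Suc m. wkb j E x * wkb (Suc (Suc m) - j) E x) =
     (2 * mom E x * (?X * ?e (Suc (Suc m))) + ?X * ?X * ?S) / x ^ Suc (Suc m)"
    unfolding s wkb_0[OF assms] by (simp only: wkb_def wkb_exp.simps ev.simps times_divide_eq_right add_divide_distrib)
  also have "\<dots> = dwkb (Suc m) E x"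
    unfolding 1 dwkb_def by (simp add: algebra_simps)
  finally show ?thesis .
qed

text \<open>Comparison of the coefficients of \<open>q ^ Suc n\<close> in the Riccati equation. The
  two extreme summands carry the new coefficient, hence the division by twice the momentum, written
  \<open>Ka ^ 2 / 2\<close>, in the recursion.\<close>

lemma wkb_rec:
  assumes "E \<in> K" "x \<in> {0<..b}"
  shows "(\<Sum>i\<le>Suc n. wkb i E x * wkb (Suc n - i) E x) = dwkb n E x"
proof (cases n)
  case 0
  show ?thesis using wkb_rec_0[OF assms] by (simp add: 0)
next
  case (Suc m)
  have "(\<Sum>i\<le>Suc n. wkb i E x * wkb (Suc n - i) E x) =
     wkb 0 E x * wkb (Suc n) E x + (\<Sum>i=1..n. wkb i E x * wkb (Suc n - i) E x) + wkb (Suc n) E x * wkb 0 E x"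
    by (simp add: atMost_atLeast0 sum.atLeast_Suc_atMost)
  then show ?thesis using wkb_rec_Suc[OF assms, of m] Suc by simp
qed

lemma wkb_bound:
  obtains B where "B \<ge> 0" "\<And>E x. E \<in> K \<Longrightarrow> x \<in> {0<..b} \<Longrightarrow> \<bar>wkb n E x\<bar> \<le> B / x ^ n"
    "\<And>E x. E \<in> K \<Longrightarrow> x \<in> {0<..b} \<Longrightarrow> \<bar>dwkb n E x\<bar> \<le> B / x ^ Suc n"
proof -
  obtain A where A: "A \<ge> 0" "\<And>E x. E \<in> K \<Longrightarrow> x \<in> {0<..b} \<Longrightarrow> \<bar>ev (wkb_exp \<gamma> n) E x\<bar> \<le> A"
    using ev_bounded by blast
  let ?d = "Add (th \<gamma> (wkb_exp \<gamma> n)) (Mul (Cst (- real n)) (wkb_exp \<gamma> n))"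
  obtain C where C: "C \<ge> 0" "\<And>E x. E \<in> K \<Longrightarrow> x \<in> {0<..b} \<Longrightarrow> \<bar>ev ?d E x\<bar> \<le> C"
    using ev_bounded by blast
  show ?thesis
  proof (rule that[of "max A C"])
    fix E x assume *: "E \<in> K" "x \<in> {0<..b}"
    show "\<bar>wkb n E x\<bar> \<le> max A C / x ^ n"
      using A(2)[OF *] * by (auto simp: wkb_def abs_divide power_abs intro!: divide_right_mono)
    have "dwkb n E x = ev ?d E x / x ^ Suc n" by (simp add: dwkb_def)
    then show "\<bar>dwkb n E x\<bar> \<le> max A C / x ^ Suc n"
      using C(2)[OF *] * by (simp add: abs_divide power_abs del: ev.simps power_Suc) (intro divide_right_mono, auto)
  qed (use A in auto)
qed

end

text \<open>The antidiagonals \<open>i + j = n\<close> with \<open>n \<le> M\<close> are complete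
  and form a Cauchy product; every remaining pair of indices has total degree above
  \<open>M\<close>.\<close>

lemma sum_square_split:
  fixes f :: "nat \<Rightarrow> nat \<Rightarrow> 'a::comm_monoid_add"
  shows "(\<Sum>i\<le>M. \<Sum>j\<le>M. f i j) = (\<Sum>n\<le>M. \<Sum>i\<le>n. f i (n - i)) + (\<Sum>i\<le>M. \<Sum>j\<in>{Suc M - i..M}. f i j)"
proof -
  have "(\<Sum>j\<le>M. f i j) = (\<Sum>j\<le>M - i. f i j) + (\<Sum>j\<in>{Suc M - i..M}. f i j)" if "i \<le> M" for i
  proof -
    have "{..M} = {..M - i} \<union> {Suc M - i..M}" "{..M - i} \<inter> {Suc M - i..M} = {}" using that by auto
    then show ?thesis by (metis finite_atMost finite_atLeastAtMost sum.union_disjoint)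
  qed
  then have "(\<Sum>i\<le>M. \<Sum>j\<le>M. f i j) = (\<Sum>i\<le>M. \<Sum>j\<le>M - i. f i j) + (\<Sum>i\<le>M. \<Sum>j\<in>{Suc M - i..M}. f i j)"
    by (simp add: sum.distrib)
  also have "(\<Sum>i\<le>M. \<Sum>j\<le>M - i. f i j) = (\<Sum>(i,j)\<in>{(i,j). i + j \<le> M}. f i j)"
  proof -
    have "{(i,j). i + j \<le> M} = Sigma {..M} (\<lambda>i. {..M - i})" by auto
    then show ?thesis by (simp add: sum.Sigma)
  qed
  also have "\<dots> = (\<Sum>n\<le>M. \<Sum>i\<le>n. f i (n - i))" by (rule sum.triangle_reindex_eq)
  finally show ?thesis .
qed

context bohr_sommerfeld
begin

definition wY :: "complex \<Rightarrow> nat \<Rightarrow> real \<Rightarrow> real \<Rightarrow> complex" where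
  "wY q M E x = (\<Sum>n\<le>M. q ^ n * of_real (wkb n E x))"

definition dwY :: "complex \<Rightarrow> nat \<Rightarrow> real \<Rightarrow> real \<Rightarrow> complex" where
  "dwY q M E x = (\<Sum>n\<le>M. q ^ n * of_real (dwkb n E x))"

text \<open>The recursion cancels all powers of \<open>q\<close> up to \<open>M\<close>. Whatever
  survives carries \<open>q ^ n\<close> with \<open>n > M\<close> accompanied by a bound
  \<open>1 / x ^ n\<close>, and \<open>norm q \<le> x\<close> lets all these powers of
  \<open>norm q / x\<close> be compared with the lowest one.\<close>

lemma wkb_residual:
  obtains C where "C \<ge> 0" "\<And>E x q. E \<in> K \<Longrightarrow> x \<in> {0<..b} \<Longrightarrow> norm q \<le> x \<Longrightarrow>
    norm ((wY q M E x)\<^sup>2 - q * dwY q M E x - of_real (E - V x)) \<le> C * (norm q / x) ^ Suc M"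
proof -
  have "\<exists>B. \<forall>n. B n \<ge> 0 \<and> (\<forall>E\<in>K. \<forall>x\<in>{0<..b}. \<bar>wkb n E x\<bar> \<le> B n / x ^ n \<and> \<bar>dwkb n E x\<bar> \<le> B n / x ^ Suc n)"
    by (rule choice, rule allI) (meson wkb_bound)
  then obtain B where B: "\<And>n. B n \<ge> 0" "\<And>n E x. E \<in> K \<Longrightarrow> x \<in> {0<..b} \<Longrightarrow> \<bar>wkb n E x\<bar> \<le> B n / x ^ n"
    "\<And>n E x. E \<in> K \<Longrightarrow> x \<in> {0<..b} \<Longrightarrow> \<bar>dwkb n E x\<bar> \<le> B n / x ^ Suc n" by blast
  define C where "C = (\<Sum>i\<le>M. \<Sum>j\<in>{Suc M - i..M}. B i * B j) + B M"
  show ?thesis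
  proof (rule that[of C])
    show "C \<ge> 0" unfolding C_def using B(1) by (intro add_nonneg_nonneg sum_nonneg mult_nonneg_nonneg) auto
    fix E x q assume E: "E \<in> K" and x: "x \<in> {0<..b}" and q: "norm (q::complex) \<le> x"
    define w where "w = (\<lambda>n. complex_of_real (wkb n E x))"
    define R where "R = (\<Sum>i\<le>M. \<Sum>j\<in>{Suc M - i..M}. q ^ (i + j) * (w i * w j))"
    define c where "c = (\<lambda>n. \<Sum>i\<le>n. w i * w (n - i))"
    have rec: "c (Suc n) = of_real (dwkb n E x)" for n
      unfolding c_def w_def wkb_rec[OF E x, symmetric] of_real_sum of_real_mult ..
    have c0: "c 0 = w 0 * w 0" by (simp add: c_def)
    have "(wY q M E x)\<^sup>2 = (\<Sum>i\<le>M. \<Sum>j\<le>M. q ^ (i + j) * (w i * w j))"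
      unfolding wY_def w_def power2_eq_square sum_product by (simp add: power_add mult_ac)
    also have "\<dots> = (\<Sum>n\<le>M. \<Sum>i\<le>n. q ^ (i + (n - i)) * (w i * w (n - i))) + R"
      unfolding R_def by (rule sum_square_split)
    also have "(\<Sum>n\<le>M. \<Sum>i\<le>n. q ^ (i + (n - i)) * (w i * w (n - i))) = (\<Sum>n\<le>M. q ^ n * c n)"
      unfolding sum_distrib_left c_def by (intro sum.cong refl) auto
    also have "\<dots> = w 0 * w 0 + (\<Sum>n<M. q ^ Suc n * of_real (dwkb n E x))"
      by (simp only: sum.atMost_shift rec c0 power_0 mult_1)
    also have "w 0 * w 0 = of_real (E - V x)"
      using Ka_mom(2)[OF E, of x] x unfolding w_def wkb_0[OF E x] by (simp add: power2_eq_square flip: of_real_mult)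
    finally have 1: "(wY q M E x)\<^sup>2 = of_real (E - V x) + (\<Sum>n<M. q ^ Suc n * of_real (dwkb n E x)) + R" .
    have 2: "q * dwY q M E x = (\<Sum>n<M. q ^ Suc n * of_real (dwkb n E x)) + q ^ Suc M * of_real (dwkb M E x)"
      unfolding dwY_def lessThan_Suc_atMost[symmetric] sum.lessThan_Suc by (simp add: distrib_left sum_distrib_left mult_ac)
    have x0: "x > 0" using x by simp
    have qx: "0 \<le> norm q / x" "norm q / x \<le> 1" using q x0 by (auto simp: divide_le_eq)
    have le: "norm q ^ n / x ^ n \<le> (norm q / x) ^ Suc M" if "n \<ge> Suc M" for n
      using power_decreasing[OF that qx] by (simp add: power_divide)
    have "norm R \<le> (\<Sum>i\<le>M. \<Sum>j\<in>{Suc M - i..M}. B i * B j * (norm q / x) ^ Suc M)"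
      unfolding R_def
    proof (intro sum_norm_le)
      fix i j assume ij: "i \<in> {..M}" "j \<in> {Suc M - i..M}"
      then have n: "i + j \<ge> Suc M" by auto
      have "norm (q ^ (i + j) * (w i * w j)) = norm q ^ (i + j) * (\<bar>wkb i E x\<bar> * \<bar>wkb j E x\<bar>)"
        by (simp add: norm_mult norm_power w_def)
      also have "\<dots> \<le> norm q ^ (i + j) * (B i / x ^ i * (B j / x ^ j))"
        using B(1) x0 by (intro mult_left_mono mult_mono B(2)[OF E x]) auto
      also have "\<dots> = B i * B j * (norm q ^ (i + j) / x ^ (i + j))" by (simp add: power_add)
      also have "\<dots> \<le> B i * B j * (norm q / x) ^ Suc M"
        using B(1) by (intro mult_left_mono le n) auto
      finally show "norm (q ^ (i + j) * (w i * w j)) \<le> B i * B j * (norm q / x) ^ Suc M" .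
    qed
    moreover have "norm (q ^ Suc M * of_real (dwkb M E x)) \<le> B M * (norm q / x) ^ Suc M"
    proof -
      have "norm (q ^ Suc M * of_real (dwkb M E x)) = norm q ^ Suc M * \<bar>dwkb M E x\<bar>"
        by (simp only: norm_mult norm_power norm_of_real)
      also have "\<dots> \<le> norm q ^ Suc M * (B M / x ^ Suc M)"
        by (intro mult_left_mono B(3)[OF E x]) auto
      finally show ?thesis by (simp add: power_divide mult_ac)
    qed
    ultimately have "norm (R - q ^ Suc M * of_real (dwkb M E x)) \<le> C * (norm q / x) ^ Suc M"
      unfolding C_def distrib_right sum_distrib_right by (intro order_trans[OF norm_triangle_ineq4] add_mono)
    then show "norm ((wY q M E x)\<^sup>2 - q * dwY q M E x - of_real (E - V x)) \<le> C * (norm q / x) ^ Suc M"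
      unfolding 1 2 by (simp add: algebra_simps)
  qed
qed

section \<open>Primitives of the WKB terms and their expansions at 0\<close>

lemma at_within_Ioc: "0 < e \<Longrightarrow> e < x \<Longrightarrow> x \<le> b \<Longrightarrow> at x within {0<..b} = at x within {e..b}"
  by (rule at_within_nhd[where S = "{e<..}"]) auto

lemma wkb_cont: "E \<in> K \<Longrightarrow> 0 < e \<Longrightarrow> continuous_on {e..b} (wkb n E)"
proof -
  assume "E \<in> K" "0 < e"
  then have "continuous_on {0<..b} (wkb n E)"
    by (meson wkb_deriv DERIV_continuous continuous_on_eq_continuous_within)
  then show ?thesis by (rule continuous_on_subset) (use \<open>0 < e\<close> in auto)
qed

text \<open>The integration starts at the right end point, so that all corrections to the phase
  vanish at \<open>b\<close> and matter only at the matching point.\<close>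

definition "wH n E x = integral {x..b} (wkb n E)"

lemma wH_deriv:
  assumes "E \<in> K" "x \<in> {0<..b}"
  shows "(wH n E has_real_derivative - wkb n E x) (at x within {0<..b})"
proof -
  have "((\<lambda>x. integral {x..b} (wkb n E)) has_real_derivative - wkb n E x) (at x within {x / 2..b})"
    by (rule integral_has_real_derivative'[OF wkb_cont]) (use assms in auto)
  moreover have "at x within {0<..b} = at x within {x / 2..b}" by (rule at_within_Ioc) (use assms in auto)
  ultimately show ?thesis unfolding wH_def[abs_def] by simp
qed

lemma wH_bound:
  assumes "n \<ge> 2"
  obtains B where "B \<ge> 0" "\<And>E x. E \<in> K \<Longrightarrow> x \<in> {0<..b} \<Longrightarrow> \<bar>wH n E x\<bar> \<le> B / x ^ (n - 1)"
proof -
  obtain B where B: "B \<ge> 0" "\<And>E x. E \<in> K \<Longrightarrow> x \<in> {0<..b} \<Longrightarrow> \<bar>wkb n E x\<bar> \<le> B / x ^ n"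
    by (rule wkb_bound[of n]) blast
  define r where "r = real (n - 1)"
  have r: "r \<ge> 1" "real n = r + 1" using assms by (auto simp: r_def)
  show ?thesis
  proof (rule that[of "B / r"])
    fix E x assume E: "E \<in> K" and x: "x \<in> {0<..b}"
    have "norm (complex_of_real (wH n E b) - of_real (wH n E x)) \<le> (- (B/r) * b powr (- r)) - (- (B/r) * x powr (- r))"
    proof (rule norm_diff_le_of_deriv[where f = "\<lambda>t. of_real (wH n E t)" and g = "\<lambda>t. - (B/r) * t powr (- r)"
          and f' = "\<lambda>t. of_real (- wkb n E t)" and g' = "\<lambda>t. B * t powr (- r - 1)"])
      fix t assume t: "t \<in> {x..b}"
      then have t': "t \<in> {0<..b}" "t > 0" using x by auto
      have "(wH n E has_real_derivative - wkb n E t) (at t within {x..b})"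
        by (rule DERIV_subset[OF wH_deriv[OF E t'(1)]]) (use x in auto)
      then show "((\<lambda>t. complex_of_real (wH n E t)) has_vector_derivative of_real (- wkb n E t)) (at t within {x..b})"
        by (rule has_vector_derivative_of_real)
      have "((\<lambda>t. - (B/r) * t powr (- r)) has_real_derivative - (B/r) * (- r * t powr (- r - 1))) (at t within {x..b})"
        using t' by (auto intro!: derivative_eq_intros)
      then show "((\<lambda>t. - (B/r) * t powr (- r)) has_real_derivative B * t powr (- r - 1)) (at t within {x..b})"
        using r by simp
      have "t ^ n = t powr (r + 1)" using t' r by (metis powr_realpow)
      then have "B / t ^ n = B * t powr (- r - 1)" 
        using powr_minus_divide[of t "r + 1"] by simp
      then show "norm (complex_of_real (- wkb n E t)) \<le> B * t powr (- r - 1)"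
        using B(2)[OF E t'(1)] by simp
    qed (use x in auto)
    moreover have "wH n E b = 0" by (simp add: wH_def)
    moreover have "0 \<le> (B/r) * b powr (- r)" using B(1) r by simp
    moreover have "x powr (- r) = 1 / x ^ (n - 1)"
      using x powr_minus_divide[of x r] powr_realpow[of x "n - 1"] by (simp add: r_def)
    ultimately show "\<bar>wH n E x\<bar> \<le> B / r / x ^ (n - 1)" by simp
  qed (use B r in auto)
qed

text \<open>\<open>x powr a\<close> carries the singular part, and \<open>d\<close> counts the
  factors \<open>x powr \<gamma>\<close> that the integrand brings along. A term of exponent
  \<open>s + a - 1\<close> has the primitive \<open>x powr (s + a) / (s + a)\<close>; the hypothesis
  on exponents excludes logarithms. The WKB terms correspond to \<open>d = 1\<close> and
  \<open>a = 1 - n\<close>, the action to \<open>d = 0\<close> and \<open>a = 1\<close>.\<close>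

lemma antider_lin:
  assumes ne: "\<And>m j. real (m + d) * \<gamma> + real j + a \<noteq> 0" and "L \<in> lin powB"
  shows "\<exists>M\<in>lin powB. \<forall>E. \<forall>x>0. ((\<lambda>x. of_real (x powr a) * M x E) has_vector_derivative
     of_real (x powr (real d * \<gamma> + a - 1)) * L x E) (at x)"
  using assms(2)
proof (induction L rule: lin.induct)
  case lin_zero
  show ?case by (rule bexI[OF _ lin.lin_zero]) auto
next
  case (lin_plus f L)
  from lin_plus.IH obtain M where M: "M \<in> lin powB" "\<forall>E. \<forall>x>0. ((\<lambda>x. of_real (x powr a) * M x E) has_vector_derivative
     of_real (x powr (real d * \<gamma> + a - 1)) * L x E) (at x)" by blast
  obtain c m j where f: "f = (\<lambda>h E. c E * of_real (h powr (real m * \<gamma> + real j)))" and c: "bounded (c ` K)"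
    using lin_plus(1) unfolding powB_def by blast
  define s where "s = real (m + d) * \<gamma> + real j"
  have s: "s + a \<noteq> 0" using ne by (simp add: s_def)
  show ?case
  proof (intro bexI[of _ "\<lambda>h E. (of_real (1 / (s + a)) * c E) * of_real (h powr (real (m + d) * \<gamma> + real j)) + M h E"] allI impI)
    show "(\<lambda>h E. (of_real (1 / (s + a)) * c E) * of_real (h powr (real (m + d) * \<gamma> + real j)) + M h E) \<in> lin powB"
      by (intro lin.lin_plus powB_I bounded_times bounded_const c M)
    fix E x :: real assume x: "x > 0"
    have "((\<lambda>x. x powr (s + a) / (s + a)) has_real_derivative x powr (s + a - 1)) (at x)"
      using x s by (auto intro!: derivative_eq_intros)
    then have "((\<lambda>x. complex_of_real (x powr (s + a) / (s + a))) has_vector_derivative of_real (x powr (s + a - 1))) (at x)"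
      by (rule has_vector_derivative_of_real)
    from has_vector_derivative_add[OF has_vector_derivative_mult_right[OF this, of "c E"] M(2)[rule_format, OF x, of E]]
    have der: "((\<lambda>x. c E * complex_of_real (x powr (s + a) / (s + a)) + of_real (x powr a) * M x E) has_vector_derivative
       c E * of_real (x powr (s + a - 1)) + of_real (x powr (real d * \<gamma> + a - 1)) * L x E) (at x)" .
    have sa: "s + a - 1 = (real d * \<gamma> + a - 1) + (real m * \<gamma> + real j)" by (simp add: s_def algebra_simps)
    have pw: "x powr (s + a - 1) = x powr (real d * \<gamma> + a - 1) * x powr (real m * \<gamma> + real j)"
      unfolding sa by (rule powr_add)
    have 1: "c E * of_real (x powr (s + a - 1)) + of_real (x powr (real d * \<gamma> + a - 1)) * L x E
       = of_real (x powr (real d * \<gamma> + a - 1)) * (f x E + L x E)"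
      unfolding f pw by (simp add: distrib_left)
    have 2: "(\<lambda>x. c E * complex_of_real (x powr (s + a) / (s + a)) + of_real (x powr a) * M x E) =
       (\<lambda>x. of_real (x powr a) * ((of_real (1 / (s + a)) * c E) * of_real (x powr (real (m + d) * \<gamma> + real j)) + M x E))"
      unfolding s_def[symmetric] powr_add by (simp add: fun_eq_iff distrib_left)
    show "((\<lambda>x. of_real (x powr a) * ((of_real (1 / (s + a)) * c E) * of_real (x powr (real (m + d) * \<gamma> + real j)) + M x E)) has_vector_derivative
       of_real (x powr (real d * \<gamma> + a - 1)) * (f x E + L x E)) (at x)"
      using der unfolding 1 2 .
  qed
qed

lemma lin_powB_bounded:
  assumes "M \<in> lin powB"
  shows "\<exists>B. \<forall>E\<in>K. norm (M x E) \<le> B"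
  using assms
proof (induction M rule: lin.induct)
  case lin_zero then show ?case by (intro exI[of _ 0]) auto
next
  case (lin_plus f M)
  then obtain B where B: "\<forall>E\<in>K. norm (M x E) \<le> B" by blast
  obtain c m j where f: "f = (\<lambda>h E. c E * of_real (h powr (real m * \<gamma> + real j)))" and c: "bounded (c ` K)"
    using lin_plus(1) unfolding powB_def by blast
  obtain A where A: "\<And>E. E \<in> K \<Longrightarrow> norm (c E) \<le> A" using c unfolding bounded_iff by blast
  have "norm (f x E + M x E) \<le> A * x powr (real m * \<gamma> + real j) + B" if "E \<in> K" for E
  proof -
    have "norm (f x E) \<le> A * x powr (real m * \<gamma> + real j)"
      unfolding f norm_mult using A[OF that] by (auto intro: mult_right_mono)
    then show ?thesis using B that norm_triangle_ineq[of "f x E" "M x E"] by fastforce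
  qed
  then show ?case by blast
qed

lemma approx_antider:
  assumes ne: "\<And>m j. real (m + d) * \<gamma> + real j + a \<noteq> 0"
    and f: "approx powB PK f"
    and F: "\<And>E x. E \<in> K \<Longrightarrow> x \<in> {0<..b} \<Longrightarrow> (F E has_vector_derivative of_real (x powr (real d * \<gamma> + a - 1)) * f x E) (at x within {0<..b})"
    and bd: "\<And>x. x \<in> {0<..b} \<Longrightarrow> \<exists>B. \<forall>E\<in>K. norm (F E x) \<le> B"
  shows "\<exists>c M. bounded (c ` K) \<and> M \<in> lin powB \<and> bigo_on PK N (\<lambda>x E. F E x - c E - of_real (x powr a) * M x E)"
proof -
  \<comment> \<open>A positive order makes the remainder integrable at 0, so that the difference of
    \<open>F\<close> and the explicit primitive has a limit there; this limit is the constant of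
    integration.\<close>
  define r where "r = max N 1"
  obtain L where L: "L \<in> lin powB" "bigo_on PK (r - (real d * \<gamma> + a)) (\<lambda>x E. f x E - L x E)"
    using f unfolding approx_def by blast
  obtain M where M: "M \<in> lin powB" "\<forall>E. \<forall>x>0. ((\<lambda>x. of_real (x powr a) * M x E) has_vector_derivative
     of_real (x powr (real d * \<gamma> + a - 1)) * L x E) (at x)"
    using antider_lin[OF ne L(1)] by blast
  obtain C where C: "C \<ge> 0" "\<forall>\<^sub>F x in at_right 0. \<forall>E\<in>K. norm (f x E - L x E) \<le> C * x powr (r - (real d * \<gamma> + a))"
    using L(2) by (rule bigo_onE)
  then obtain e where e: "e > 0" "\<And>x E. 0 < x \<Longrightarrow> x < e \<Longrightarrow> E \<in> K \<Longrightarrow> norm (f x E - L x E) \<le> C * x powr (r - (real d * \<gamma> + a))"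
    unfolding eventually_at_right_field by blast
  define x0 where "x0 = min (e / 2) b"
  have x0: "x0 > 0" "x0 \<le> b" "x0 < e" using e(1) b_pos by (auto simp: x0_def)
  have "\<exists>c. \<forall>x\<in>{0<..x0}. norm ((F E x - of_real (x powr a) * M x E) - c) \<le> C / r * x powr r" if E: "E \<in> K" for E
  proof (rule limit_at_0_of_deriv_bound)
    fix x assume x: "x \<in> {0<..x0}"
    show "((\<lambda>x. F E x - of_real (x powr a) * M x E) has_vector_derivative
       of_real (x powr (real d * \<gamma> + a - 1)) * f x E - of_real (x powr (real d * \<gamma> + a - 1)) * L x E) (at x within {0<..x0})"
    proof (rule has_vector_derivative_diff)
      show "(F E has_vector_derivative of_real (x powr (real d * \<gamma> + a - 1)) * f x E) (at x within {0<..x0})"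
        by (rule has_vector_derivative_within_subset[OF F[OF E]]) (use x x0 in auto)
      show "((\<lambda>x. of_real (x powr a) * M x E) has_vector_derivative of_real (x powr (real d * \<gamma> + a - 1)) * L x E) (at x within {0<..x0})"
        by (rule has_vector_derivative_at_within) (use M(2) x in auto)
    qed
    have "norm (of_real (x powr (real d * \<gamma> + a - 1)) * f x E - of_real (x powr (real d * \<gamma> + a - 1)) * L x E)
      = x powr (real d * \<gamma> + a - 1) * norm (f x E - L x E)"
      by (simp add: norm_mult flip: right_diff_distrib)
    also have "\<dots> \<le> x powr (real d * \<gamma> + a - 1) * (C * x powr (r - (real d * \<gamma> + a)))"
      using x x0 E by (intro mult_left_mono e(2)) auto
    also have "\<dots> = C * (x powr (real d * \<gamma> + a - 1) * x powr (r - (real d * \<gamma> + a)))" by simp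
    also have "x powr (real d * \<gamma> + a - 1) * x powr (r - (real d * \<gamma> + a)) = x powr (r - 1)"
      by (subst powr_add[symmetric]) simp
    finally show "norm (of_real (x powr (real d * \<gamma> + a - 1)) * f x E - of_real (x powr (real d * \<gamma> + a - 1)) * L x E) \<le> C * x powr (r - 1)" .
  qed (use x0 in \<open>auto simp: r_def\<close>)
  then obtain c where c: "\<And>E x. E \<in> K \<Longrightarrow> x \<in> {0<..x0} \<Longrightarrow> norm ((F E x - of_real (x powr a) * M x E) - c E) \<le> C / r * x powr r"
    by metis
  obtain B1 where B1: "\<forall>E\<in>K. norm (F E x0) \<le> B1" using bd[of x0] x0 by auto
  obtain B2 where B2: "\<forall>E\<in>K. norm (M x0 E) \<le> B2" using lin_powB_bounded[OF M(1)] by blast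
  \<comment> \<open>The constant arises as a limit for each energy separately; its boundedness in
    \<open>E\<close> is read off at the point \<open>x0\<close>, which is the same for all
    energies.\<close>
  have "norm (c E) \<le> B1 + x0 powr a * B2 + C / r * x0 powr r" if E: "E \<in> K" for E
  proof -
    have "norm (of_real (x0 powr a) * M x0 E) \<le> x0 powr a * B2"
      using B2 E by (auto simp: norm_mult intro: mult_left_mono)
    moreover have "norm (F E x0) \<le> B1" using B1 E by blast
    moreover have "norm ((F E x0 - of_real (x0 powr a) * M x0 E) - c E) \<le> C / r * x0 powr r" using c[OF E] x0 by simp
    moreover have "c E = F E x0 - of_real (x0 powr a) * M x0 E - ((F E x0 - of_real (x0 powr a) * M x0 E) - c E)" by simp
    ultimately show ?thesis
      by (metis (no_types, lifting) add_mono norm_triangle_ineq4 order_trans)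
  qed
  then have "bounded (c ` K)" unfolding bounded_iff by blast
  moreover have "bigo_on PK N (\<lambda>x E. F E x - c E - of_real (x powr a) * M x E)"
  proof (rule bigo_on_mono)
    show "bigo_on PK r (\<lambda>x E. F E x - c E - of_real (x powr a) * M x E)"
    proof (rule bigo_onI[of _ _ "C / r"], use eventually_small[OF x0(1)] in eventually_elim)
      case (elim x)
      then show ?case using c[of _ x] by (simp add: algebra_simps)
    qed
  qed (simp add: r_def)
  ultimately show ?thesis using M(1) by blast
qed

text \<open>Thanks to the factor \<open>x powr \<gamma>\<close> split off in \<open>wkb_exp\<close>,
  the integrand has the exponents \<open>(m + 1) * \<gamma> + j - n\<close>, which irrationality
  keeps away from -1. The factor \<open>x ^ (n - 1)\<close> removes the negative exponents and turns
  the constant of integration into the coefficient of \<open>x ^ (n - 1)\<close>.\<close>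

lemma approx_wH:
  assumes "n \<ge> 2"
  shows "approx powB PK (\<lambda>x E. of_real (x ^ (n - 1) * wH n E x))"
proof (rule approx_limit)
  fix N :: real
  have n: "real (n - 1) = real n - 1" using assms by simp
  have "\<exists>c M. bounded (c ` K) \<and> M \<in> lin powB \<and>
     bigo_on PK N (\<lambda>x E. of_real (wH n E x) - c E - of_real (x powr (1 - real n)) * M x E)"
  proof (rule approx_antider[where d = 1 and f = "\<lambda>x E. of_real (ev (Mul (Cst (-1)) (wk \<gamma> n)) E x)" and F = "\<lambda>E x. of_real (wH n E x)"])
    fix m j
    have "real (m + 1) * \<gamma> + real_of_int (int j + 1 - int n) \<in> exps \<gamma> 1" unfolding exps_def by fastforce
    then have "real (m + 1) * \<gamma> + real_of_int (int j + 1 - int n) \<noteq> of_int 0" by (rule exps_1_not_int[OF gamma_irrat])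
    then show "real (m + 1) * \<gamma> + real j + (1 - real n) \<noteq> 0" by (simp add: algebra_simps)
  next
    fix E x assume E: "E \<in> K" and x: "x \<in> {0<..b}"
    have "- wkb n E x = x powr (\<gamma> - real n) * ev (Mul (Cst (-1)) (wk \<gamma> n)) E x"
    proof -
      obtain k where k: "n = Suc k" using assms by (cases n) auto
      show ?thesis unfolding wkb_def k using x by (simp add: powr_diff powr_realpow[symmetric] del: power_Suc of_nat_Suc)
    qed
    then show "((\<lambda>x. complex_of_real (wH n E x)) has_vector_derivative of_real (x powr (real 1 * \<gamma> + (1 - real n) - 1)) * of_real (ev (Mul (Cst (-1)) (wk \<gamma> n)) E x)) (at x within {0<..b})"
      using has_vector_derivative_of_real[OF wH_deriv[OF E x, of n]]
      by (simp only: of_real_mult[symmetric]) simp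
  next
    fix x assume x: "x \<in> {0<..b}"
    obtain B where "\<And>E x. E \<in> K \<Longrightarrow> x \<in> {0<..b} \<Longrightarrow> \<bar>wH n E x\<bar> \<le> B / x ^ (n - 1)" by (rule wH_bound[OF assms]) blast
    then show "\<exists>B. \<forall>E\<in>K. norm (complex_of_real (wH n E x)) \<le> B" using x by auto
  qed (rule approx_ev)
  then obtain c M where c: "bounded (c ` K)" and M: "M \<in> lin powB"
    and cM: "bigo_on PK N (\<lambda>x E. of_real (wH n E x) - c E - of_real (x powr (1 - real n)) * M x E)"
    by (elim exE conjE) (rule that)
  have "approx powB PK (\<lambda>x E. of_real x ^ (n - 1) * c E + M x E)"
    by (intro approx_add approx_mult[OF gauge_pow] approx_power[OF gauge_pow] approx_x approx_coeff c approx_lin M)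
  moreover have "bigo_on PK N (\<lambda>x E. of_real (x ^ (n - 1) * wH n E x) - (of_real x ^ (n - 1) * c E + M x E))"
  proof (rule bigo_on_cong)
    have "bigo_on PK (real (n - 1) + N) (\<lambda>x E. of_real (x powr real (n - 1)) * (of_real (wH n E x) - c E - of_real (x powr (1 - real n)) * M x E))"
      by (rule bigo_on_mult[OF bigo_on_h_powr cM])
    then show "bigo_on PK N (\<lambda>x E. of_real (x powr real (n - 1)) * (of_real (wH n E x) - c E - of_real (x powr (1 - real n)) * M x E))"
      by (rule bigo_on_mono) simp
    show "\<forall>\<^sub>F x in at_right 0. \<forall>E\<in>K. of_real (x powr real (n - 1)) * (of_real (wH n E x) - c E - of_real (x powr (1 - real n)) * M x E) = of_real (x ^ (n - 1) * wH n E x) - (of_real x ^ (n - 1) * c E + M x E)"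
      using eventually_small[OF zero_less_one]
    proof eventually_elim
      case (elim x)
      have "x powr real (n - 1) * x powr (1 - real n) = 1" using elim n by (subst powr_add[symmetric]) simp
      then have 1: "complex_of_real (x powr real (n - 1)) * of_real (x powr (1 - real n)) = 1" by (metis of_real_1 of_real_mult)
      have 2: "x powr real (n - 1) = x ^ (n - 1)" using elim by (intro powr_realpow) auto
      show ?case using 1 unfolding 2 by (simp add: algebra_simps)
    qed
  qed
  ultimately show "\<exists>G. approx powB PK G \<and> bigo_on PK N (\<lambda>x E. of_real (x ^ (n - 1) * wH n E x) - G x E)" by blast
qed

section \<open>The action integral near the left end point\<close>

definition "action E x = integral {0..x} (mom E)"

lemma mom_cont: "continuous_on {0..b} (mom E)"
  unfolding mom_def by (intro continuous_intros V_cont)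

lemma action_deriv:
  assumes "x \<in> {0..b}"
  shows "(action E has_real_derivative mom E x) (at x within {0..b})"
  unfolding action_def[abs_def] by (rule integral_has_real_derivative[OF mom_cont assms])

lemma V_bound: obtains B where "B \<ge> 0" "\<And>x. x \<in> {0..b} \<Longrightarrow> \<bar>V x\<bar> \<le> B * x powr \<gamma>"
proof -
  obtain B where B: "B \<ge> 0" "\<And>x. x \<in> {0..b} \<Longrightarrow> \<bar>D 0 x\<bar> \<le> B" using D_bounded by blast
  have "\<bar>V x\<bar> \<le> B * x powr \<gamma>" if "x \<in> {0..b}" for x
    using mult_right_mono[OF B(2)[OF that], of "x powr \<gamma>"] that by (simp add: V_eq abs_mult mult.commute)
  then show ?thesis using that B(1) by blast
qed

lemma mom_diff_bound:
  obtains B where "B \<ge> 0" "\<And>E x. E \<in> K \<Longrightarrow> x \<in> {0..b} \<Longrightarrow> \<bar>mom E x - sqrt E\<bar> \<le> B * x powr \<gamma>"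
proof -
  obtain B where B: "B \<ge> 0" "\<And>x. x \<in> {0..b} \<Longrightarrow> \<bar>V x\<bar> \<le> B * x powr \<gamma>" by (rule V_bound) blast
  have "\<bar>mom E x - sqrt E\<bar> \<le> B / sqrt \<delta>\<^sub>0 * x powr \<gamma>" if E: "E \<in> K" and x: "x \<in> {0..b}" for E x
  proof -
    have m: "mom E x > 0" by (rule mom_pos[OF E x])
    have k: "sqrt E \<ge> sqrt \<delta>\<^sub>0" "sqrt \<delta>\<^sub>0 > 0" using E_ge[OF E] delta_pos by auto
    have "(mom E x - sqrt E) * (mom E x + sqrt E) = - V x"
      using Ka_mom(2)[OF E x] E_pos[OF E] by (simp add: algebra_simps power2_eq_square)
    then have "\<bar>mom E x - sqrt E\<bar> * (mom E x + sqrt E) = \<bar>V x\<bar>"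
      using m k by (metis abs_minus_cancel abs_mult abs_of_pos add_pos_pos order_less_le_trans)
    then have "\<bar>mom E x - sqrt E\<bar> = \<bar>V x\<bar> / (mom E x + sqrt E)" 
    proof (subst nonzero_eq_divide_eq)
      show "mom E x + sqrt E \<noteq> 0" using m k by linarith
    qed
    also have "\<dots> \<le> (B * x powr \<gamma>) / sqrt \<delta>\<^sub>0" 
    proof (intro frac_le)
      show "sqrt \<delta>\<^sub>0 \<le> mom E x + sqrt E" using m k by linarith
    qed (use k B(2)[OF x] B(1) in auto)
    finally show ?thesis by simp
  qed
  then show ?thesis using that[of "B / sqrt \<delta>\<^sub>0"] B(1) delta_pos by simp
qed

lemma action_diff_bound:
  obtains B where "B \<ge> 0" "\<And>E x. E \<in> K \<Longrightarrow> x \<in> {0..b} \<Longrightarrow> \<bar>action E x - sqrt E * x\<bar> \<le> B * x powr \<gamma> * x"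
proof -
  obtain B where B: "B \<ge> 0" "\<And>E x. E \<in> K \<Longrightarrow> x \<in> {0..b} \<Longrightarrow> \<bar>mom E x - sqrt E\<bar> \<le> B * x powr \<gamma>" by (rule mom_diff_bound) blast
  have "\<bar>action E x - sqrt E * x\<bar> \<le> B * x powr \<gamma> * x" if E: "E \<in> K" and x: "x \<in> {0..b}" for E x
  proof -
    have c: "continuous_on {0..x} (mom E)" by (rule continuous_on_subset[OF mom_cont]) (use x in auto)
    have "action E x - sqrt E * x = integral {0..x} (\<lambda>t. mom E t - sqrt E)"
      unfolding action_def using x by (subst integral_diff) (auto intro: integrable_continuous_real c)
    also have "norm \<dots> \<le> (B * x powr \<gamma>) * (x - 0)"
    proof (rule integral_bound)
      fix t assume t: "t \<in> {0..x}"
      then have "\<bar>mom E t - sqrt E\<bar> \<le> B * t powr \<gamma>" using B(2)[OF E, of t] x by auto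
      also have "\<dots> \<le> B * x powr \<gamma>" using t B(1) gamma_pos by (intro mult_left_mono powr_mono2) auto
      finally show "norm (mom E t - sqrt E) \<le> B * x powr \<gamma>" by simp
    qed (use x in \<open>auto intro!: continuous_intros c\<close>)
    finally show ?thesis by simp
  qed
  then show ?thesis using that B(1) by blast
qed

lemma bigo_action: "bigo_on PK \<gamma> (\<lambda>x E. of_real ((action E x - sqrt E * x) / x))"
proof -
  obtain B where B: "B \<ge> 0" "\<And>E x. E \<in> K \<Longrightarrow> x \<in> {0..b} \<Longrightarrow> \<bar>action E x - sqrt E * x\<bar> \<le> B * x powr \<gamma> * x" by (rule action_diff_bound) blast
  show ?thesis
  proof (rule bigo_onI[of _ _ B], use eventually_le_b in eventually_elim)
    case (elim x)
    show ?case
    proof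
      fix E assume E: "E \<in> K"
      have "\<bar>action E x - sqrt E * x\<bar> / x \<le> B * x powr \<gamma>" using B(2)[OF E, of x] elim by (simp add: divide_le_eq)
      then show "norm (complex_of_real ((action E x - sqrt E * x) / x)) \<le> B * x powr \<gamma>"
        unfolding norm_of_real abs_divide using elim by simp
    qed
  qed
qed

lemma approx_sqrt_E: "approx powB PK (\<lambda>x E. of_real (sqrt E))"
proof (rule approx_cong[OF approx_E_powr[of "1/2"]])
  have "E powr (1/2) = sqrt E" if "E \<in> K" for E using E_pos[OF that] by (simp add: powr_half_sqrt)
  then show "\<forall>\<^sub>F x in at_right 0. \<forall>E\<in>K. complex_of_real (E powr (1/2)) = of_real (sqrt E)"
    by (intro always_eventually) simp
qed

lemma approx_mom: "approx powB PK (\<lambda>x E. of_real (mom E x))"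
proof (rule approx_cong[OF approx_ev[of "wkb_exp \<gamma> 0"]])
  show "\<forall>\<^sub>F x in at_right 0. \<forall>E\<in>K. of_real (ev (wkb_exp \<gamma> 0) E x) = complex_of_real (mom E x)"
    using eventually_le_b
  proof eventually_elim
    case (elim x)
    show ?case using wkb_0[OF _ elim] by (simp add: wkb_def)
  qed
qed

text \<open>The part \<open>sqrt E * x\<close> is removed because at the matching point it
  contributes exactly \<open>pi * n\<close> to the phase. The rest, relative to \<open>x\<close>, is
  small of order \<open>\<gamma>\<close>, and this gain has to outweigh the factor \<open>n\<close>
  by which it is multiplied later.\<close>

lemma approx_action: "approx powB PK (\<lambda>x E. of_real ((action E x - sqrt E * x) / x))"
proof (rule approx_limit)
  fix N :: real
  \<comment> \<open>One order beyond \<open>abs N\<close> pays for the later division by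
    \<open>x\<close>; it also makes the remainder \<open>O(x)\<close>, which the argument for a
    vanishing constant uses.\<close>
  define r where "r = \<bar>N\<bar> + 1"
  have "\<exists>c M. bounded (c ` K) \<and> M \<in> lin powB \<and>
     bigo_on PK r (\<lambda>x E. of_real (action E x - sqrt E * x) - c E - of_real (x powr 1) * M x E)"
  proof (rule approx_antider[where d = 0 and f = "\<lambda>x E. of_real (mom E x) - of_real (sqrt E)" and F = "\<lambda>E x. of_real (action E x - sqrt E * x)"])
    show "real (m + 0) * \<gamma> + real j + 1 \<noteq> 0" for m j
      using gamma_pos by (metis add.right_neutral add_nonneg_pos add_nonneg_nonneg less_imp_le less_irrefl mult_nonneg_nonneg of_nat_0_le_iff zero_less_one)
    show "approx powB PK (\<lambda>x E. of_real (mom E x) - of_real (sqrt E))"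
      by (intro approx_diff[OF gauge_pow] approx_mom approx_sqrt_E)
  next
    fix E x assume E: "E \<in> K" and x: "x \<in> {0<..b}"
    have "(action E has_real_derivative mom E x) (at x within {0<..b})"
      by (rule DERIV_subset[OF action_deriv]) (use x in auto)
    then have "((\<lambda>x. action E x - sqrt E * x) has_real_derivative mom E x - sqrt E * 1) (at x within {0<..b})"
      by (intro DERIV_diff DERIV_cmult DERIV_ident)
    from has_vector_derivative_of_real[OF this]
    show "((\<lambda>x. complex_of_real (action E x - sqrt E * x)) has_vector_derivative of_real (x powr (real 0 * \<gamma> + 1 - 1)) * (of_real (mom E x) - of_real (sqrt E))) (at x within {0<..b})"
      using x by simp
  next
    fix x assume x: "x \<in> {0<..b}"
    obtain B where B: "\<And>E x. E \<in> K \<Longrightarrow> x \<in> {0..b} \<Longrightarrow> \<bar>action E x - sqrt E * x\<bar> \<le> B * x powr \<gamma> * x" by (rule action_diff_bound) blast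
    show "\<exists>B. \<forall>E\<in>K. norm (complex_of_real (action E x - sqrt E * x)) \<le> B"
      unfolding norm_of_real using B[of _ x] x by auto
  qed
  then obtain c M where c: "bounded (c ` K)" and M: "M \<in> lin powB"
    and cM: "bigo_on PK r (\<lambda>x E. of_real (action E x - sqrt E * x) - c E - of_real (x powr 1) * M x E)"
    by (elim exE conjE) (rule that)
  have bF: "bigo_on PK 1 (\<lambda>x E. of_real (action E x - sqrt E * x))"
  proof (rule bigo_on_cong)
    show "bigo_on PK 1 (\<lambda>x E. of_real (x powr 1) * of_real ((action E x - sqrt E * x) / x))"
      by (rule bigo_on_mono[OF bigo_on_mult[OF bigo_on_h_powr bigo_action]]) (use gamma_pos in auto)
    show "\<forall>\<^sub>F x in at_right 0. \<forall>E\<in>K. of_real (x powr 1) * of_real ((action E x - sqrt E * x) / x) = complex_of_real (action E x - sqrt E * x)"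
      using eventually_le_b by eventually_elim (auto simp flip: of_real_mult)
  qed
  have bM: "bigo_on PK 1 (\<lambda>x E. of_real (x powr 1) * M x E)"
    using bigo_on_mult[OF bigo_on_h_powr lin_powB_bigo[OF M], of 1] by simp
  have "bigo_on PK 1 (\<lambda>x E. of_real (action E x - sqrt E * x) - of_real (x powr 1) * M x E - (of_real (action E x - sqrt E * x) - c E - of_real (x powr 1) * M x E))"
    by (intro bigo_on_diff bF bM bigo_on_mono[OF cM]) (simp add: r_def)
  \<comment> \<open>The constant of integration does not depend on \<open>x\<close>; being
    \<open>O(x)\<close>, it vanishes on \<open>K\<close>. Otherwise the division by \<open>x\<close>
    would leave a term \<open>c E / x\<close>.\<close>
  then have bc: "bigo_on PK 1 (\<lambda>x E. c E)" by simp
  have c0: "c E = 0" if E: "E \<in> K" for E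
  proof (rule ccontr)
    assume "c E \<noteq> 0"
    then have "\<forall>\<^sub>F x in at_right (0::real). \<forall>E'\<in>K. norm (c E') \<le> norm (c E) / 2"
      by (intro bigo_on_small[OF bc]) auto
    then have "\<forall>\<^sub>F x in at_right (0::real). False"
      by eventually_elim (use E \<open>c E \<noteq> 0\<close> in force)
    then show False by simp
  qed
  have "bigo_on PK N (\<lambda>x E. of_real ((action E x - sqrt E * x) / x) - M x E)"
  proof (rule bigo_on_cong)
    show "bigo_on PK N (\<lambda>x E. of_real (x powr (-1)) * (of_real (action E x - sqrt E * x) - c E - of_real (x powr 1) * M x E))"
      by (rule bigo_on_mono[OF bigo_on_mult[OF bigo_on_h_powr cM]]) (simp add: r_def)
    show "\<forall>\<^sub>F x in at_right 0. \<forall>E\<in>K. of_real (x powr (-1)) * (of_real (action E x - sqrt E * x) - c E - of_real (x powr 1) * M x E) = of_real ((action E x - sqrt E * x) / x) - M x E"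
      using eventually_le_b
    proof eventually_elim
      case (elim x)
      then show ?case by (simp add: c0 powr_minus_divide field_simps)
    qed
  qed
  then show "\<exists>G. approx powB PK G \<and> bigo_on PK N (\<lambda>x E. of_real ((action E x - sqrt E * x) / x) - G x E)"
    using approx_lin[OF M] by blast
qed

section \<open>The exact solution and its WKB Wronskian\<close>

definition "amp h E s = picard_sum (vpot h E) s"
definition "sol h E x = Im (cis (sqrt E * x / h) * amp h E (sqrt E * x / h))"
text \<open>This is \<open>h\<close> times the derivative of \<open>sol\<close>. With this scaling
  both functions stay bounded as \<open>h\<close> tends to 0, and the value at 0 is
  \<open>sqrt E\<close>.\<close>

definition "dsol h E x = sqrt E * Re (cis (sqrt E * x / h) * amp h E (sqrt E * x / h))"

lemma vpot_cont_full:
  assumes "E \<in> K" "h > 0"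
  shows "continuous_on {0..sqrt E * b / h} (vpot h E)"
proof -
  have "continuous_on {0..sqrt E * b / h} (\<lambda>t. V (h * t / sqrt E))"
  proof (rule continuous_on_compose2[OF V_cont])
    show "(\<lambda>t. h * t / sqrt E) ` {0..sqrt E * b / h} \<subseteq> {0..b}"
      using E_pos[OF assms(1)] assms(2) by (auto simp: field_simps)
  qed (intro continuous_intros, use E_pos[OF assms(1)] in auto)
  then show ?thesis unfolding vpot_def using E_pos[OF assms(1)] by (intro continuous_intros) auto
qed

lemma sol_deriv:
  assumes E: "E \<in> K" and h: "h > 0" and x: "x \<in> {0..b}"
  shows "(sol h E has_real_derivative dsol h E x / h) (at x within {0..b})"
    and "(dsol h E has_real_derivative - (E - V x) * sol h E x / h) (at x within {0..b})"
proof -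
  define k where "k = sqrt E"
  have k: "k > 0" "k * k = E" using E_pos[OF E] by (auto simp: k_def)
  define s where "s = k * x / h"
  define G where "G = (\<lambda>s. cis s * amp h E s)"
  have sx: "s \<in> {0..k * b / h}" using x k h by (auto simp: s_def intro!: divide_right_mono mult_left_mono)
  have "(amp h E has_vector_derivative of_real (vpot h E s) * Lop s (amp h E s)) (at s within {0..k * b / h})"
    unfolding amp_def[abs_def] by (rule picard_sum_deriv[OF vpot_cont_full[OF E h, folded k_def] sx])
  moreover have "(cis has_vector_derivative \<i> * cis s) (at s within {0..k * b / h})"
  proof -
    have "((\<lambda>z. exp (\<i> * z)) has_field_derivative \<i> * exp (\<i> * of_real s)) (at (of_real s))"
      by (auto intro!: derivative_eq_intros)
    from has_vector_derivative_real_field[OF this, of "{0..k * b / h}"] show ?thesis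
      by (simp add: cis_conv_exp[abs_def])
  qed
  ultimately have "(G has_vector_derivative cis s * (of_real (vpot h E s) * Lop s (amp h E s)) + \<i> * cis s * amp h E s) (at s within {0..k * b / h})"
    unfolding G_def by (intro has_vector_derivative_mult)
  also have "cis s * (of_real (vpot h E s) * Lop s (amp h E s)) + \<i> * cis s * amp h E s
     = of_real (vpot h E s * Im (G s)) + \<i> * G s"
    using cis_mult_Lop[of s "amp h E s"] by (simp add: G_def mult_ac)
  finally have G: "(G has_vector_derivative of_real (vpot h E s * Im (G s)) + \<i> * G s) (at s within {0..k * b / h})" .
  have "((\<lambda>x. k * x / h) has_vector_derivative k / h) (at x within {0..b})"
    using h by (auto intro!: derivative_eq_intros simp: has_real_derivative_iff_has_vector_derivative[symmetric])
  moreover have "(G has_vector_derivative of_real (vpot h E s * Im (G s)) + \<i> * G s) (at (k * x / h) within (\<lambda>x. k * x / h) ` {0..b})"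
    unfolding s_def[symmetric]
    by (rule has_vector_derivative_within_subset[OF G]) (use k h in \<open>auto intro!: divide_right_mono mult_left_mono\<close>)
  ultimately have der: "((G \<circ> (\<lambda>x. k * x / h)) has_vector_derivative (k / h) *\<^sub>R (of_real (vpot h E s * Im (G s)) + \<i> * G s)) (at x within {0..b})"
    by (rule vector_diff_chain_within)
  have v: "vpot h E s = V x / E" using k h by (simp add: vpot_def s_def k_def[symmetric])
  have solG: "sol h E = (\<lambda>x. Im ((G \<circ> (\<lambda>x. k * x / h)) x))" by (simp add: sol_def G_def k_def fun_eq_iff)
  have dx: "dsol h E x / h = Im ((k / h) *\<^sub>R (of_real (vpot h E s * Im (G s)) + \<i> * G s))"
    by (simp add: dsol_def G_def s_def k_def)
  show "(sol h E has_real_derivative dsol h E x / h) (at x within {0..b})"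
    unfolding dx unfolding solG has_real_derivative_iff_has_vector_derivative
    by (rule bounded_linear.has_vector_derivative[OF bounded_linear_Im der])
  have 1: "dsol h E = (\<lambda>x. k * Re ((G \<circ> (\<lambda>x. k * x / h)) x))" by (simp add: dsol_def G_def k_def fun_eq_iff)
  have "k * Re ((k / h) *\<^sub>R (of_real (vpot h E s * Im (G s)) + \<i> * G s)) = (k * k) * (V x / E - 1) * Im (G s) / h"
    unfolding v by (simp add: algebra_simps diff_divide_distrib add_divide_distrib)
  also have "(k * k) * (V x / E - 1) = - (E - V x)"
    unfolding k(2) using E_pos[OF E] by (simp add: field_simps)
  finally have 2: "k * Re ((k / h) *\<^sub>R (of_real (vpot h E s * Im (G s)) + \<i> * G s)) = - (E - V x) * Im (G s) / h" .
  have 3: "sol h E x = Im (G s)" by (simp add: sol_def G_def s_def k_def)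
  have "((\<lambda>x. Re ((G \<circ> (\<lambda>x. k * x / h)) x)) has_real_derivative Re ((k / h) *\<^sub>R (of_real (vpot h E s * Im (G s)) + \<i> * G s))) (at x within {0..b})"
    using bounded_linear.has_vector_derivative[OF bounded_linear_Re der]
    by (simp add: has_real_derivative_iff_has_vector_derivative)
  from DERIV_cmult[OF this, of k] show "(dsol h E has_real_derivative - (E - V x) * sol h E x / h) (at x within {0..b})"
    unfolding 2 1 3 .
qed

lemma sol_0: "sol h E 0 = 0" "dsol h E 0 = sqrt E"
  if "E \<in> K" "h > 0"
proof -
  have "amp h E 0 = 1" unfolding amp_def by (rule picard_sum_0[OF vpot_cont_full[OF that]])
  then show "sol h E 0 = 0" "dsol h E 0 = sqrt E" by (simp_all add: sol_def dsol_def)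
qed

section \<open>Dirichlet eigenvalues as zeros of the solution at the right end point\<close>

lemma deriv_at_interior:
  "(f has_real_derivative d) (at x within {0..b}) \<Longrightarrow> 0 < x \<Longrightarrow> x < b \<Longrightarrow> (f has_real_derivative d) (at x)"
  by (simp add: at_within_Icc_at)

text \<open>A Gronwall argument run backwards from \<open>b\<close>: the weight
  \<open>exp ((1 + C) * x)\<close> makes \<open>y ^ 2 + y' ^ 2\<close> nondecreasing, so the product
  cannot be positive to the left of a point where it is 0.\<close>

lemma zero_cauchy_data:
  fixes y y' y'' q :: "real \<Rightarrow> real"
  assumes y: "\<And>x. x \<in> {0..b} \<Longrightarrow> (y has_real_derivative y' x) (at x within {0..b})"
    and y': "\<And>x. x \<in> {0..b} \<Longrightarrow> (y' has_real_derivative y'' x) (at x within {0..b})"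
    and ode: "\<And>x. x \<in> {0..b} \<Longrightarrow> y'' x = q x * y x"
    and q: "\<And>x. x \<in> {0..b} \<Longrightarrow> \<bar>q x\<bar> \<le> C"
    and zero: "y b = 0" "y' b = 0" and x: "x \<in> {0..b}"
  shows "y x = 0"
proof -
  define e where "e = (\<lambda>x. ((y x)\<^sup>2 + (y' x)\<^sup>2) * exp ((1 + C) * x))"
  have "e x \<le> e b"
  proof (rule DERIV_nonneg_imp_increasing_open[of x b e])
    show "x \<le> b" using x by simp
    have "continuous_on {0..b} y" "continuous_on {0..b} y'"
      using y y' by (meson DERIV_continuous continuous_on_eq_continuous_within)+
    then have "continuous_on {0..b} e" unfolding e_def by (intro continuous_intros)
    then show "continuous_on {x..b} e" by (rule continuous_on_subset) (use x in auto)
    fix t assume t: "x < t" "t < b"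
    then have t': "t \<in> {0..b}" "0 < t" using x by auto
    have yd: "(y has_real_derivative y' t) (at t)" "(y' has_real_derivative q t * y t) (at t)"
      using deriv_at_interior[OF y[OF t'(1)]] deriv_at_interior[OF y'[OF t'(1)]] ode[OF t'(1)] t t' by auto
    have "(e has_real_derivative (2 * y t * y' t + 2 * y' t * (q t * y t) + (1 + C) * ((y t)\<^sup>2 + (y' t)\<^sup>2)) * exp ((1 + C) * t)) (at t)"
      unfolding e_def by (auto intro!: derivative_eq_intros yd simp: algebra_simps)
    moreover have "0 \<le> 2 * y t * y' t + 2 * y' t * (q t * y t) + (1 + C) * ((y t)\<^sup>2 + (y' t)\<^sup>2)"
    proof -
      have ab: "\<bar>2 * (y t * y' t)\<bar> \<le> (y t)\<^sup>2 + (y' t)\<^sup>2"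
        using sum_squares_bound[of "\<bar>y t\<bar>" "\<bar>y' t\<bar>"] by (simp add: abs_mult)
      have "\<bar>(1 + q t) * (2 * (y t * y' t))\<bar> \<le> (1 + C) * ((y t)\<^sup>2 + (y' t)\<^sup>2)"
        unfolding abs_mult[of "1 + q t"] using q[OF t'(1)] ab by (intro mult_mono) auto
      moreover have "2 * y t * y' t + 2 * y' t * (q t * y t) = (1 + q t) * (2 * (y t * y' t))" by (simp add: algebra_simps)
      ultimately show ?thesis by (simp add: abs_le_iff)
    qed
    ultimately show "\<exists>d. (e has_real_derivative d) (at t) \<and> 0 \<le> d" by force
  qed
  also have "e b = 0" using zero by (simp add: e_def)
  finally have "((y x)\<^sup>2 + (y' x)\<^sup>2) \<le> 0" by (simp add: e_def mult_le_0_iff)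
  then show "y x = 0" by (simp add: sum_power2_le_zero_iff)
qed

text \<open>An eigenfunction \<open>y\<close> and \<open>sol\<close> both vanish at 0, so their
  constant Wronskian is 0. At \<open>b\<close> it reduces to a multiple of
  \<open>y' b * sol h E b\<close>, and \<open>y' b\<close> cannot vanish by uniqueness for the
  Cauchy problem at \<open>b\<close>. Conversely \<open>sol\<close> is not identically zero, because
  its derivative at 0 is \<open>sqrt E / h\<close>.\<close>

lemma dirichlet_iff_sol:
  assumes E: "E \<in> K" and h: "h > 0"
  shows "dirichlet_eigenvalue V b h E \<longleftrightarrow> sol h E b = 0"
proof
  assume z: "sol h E b = 0"
  show "dirichlet_eigenvalue V b h E"
    unfolding dirichlet_eigenvalue_def
  proof (rule exI[of _ "sol h E"], rule exI[of _ "\<lambda>x. dsol h E x / h"],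
      rule exI[of _ "\<lambda>x. - (E - V x) * sol h E x / h / h"], intro conjI ballI)
    fix x assume x: "x \<in> {0..b}"
    show "(sol h E has_real_derivative dsol h E x / h) (at x within {0..b})" by (rule sol_deriv[OF E h x])
    show "((\<lambda>x. dsol h E x / h) has_real_derivative - (E - V x) * sol h E x / h / h) (at x within {0..b})"
      by (rule DERIV_cdivide[OF sol_deriv(2)[OF E h x]])
    show "- h\<^sup>2 * (- (E - V x) * sol h E x / h / h) + V x * sol h E x = E * sol h E x"
      using h by (simp add: power2_eq_square field_simps)
  next
    show "\<exists>x\<in>{0..b}. sol h E x \<noteq> 0"
    proof (rule ccontr)
      assume "\<not> (\<exists>x\<in>{0..b}. sol h E x \<noteq> 0)"
      then have z: "\<And>x. x \<in> {0..b} \<Longrightarrow> 0 = sol h E x" by auto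
      have b0: "0 \<in> {0..b}" using b_pos by simp
      have "(sol h E has_real_derivative 0) (at 0 within {0..b})"
        by (rule has_field_derivative_transform_within[OF DERIV_const zero_less_one b0 z])
      moreover have "at 0 within {0..b} \<noteq> bot" using b_pos by (simp add: trivial_limit_within)
      ultimately have "dsol h E 0 / h = 0"
        using has_field_derivative_unique[OF sol_deriv(1)[OF E h b0]] by blast
      then show False using sol_0[OF E h] h E_pos[OF E] by simp
    qed
  qed (use z sol_0[OF E h] in auto)
next
  assume "dirichlet_eigenvalue V b h E"
  then obtain y y' y'' where y: "\<And>x. x \<in> {0..b} \<Longrightarrow> (y has_real_derivative y' x) (at x within {0..b})"
    "\<And>x. x \<in> {0..b} \<Longrightarrow> (y' has_real_derivative y'' x) (at x within {0..b})"
    and eq: "\<And>x. x \<in> {0..b} \<Longrightarrow> - h\<^sup>2 * y'' x + V x * y x = E * y x"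
    and y0: "y 0 = 0" "y b = 0" "\<exists>x\<in>{0..b}. y x \<noteq> 0" unfolding dirichlet_eigenvalue_def by blast
  have y'': "y'' x = - (E - V x) / h\<^sup>2 * y x" if "x \<in> {0..b}" for x
    using eq[OF that] h by (simp add: field_simps)
  define c where "c = (\<lambda>x. y x * dsol h E x - h * y' x * sol h E x)"
  have "(c has_real_derivative 0) (at x within {0..b})" if x: "x \<in> {0..b}" for x
  proof -
    have "(c has_real_derivative (y' x * dsol h E x + y x * (- (E - V x) * sol h E x / h))
        - (h * y'' x * sol h E x + h * y' x * (dsol h E x / h))) (at x within {0..b})"
      unfolding c_def using h by (auto intro!: derivative_eq_intros y sol_deriv[OF E h] x)
    also have "(y' x * dsol h E x + y x * (- (E - V x) * sol h E x / h))
        - (h * y'' x * sol h E x + h * y' x * (dsol h E x / h)) = 0"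
      unfolding y''[OF x] using h by (simp add: power2_eq_square field_simps)
    finally show ?thesis .
  qed
  then have "\<exists>d. \<forall>x\<in>{0..b}. c x = d"
    by (intro has_field_derivative_zero_constant) (auto intro: convex_closed_interval)
  then obtain d where d: "\<And>x. x \<in> {0..b} \<Longrightarrow> c x = d" by blast
  have "c 0 = 0" by (simp add: c_def y0 sol_0[OF E h])
  then have "c b = 0" using d[of 0] d[of b] b_pos by simp
  then have "y' b * sol h E b = 0" using y0 h by (simp add: c_def)
  moreover have "y' b \<noteq> 0"
  proof
    assume z: "y' b = 0"
    have "continuous_on {0..b} (\<lambda>x. - (E - V x) / h\<^sup>2)" using h by (intro continuous_intros V_cont) auto
    then have "bounded ((\<lambda>x. - (E - V x) / h\<^sup>2) ` {0..b})"
      by (intro compact_imp_bounded compact_continuous_image) auto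
    then obtain C where C: "\<And>x. x \<in> {0..b} \<Longrightarrow> \<bar>- (E - V x) / h\<^sup>2\<bar> \<le> C" unfolding bounded_iff real_norm_def by blast
    have "y x = 0" if "x \<in> {0..b}" for x
      by (rule zero_cauchy_data[OF y y'' C y0(2) z that])
    then show False using y0(3) by blast
  qed
  ultimately show "sol h E b = 0" by simp
qed

section \<open>Uniform bounds for the exact solution\<close>

lemma V_deriv_nonneg:
  assumes "0 < x" "x < b" "(V has_real_derivative d) (at x)"
  shows "d \<ge> 0"
  by (rule mono_on_imp_deriv_nonneg[OF V_mono assms(3)]) (use assms in simp)

text \<open>The energy is non-increasing because \<open>V\<close> is monotone.\<close>
lemma energy_bound:
  assumes E: "E \<in> K" and h: "h > 0" and x: "x \<in> {0..b}"
  shows "(dsol h E x)\<^sup>2 + (E - V x) * (sol h E x)\<^sup>2 \<le> E"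
proof -
  let ?e = "\<lambda>x. (dsol h E x)\<^sup>2 + (E - V x) * (sol h E x)\<^sup>2"
  have "?e x \<le> ?e 0"
  proof (rule DERIV_nonpos_imp_decreasing_open[of 0 x ?e])
    show "0 \<le> x" using x by simp
    have "continuous_on {0..b} (sol h E)" "continuous_on {0..b} (dsol h E)"
      using sol_deriv[OF E h] by (meson DERIV_continuous continuous_on_eq_continuous_within)+
    then have "continuous_on {0..b} ?e" by (intro continuous_intros V_cont)
    then show "continuous_on {0..x} ?e" by (rule continuous_on_subset) (use x in auto)
    fix t assume t: "0 < t" "t < x"
    then have t': "t \<in> {0..b}" "t \<in> {0<..b}" "t < b" using x by auto
    obtain d where d: "(V has_real_derivative d) (at t)"
    proof -
      have "at t within {0<..b} = at t" by (rule at_within_interior) (use t t' in simp)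
      then show ?thesis using V_deriv[OF t'(2)] that by simp
    qed
    have u: "(sol h E has_real_derivative dsol h E t / h) (at t)" "(dsol h E has_real_derivative - (E - V t) * sol h E t / h) (at t)"
      using sol_deriv[OF E h t'(1)] t t' by (auto intro: deriv_at_interior)
    have "(?e has_real_derivative - d * (sol h E t)\<^sup>2) (at t)"
      using h by (auto intro!: derivative_eq_intros u d simp: power2_eq_square field_simps)
    moreover have "- d * (sol h E t)\<^sup>2 \<le> 0" using V_deriv_nonneg[OF t(1) t'(3) d] by simp
    ultimately show "\<exists>y. (?e has_real_derivative y) (at t) \<and> y \<le> 0" by blast
  qed
  also have "?e 0 = E" using sol_0[OF E h] E_pos[OF E] by simp
  finally show ?thesis .
qed

text \<open>The gap turns the energy estimate into a bound that is uniform in \<open>h\<close> and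
  in the position. It is needed because the derivative of the Wronskian is the Riccati residual
  multiplied by \<open>sol\<close>.\<close>

lemma sol_bound:
  obtains B where "B > 0" "\<And>E h x. E \<in> K \<Longrightarrow> h > 0 \<Longrightarrow> x \<in> {0..b} \<Longrightarrow> \<bar>sol h E x\<bar> \<le> B"
proof -
  obtain M where M: "M > 0" "\<And>E. E \<in> K \<Longrightarrow> E \<le> M" by (rule E_le) blast
  have "\<bar>sol h E x\<bar> \<le> sqrt (M / \<delta>\<^sub>0)" if E: "E \<in> K" and h: "h > 0" and x: "x \<in> {0..b}" for E h x
  proof -
    have "\<delta>\<^sub>0 * (sol h E x)\<^sup>2 \<le> (E - V x) * (sol h E x)\<^sup>2" using gap[OF E x] by (intro mult_right_mono) auto
    also have "\<dots> \<le> M" using energy_bound[OF E h x] M(2)[OF E] zero_le_power2[of "dsol h E x"] by linarith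
    finally have "(sol h E x)\<^sup>2 \<le> M / \<delta>\<^sub>0" using delta_pos by (simp add: field_simps)
    then show ?thesis using real_sqrt_le_mono by fastforce
  qed
  then show ?thesis using that[of "sqrt (M / \<delta>\<^sub>0)"] M(1) delta_pos by simp
qed

text \<open>The first-order WKB term is a logarithmic derivative, so its contribution to the WKB
  solution is exactly the amplitude \<open>Ka\<close>. The sum in the phase can therefore start at
  2.\<close>

lemma Ka_deriv_wkb:
  assumes "E \<in> K" "x \<in> {0<..b}"
  shows "(ev Ka E has_real_derivative - wkb 1 E x * ev Ka E x) (at x within {0<..b})"
proof -
  have "ev (th \<gamma> Ka) E x / x = - wkb 1 E x * ev Ka E x"
    using assms by (simp add: wkb_def wk.simps One_nat_def mult_ac)
  with ev_deriv[OF assms, of Ka] show ?thesis by (simp only:)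
qed

text \<open>With \<open>q = - \<i> * h\<close>, the product \<open>p = Ka * exp wphase\<close>
  satisfies \<open>p' = - (\<i> / h) * wY q M * p\<close>. The Wronskian below equals
  \<open>h * (u' * p - u * p')\<close> for \<open>u = sol\<close>.\<close>

definition wphase :: "real \<Rightarrow> nat \<Rightarrow> real \<Rightarrow> real \<Rightarrow> complex" where
  "wphase h M E x = - \<i> * of_real (action E x / h)
      + \<i> / of_real h * (\<Sum>n=2..M. (- \<i> * of_real h) ^ n * of_real (wH n E x))"

text \<open>Up to normalization the Wronskian of the exact solution with the conjugate of an approximate
  complex WKB solution; were the latter exact, it would not depend on \<open>x\<close>.\<close>
definition wron :: "real \<Rightarrow> nat \<Rightarrow> real \<Rightarrow> real \<Rightarrow> complex" where
  "wron h M E x = (of_real (dsol h E x) + \<i> * wY (- \<i> * of_real h) M E x * of_real (sol h E x))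
      * (of_real (ev Ka E x) * exp (wphase h M E x))"

lemma wY_deriv:
  assumes "E \<in> K" "x \<in> {0<..b}"
  shows "((\<lambda>x. wY q M E x) has_vector_derivative dwY q M E x) (at x within {0<..b})"
  unfolding wY_def dwY_def
  by (intro has_vector_derivative_sum has_vector_derivative_mult_right has_vector_derivative_of_real wkb_deriv assms)

text \<open>The equation for the logarithmic derivative of the WKB solution holds exactly for the
  truncated sum. The terms with \<open>dsol\<close> then cancel, and the coefficient of
  \<open>sol\<close> is the Riccati residual.\<close>

lemma wron_deriv:
  assumes E: "E \<in> K" and h: "h > 0" and x: "x \<in> {0<..b}" and M: "M \<ge> 1"
  shows "(wron h M E has_vector_derivative
     ((wY (- \<i> * of_real h) M E x)\<^sup>2 - (- \<i> * of_real h) * dwY (- \<i> * of_real h) M E x - of_real (E - V x))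
      * (of_real (sol h E x / h) * (of_real (ev Ka E x) * exp (wphase h M E x)))) (at x within {0<..b})"
proof -
  define q where "q = - \<i> * complex_of_real h"
  define Y where "Y = wY q M E x"
  define Y' where "Y' = dwY q M E x"
  let ?F = "at x within {0<..b}"
  have hq: "\<i> / of_real h * q = 1" using h by (simp add: q_def field_simps)
  have x': "x \<in> {0..b}" using x by auto
  have sub: "{0<..b} \<subseteq> {0..b}" by auto
  have ph: "(wphase h M E has_vector_derivative - \<i> / of_real h * (Y - q * of_real (wkb 1 E x))) ?F"
  proof -
    have "((\<lambda>x. action E x / h) has_real_derivative mom E x / h) ?F"
      by (rule DERIV_cdivide[OF DERIV_subset[OF action_deriv[OF x'] sub]])
    then have 1: "((\<lambda>x. - \<i> * complex_of_real (action E x / h)) has_vector_derivative - \<i> * of_real (mom E x / h)) ?F"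
      by (intro has_vector_derivative_mult_right has_vector_derivative_of_real)
    have 2: "((\<lambda>x. \<i> / of_real h * (\<Sum>n=2..M. q ^ n * complex_of_real (wH n E x))) has_vector_derivative
        \<i> / of_real h * (\<Sum>n=2..M. q ^ n * of_real (- wkb n E x))) ?F"
      by (intro has_vector_derivative_mult_right has_vector_derivative_sum has_vector_derivative_of_real wH_deriv E x)
    have set: "{..M} = {0, 1} \<union> {2..M}" using M by auto
    have Y: "Y = of_real (mom E x) + q * of_real (wkb 1 E x) + (\<Sum>n=2..M. q ^ n * of_real (wkb n E x))"
      unfolding Y_def wY_def set by (subst sum.union_disjoint) (auto simp: wkb_0[OF E x])
    have "- \<i> * of_real (mom E x / h) + \<i> / of_real h * (\<Sum>n=2..M. q ^ n * of_real (- wkb n E x))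
       = - \<i> / of_real h * (Y - q * of_real (wkb 1 E x))"
      unfolding Y by (simp add: sum_negf distrib_left)
    with has_vector_derivative_add[OF 1 2] show ?thesis
      unfolding wphase_def[abs_def] q_def by simp
  qed
  have ex: "((\<lambda>x. exp (wphase h M E x)) has_vector_derivative
      - \<i> / of_real h * (Y - q * of_real (wkb 1 E x)) * exp (wphase h M E x)) ?F"
    using field_vector_diff_chain_within[OF ph, of exp "exp (wphase h M E x)"]
    by (simp add: comp_def DERIV_exp has_field_derivative_at_within)
  have ka: "((\<lambda>x. complex_of_real (ev Ka E x)) has_vector_derivative of_real (- wkb 1 E x * ev Ka E x)) ?F"
    by (rule has_vector_derivative_of_real[OF Ka_deriv_wkb[OF E x]])
  define p where "p = of_real (ev Ka E x) * exp (wphase h M E x)"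
  have "((\<lambda>x. of_real (ev Ka E x) * exp (wphase h M E x)) has_vector_derivative
     of_real (ev Ka E x) * (- \<i> / of_real h * (Y - q * of_real (wkb 1 E x)) * exp (wphase h M E x))
     + of_real (- wkb 1 E x * ev Ka E x) * exp (wphase h M E x)) ?F"
    by (rule has_vector_derivative_mult[OF ka ex])
  also have "of_real (ev Ka E x) * (- \<i> / of_real h * (Y - q * of_real (wkb 1 E x)) * exp (wphase h M E x))
     + of_real (- wkb 1 E x * ev Ka E x) * exp (wphase h M E x)
     = - \<i> / of_real h * Y * p + (\<i> / of_real h * q - 1) * of_real (wkb 1 E x) * p"
    unfolding p_def by (simp add: algebra_simps)
  \<comment> \<open>The summand \<open>wkb 1\<close> of \<open>Y\<close> is missing in the
    derivative of the phase and is restored by the derivative of \<open>Ka\<close>.\<close>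
  also have "\<dots> = - \<i> / of_real h * Y * p" unfolding hq by simp
  finally have pd: "((\<lambda>x. of_real (ev Ka E x) * exp (wphase h M E x)) has_vector_derivative - \<i> / of_real h * Y * p) ?F" .
  have sd: "((\<lambda>x. complex_of_real (sol h E x)) has_vector_derivative of_real (dsol h E x / h)) ?F"
    "((\<lambda>x. complex_of_real (dsol h E x)) has_vector_derivative of_real (- (E - V x) * sol h E x / h)) ?F"
    by (rule has_vector_derivative_of_real[OF DERIV_subset[OF sol_deriv(1)[OF E h x'] sub]],
        rule has_vector_derivative_of_real[OF DERIV_subset[OF sol_deriv(2)[OF E h x'] sub]])
  have yd: "((\<lambda>x. \<i> * wY q M E x) has_vector_derivative \<i> * Y') ?F"
    unfolding Y'_def by (intro has_vector_derivative_mult_right wY_deriv E x)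
  have "((\<lambda>x. (of_real (dsol h E x) + \<i> * wY q M E x * of_real (sol h E x)) * (of_real (ev Ka E x) * exp (wphase h M E x))) has_vector_derivative
     (of_real (dsol h E x) + \<i> * wY q M E x * of_real (sol h E x)) * (- \<i> / of_real h * Y * p)
     + (of_real (- (E - V x) * sol h E x / h) + (\<i> * wY q M E x * of_real (dsol h E x / h) + \<i> * Y' * of_real (sol h E x))) * p) ?F"
    unfolding p_def by (intro has_vector_derivative_mult[OF _ pd[unfolded p_def]] has_vector_derivative_add sd has_vector_derivative_mult yd)
  also have "(of_real (dsol h E x) + \<i> * wY q M E x * of_real (sol h E x)) * (- \<i> / of_real h * Y * p)
     + (of_real (- (E - V x) * sol h E x / h) + (\<i> * wY q M E x * of_real (dsol h E x / h) + \<i> * Y' * of_real (sol h E x))) * p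
     = (Y\<^sup>2 - q * Y' - of_real (E - V x)) * (of_real (sol h E x / h) * p)"
  proof -
    have "\<i> * Y' = - q * Y' / of_real h" using h by (simp add: q_def)
    then show ?thesis unfolding Y_def[symmetric] by (simp add: power2_eq_square algebra_simps add_divide_distrib diff_divide_distrib)
  qed
  finally show ?thesis unfolding wron_def[abs_def] p_def Y_def Y'_def q_def .
qed

text \<open>The main phase is purely imaginary, and the \<open>n\<close>-th correction is at most a
  constant times \<open>(h / x) ^ (n - 1)\<close>, which \<open>h \<le> x\<close> keeps
  bounded.\<close>

lemma wphase_bound:
  obtains C where "\<And>E h x. E \<in> K \<Longrightarrow> x \<in> {0<..b} \<Longrightarrow> 0 < h \<Longrightarrow> h \<le> x \<Longrightarrow> norm (exp (wphase h M E x)) \<le> C"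
proof -
  have "\<exists>B. \<forall>n. n \<ge> 2 \<longrightarrow> B n \<ge> 0 \<and> (\<forall>E\<in>K. \<forall>x\<in>{0<..b}. \<bar>wH n E x\<bar> \<le> B n / x ^ (n - 1))"
    by (rule choice, rule allI, subst ex_simps) (meson wH_bound)
  then obtain B where B: "\<And>n. n \<ge> 2 \<Longrightarrow> B n \<ge> 0" "\<And>n E x. n \<ge> 2 \<Longrightarrow> E \<in> K \<Longrightarrow> x \<in> {0<..b} \<Longrightarrow> \<bar>wH n E x\<bar> \<le> B n / x ^ (n - 1)"
    by blast
  have "norm (exp (wphase h M E x)) \<le> exp (\<Sum>n=2..M. B n)"
    if E: "E \<in> K" and x: "x \<in> {0<..b}" and h: "0 < h" "h \<le> x" for E h x
  proof -
    have "Re (wphase h M E x) = Re (\<i> / of_real h * (\<Sum>n=2..M. (- \<i> * of_real h) ^ n * of_real (wH n E x)))"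
      by (simp add: wphase_def)
    also have "\<dots> \<le> norm (\<i> / of_real h * (\<Sum>n=2..M. (- \<i> * of_real h) ^ n * of_real (wH n E x)))"
      by (rule complex_Re_le_cmod)
    also have "\<dots> = norm (\<Sum>n=2..M. \<i> / of_real h * ((- \<i> * of_real h) ^ n * of_real (wH n E x)))"
      by (simp add: sum_distrib_left)
    also have "\<dots> \<le> (\<Sum>n=2..M. B n)"
    proof (rule sum_norm_le)
      fix n assume "n \<in> {2..M}"
      then obtain m where n: "n = Suc m" "n \<ge> 2" by (cases n) auto
      have "norm (\<i> / of_real h * ((- \<i> * of_real h) ^ n * of_real (wH n E x))) = h ^ m * \<bar>wH n E x\<bar>"
        using h by (simp add: norm_mult norm_divide norm_power n(1))
      also have "\<dots> \<le> h ^ m * (B n / x ^ m)"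
        using B(2)[OF n(2) E x] h by (intro mult_left_mono) (auto simp: n(1))
      also have "\<dots> = B n * (h / x) ^ m" by (simp add: power_divide)
      also have "\<dots> \<le> B n * 1"
        using h x B(1)[OF n(2)] by (intro mult_left_mono power_le_one) auto
      finally show "norm (\<i> / of_real h * ((- \<i> * of_real h) ^ n * of_real (wH n E x))) \<le> B n" by simp
    qed
    finally show ?thesis by (simp add: norm_exp_eq_Re)
  qed
  then show ?thesis by (rule that)
qed

text \<open>The residual is replaced by its bound at the left end \<open>x\<close>, where it is
  worst, and multiplied by the length of the interval. This crude estimate and its factor
  \<open>1 / h\<close> do no harm, since \<open>M\<close> can be raised.\<close>

lemma wron_almost_conserved:
  assumes M: "M \<ge> 1"
  obtains C where "C \<ge> 0" "\<And>E h x. E \<in> K \<Longrightarrow> x \<in> {0<..b} \<Longrightarrow> 0 < h \<Longrightarrow> h \<le> x \<Longrightarrow>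
    norm (wron h M E b - wron h M E x) \<le> C / h * (h / x) ^ Suc M"
proof -
  obtain C1 where C1: "C1 \<ge> 0" "\<And>E x q. E \<in> K \<Longrightarrow> x \<in> {0<..b} \<Longrightarrow> norm q \<le> x \<Longrightarrow>
    norm ((wY q M E x)\<^sup>2 - q * dwY q M E x - of_real (E - V x)) \<le> C1 * (norm q / x) ^ Suc M"
    by (rule wkb_residual) blast
  obtain C2 where C2: "C2 > 0" "\<And>E h x. E \<in> K \<Longrightarrow> h > 0 \<Longrightarrow> x \<in> {0..b} \<Longrightarrow> \<bar>sol h E x\<bar> \<le> C2" by (rule sol_bound) blast
  obtain C3 where C3: "C3 \<ge> 0" "\<And>E x. E \<in> K \<Longrightarrow> x \<in> {0<..b} \<Longrightarrow> \<bar>ev Ka E x\<bar> \<le> C3" by (rule ev_bounded[of Ka]) blast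
  obtain C4 where C4: "\<And>E h x. E \<in> K \<Longrightarrow> x \<in> {0<..b} \<Longrightarrow> 0 < h \<Longrightarrow> h \<le> x \<Longrightarrow> norm (exp (wphase h M E x)) \<le> C4"
    by (rule wphase_bound) blast
  show ?thesis
  proof (rule that[of "C1 * (C2 * (C3 * \<bar>C4\<bar>)) * b"])
    show "0 \<le> C1 * (C2 * (C3 * \<bar>C4\<bar>)) * b" using C1 C2 C3 b_pos by simp
    fix E h x assume E: "E \<in> K" and x: "x \<in> {0<..b}" and h: "0 < h" "h \<le> x"
    define c where "c = C1 * (h / x) ^ Suc M * (C2 / h * (C3 * \<bar>C4\<bar>))"
    have c0: "c \<ge> 0" unfolding c_def using C1 C2 C3 h x by simp
    have "norm (wron h M E b - wron h M E x) \<le> c * b - c * x"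
    proof (rule norm_diff_le_of_deriv[where f = "wron h M E" and g = "\<lambda>t. c * t" and g' = "\<lambda>t. c"
          and f' = "\<lambda>x. ((wY (- \<i> * of_real h) M E x)\<^sup>2 - (- \<i> * of_real h) * dwY (- \<i> * of_real h) M E x - of_real (E - V x))
      * (of_real (sol h E x / h) * (of_real (ev Ka E x) * exp (wphase h M E x)))"])
      fix t assume t: "t \<in> {x..b}"
      then have t': "t \<in> {0<..b}" "h \<le> t" "x \<le> t" "0 < t" using x h by auto
      show "(wron h M E has_vector_derivative ((wY (- \<i> * of_real h) M E t)\<^sup>2 - (- \<i> * of_real h) * dwY (- \<i> * of_real h) M E t - of_real (E - V t))
      * (of_real (sol h E t / h) * (of_real (ev Ka E t) * exp (wphase h M E t)))) (at t within {x..b})"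
        by (rule has_vector_derivative_within_subset[OF wron_deriv[OF E h(1) t'(1) M]]) (use x in auto)
      have "norm ((wY (- \<i> * of_real h) M E t)\<^sup>2 - (- \<i> * of_real h) * dwY (- \<i> * of_real h) M E t - of_real (E - V t)) \<le> C1 * (h / t) ^ Suc M"
        using C1(2)[OF E t'(1), of "- \<i> * of_real h"] h t' by (simp add: norm_mult)
      also have "\<dots> \<le> C1 * (h / x) ^ Suc M"
        using C1(1) h x t' by (intro mult_left_mono power_mono divide_left_mono) auto
      finally have 1: "norm ((wY (- \<i> * of_real h) M E t)\<^sup>2 - (- \<i> * of_real h) * dwY (- \<i> * of_real h) M E t - of_real (E - V t)) \<le> C1 * (h / x) ^ Suc M" .
      have 2: "norm (complex_of_real (sol h E t / h)) \<le> C2 / h"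
        using C2(2)[OF E h(1), of t] t' h by (auto simp: norm_divide intro: divide_right_mono)
      have 3: "norm (complex_of_real (ev Ka E t)) \<le> C3" using C3(2)[OF E t'(1)] by (simp only: norm_of_real)
      have 4: "norm (exp (wphase h M E t)) \<le> \<bar>C4\<bar>" using C4[OF E t'(1) h(1) t'(2)] by linarith
      show "norm (((wY (- \<i> * of_real h) M E t)\<^sup>2 - (- \<i> * of_real h) * dwY (- \<i> * of_real h) M E t - of_real (E - V t))
      * (of_real (sol h E t / h) * (of_real (ev Ka E t) * exp (wphase h M E t)))) \<le> c"
        unfolding c_def norm_mult[of _ "_ * _"] norm_mult[of "complex_of_real (ev Ka E t)"]
        using C1 C2 C3 h x by (intro mult_mono 1 2 3 4) auto
    qed (use x in \<open>auto intro!: derivative_eq_intros\<close>)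
    also have "\<dots> \<le> c * b" using c0 x by simp
    also have "\<dots> = C1 * (C2 * (C3 * \<bar>C4\<bar>)) * b / h * (h / x) ^ Suc M" by (simp add: c_def mult_ac)
    finally show "norm (wron h M E b - wron h M E x) \<le> C1 * (C2 * (C3 * \<bar>C4\<bar>)) * b / h * (h / x) ^ Suc M" .
  qed
qed

end

text \<open>Division by the smallest power with a nonzero coefficient leaves that coefficient as the
  limit, while the bound of order \<open>N\<close>, above all exponents, forces the limit to be
  0.\<close>

lemma eq_zero_if_powr_sum_small:
  fixes e :: "'i \<Rightarrow> complex" and s :: "'i \<Rightarrow> real"
  assumes "finite I" "inj_on s I" "\<And>i. i \<in> I \<Longrightarrow> s i < N"
    and small: "\<forall>\<^sub>F h in at_right 0. norm (\<Sum>i\<in>I. e i * of_real (h powr s i)) \<le> C * h powr N"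
    and i: "i \<in> I"
  shows "e i = 0"
proof (rule ccontr)
  assume "e i \<noteq> 0"
  define J where "J = {i\<in>I. e i \<noteq> 0}"
  have J: "finite J" "J \<noteq> {}" using assms(1) i \<open>e i \<noteq> 0\<close> by (auto simp: J_def)
  then have "Min (s ` J) \<in> s ` J" by (intro Min_in) auto
  then obtain k where k: "k \<in> J" "s k = Min (s ` J)" by auto
  have gt: "s j > s k" if "j \<in> J - {k}" for j
  proof -
    have "s k \<le> s j" using k(2) J(1) that by simp
    moreover have "s j \<noteq> s k" using assms(2) that k(1) by (auto simp: J_def inj_on_def)
    ultimately show ?thesis by simp
  qed
  have pw: "((\<lambda>h::real. h powr r) \<longlongrightarrow> 0) (at_right 0)" if "r > 0" for r :: real
    by (rule tendsto_zero_powrI[OF _ tendsto_const _ that])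
      (auto simp: tendsto_ident_at intro: eventually_at_right_0I[of 1])
  have "((\<lambda>h. e k + (\<Sum>j\<in>J - {k}. e j * of_real (h powr (s j - s k)))) \<longlongrightarrow> e k + (\<Sum>j\<in>J - {k}. e j * of_real 0)) (at_right 0)"
    by (intro tendsto_intros pw) (use gt in auto)
  then have lim: "((\<lambda>h. e k + (\<Sum>j\<in>J - {k}. e j * of_real (h powr (s j - s k)))) \<longlongrightarrow> e k) (at_right 0)" by simp
  have "((\<lambda>h. e k + (\<Sum>j\<in>J - {k}. e j * of_real (h powr (s j - s k)))) \<longlongrightarrow> 0) (at_right 0)"
  proof (rule Lim_null_comparison)
    show "((\<lambda>h. C * h powr (N - s k)) \<longlongrightarrow> 0) (at_right 0)"
      using assms(3)[of k] k(1) by (intro tendsto_mult_right_zero pw) (auto simp: J_def)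
    show "\<forall>\<^sub>F h in at_right 0. norm (e k + (\<Sum>j\<in>J - {k}. e j * of_real (h powr (s j - s k)))) \<le> C * h powr (N - s k)"
      using small eventually_small[OF zero_less_one]
    proof eventually_elim
      case (elim h)
      have "(\<Sum>i\<in>I. e i * of_real (h powr s i)) = (\<Sum>i\<in>J. e i * of_real (h powr s i))"
        using assms(1) by (intro sum.mono_neutral_right) (auto simp: J_def)
      also have "\<dots> = e k * of_real (h powr s k) + (\<Sum>j\<in>J - {k}. e j * of_real (h powr s j))"
        using J k by (subst sum.remove[of J k]) auto
      also have "\<dots> = of_real (h powr s k) * (e k + (\<Sum>j\<in>J - {k}. e j * of_real (h powr (s j - s k))))"
        using elim by (simp add: powr_diff distrib_left sum_distrib_left mult_ac)
      finally have "h powr s k * norm (e k + (\<Sum>j\<in>J - {k}. e j * of_real (h powr (s j - s k)))) \<le> C * h powr N"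
        using elim by (simp add: norm_mult)
      then show ?case using elim by (simp add: powr_diff field_simps)
    qed
  qed
  with lim have "e k = 0" using tendsto_unique trivial_limit_at_right_real by blast
  then show False using k(1) by (simp add: J_def)
qed

text \<open>Borel summation: the \<open>n\<close>-th term is switched on only when \<open>h\<close> is so small that the tail
  is dominated by a geometric series.\<close>
lemma borel_sum:
  fixes c :: "nat \<Rightarrow> 'a \<Rightarrow> complex"
  assumes "\<And>n. bounded (c n ` S)"
  shows "\<exists>\<eta>. \<forall>N. bigo_on (\<lambda>h. S) (real N) (\<lambda>h E. \<eta> h E - (\<Sum>n<N. of_real (h ^ n) * c n E))"
proof -
  have "\<exists>B. \<forall>n. B n > 0 \<and> (\<forall>E\<in>S. norm (c n E) \<le> B n)"
    by (rule choice, rule allI) (use assms in \<open>auto simp: bounded_pos\<close>)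
  then obtain B where B: "\<And>n. B n > 0" "\<And>n E. E \<in> S \<Longrightarrow> norm (c n E) \<le> B n" by blast
  define t where "t = (\<lambda>h E n. if h * B n \<le> (1/2) ^ n then of_real (h ^ n) * c n E else 0)"
  define \<eta> where "\<eta> = (\<lambda>h E. \<Sum>n. t h E n)"
  \<comment> \<open>One factor \<open>h\<close> is spent on the bound \<open>B (Suc n)\<close>; this
    is what the threshold in \<open>t\<close> allows, and a geometric factor is left.\<close>
  have tb: "norm (t h E (Suc n)) \<le> h ^ n * (1/2) ^ Suc n" if "E \<in> S" "0 < h" for h E n
  proof (cases "h * B (Suc n) \<le> (1/2) ^ Suc n")
    case True
    have "norm (t h E (Suc n)) = h ^ n * (h * norm (c (Suc n) E))"
      using True that by (simp add: t_def norm_mult norm_power)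
    also have "\<dots> \<le> h ^ n * (h * B (Suc n))" using B(2)[OF that(1)] that by (intro mult_left_mono) auto
    also have "\<dots> \<le> h ^ n * (1/2) ^ Suc n" using True that by (intro mult_left_mono) auto
    finally show ?thesis .
  qed (use that in \<open>simp add: t_def\<close>)
  have "bigo_on (\<lambda>h. S) (real N) (\<lambda>h E. \<eta> h E - (\<Sum>n<N. of_real (h ^ n) * c n E))" for N
  proof -
    have ev: "\<forall>\<^sub>F h in at_right 0. \<forall>n\<in>{..N}. h * B n \<le> (1/2) ^ n"
    proof (intro eventually_ball_finite ballI)
      fix n
      show "\<forall>\<^sub>F h in at_right 0. h * B n \<le> (1/2) ^ n"
        by (rule eventually_at_right_0I[of "(1/2) ^ n / B n"]) (use B(1)[of n] in \<open>auto simp: field_simps\<close>)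
    qed auto
    show ?thesis
    proof (rule bigo_onI[of _ _ "B N + 1"], use ev eventually_small[OF zero_less_one] in eventually_elim)
      case (elim h)
      show ?case
      proof
        fix E assume E: "E \<in> S"
        have geo: "(\<lambda>n. (1/2::real) ^ Suc n) sums 1"
          using power_half_series by simp
        have le: "norm (t h E (n + Suc N)) \<le> h ^ N * (1/2) ^ Suc n" for n
        proof -
          have "norm (t h E (n + Suc N)) \<le> h ^ (n + N) * (1/2) ^ Suc (n + N)" using tb[OF E, of h "n + N"] elim by simp
          also have "\<dots> \<le> h ^ N * (1/2) ^ Suc n" using elim by (intro mult_mono power_decreasing) auto
          finally show ?thesis .
        qed
        have s1: "summable (\<lambda>n. h ^ N * (1/2) ^ Suc n)" by (intro summable_mult sums_summable[OF geo])
        have s2: "summable (\<lambda>n. t h E (n + Suc N))" by (rule summable_comparison_test'[OF s1, of 0]) (use le in auto)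
        then have s3: "summable (t h E)" by (simp only: summable_iff_shift)
        \<comment> \<open>The term of index \<open>N\<close> is split off and bounded by
          \<open>B N\<close> directly, because \<open>tb\<close> gives away one power of
          \<open>h\<close>.\<close>
        have "\<eta> h E - (\<Sum>n<N. of_real (h ^ n) * c n E) = t h E N + (\<Sum>n. t h E (n + Suc N))"
        proof -
          have "(\<Sum>n<N. of_real (h ^ n) * c n E) = (\<Sum>n<N. t h E n)"
            using elim by (intro sum.cong) (auto simp: t_def)
          then show ?thesis unfolding \<eta>_def using suminf_split_initial_segment[OF s3, of "Suc N"] by simp
        qed
        also have "norm \<dots> \<le> h ^ N * B N + h ^ N * 1"
        proof (intro norm_triangle_le add_mono)
          show "norm (t h E N) \<le> h ^ N * B N"
            using B(1)[of N] B(2)[OF E, of N] elim by (auto simp: t_def norm_mult norm_power intro: mult_left_mono)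
          have "norm (\<Sum>n. t h E (n + Suc N)) \<le> (\<Sum>n. h ^ N * (1/2) ^ Suc n)" by (rule norm_suminf_le[OF le s1])
          also have "\<dots> = h ^ N * 1" using sums_unique[OF sums_mult[OF geo, of "h ^ N"]] by simp
          finally show "norm (\<Sum>n. t h E (n + Suc N)) \<le> h ^ N * 1" .
        qed
        finally show "norm (\<eta> h E - (\<Sum>n<N. of_real (h ^ n) * c n E)) \<le> (B N + 1) * h powr real N"
          using elim by (simp add: powr_realpow algebra_simps)
      qed
    qed
  qed
  then show ?thesis by blast
qed

context bohr_sommerfeld
begin

section \<open>The Wronskian at the matching point\<close>

lemma cis_pi_nat: "cis (pi * real n) = (- 1) ^ n"
  by (induction n) (simp_all add: distrib_left flip: cis_mult)

lemma node_identities: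
  assumes "E \<in> K" "h > 0" "n \<ge> 1"
  shows "sqrt E * node h E n / h = pi * real n" "h / node h E n = sqrt E / (pi * real n)"
    "node h E n / h = pi * real n / sqrt E"
  using E_pos[OF assms(1)] assms by (auto simp: node_def field_simps)

lemma sol_node:
  assumes "E \<in> K" "h > 0" "n \<ge> 1"
  shows "sol h E (node h E n) = (- 1) ^ n * Im (amp h E (pi * real n))"
    "dsol h E (node h E n) = sqrt E * ((- 1) ^ n * Re (amp h E (pi * real n)))"
proof -
  define r :: real where "r = (- 1) ^ n"
  have "cis (pi * real n) = of_real r" by (simp add: cis_pi_nat r_def)
  then show "sol h E (node h E n) = (- 1) ^ n * Im (amp h E (pi * real n))"
    "dsol h E (node h E n) = sqrt E * ((- 1) ^ n * Re (amp h E (pi * real n)))"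
    unfolding sol_def dsol_def node_identities(1)[OF assms] r_def[symmetric] by simp_all
qed

definition "nampl h p = amp h (fst p) (pi * real (snd p))"

lemma approx_nampl: "approx mixB Pmix nampl"
  using approx_Pin_Pmix[OF approx_picard_sum] by (simp add: nampl_def[abs_def] amp_def)

lemma bigo_nampl: "bigo_on Pmix (\<gamma> / 2) (\<lambda>h p. nampl h p - 1)"
  using bigo_Pin_Pmix[OF picard_inner_small[of 1]] by (simp add: nampl_def[abs_def] amp_def)

lemma mixB_cnj: "f \<in> mixB \<Longrightarrow> (\<lambda>h p. cnj (f h p)) \<in> mixB"
proof -
  assume "f \<in> mixB"
  then obtain c m n \<alpha> where f: "f = (\<lambda>h p. c (fst p) * of_real (h powr (real m * \<gamma> + real n) * real (snd p) powr \<alpha>))"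
    and c: "bounded (c ` K)" unfolding mixB_def by blast
  have "bounded ((\<lambda>E. cnj (c E)) ` K)" using c by (simp add: bounded_iff)
  from mixB_I[OF this, of m n \<alpha>] show ?thesis unfolding f by simp
qed

lemma approx_Re:
  assumes "approx mixB Pmix F"
  shows "approx mixB Pmix (\<lambda>h p. of_real (Re (F h p)))" "approx mixB Pmix (\<lambda>h p. of_real (Im (F h p)))"
proof -
  have c: "approx mixB Pmix (\<lambda>h p. cnj (F h p))" by (rule approx_cnj[OF mixB_cnj assms])
  have "approx mixB Pmix (\<lambda>h p. (1/2) * (F h p + cnj (F h p)))"
    by (intro approx_cmult[OF gauge_mix] approx_add assms c)
  moreover have "(1/2) * (z + cnj z) = of_real (Re z)" for z by (simp add: complex_eq_iff)
  ultimately show "approx mixB Pmix (\<lambda>h p. of_real (Re (F h p)))" by simp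
  have "approx mixB Pmix (\<lambda>h p. (- \<i> / 2) * (F h p - cnj (F h p)))"
    by (intro approx_cmult[OF gauge_mix] approx_diff[OF gauge_mix] assms c)
  moreover have "(- \<i> / 2) * (z - cnj z) = of_real (Im z)" for z by (simp add: complex_eq_iff)
  ultimately show "approx mixB Pmix (\<lambda>h p. of_real (Im (F h p)))" by simp
qed

lemma approx_mix_base:
  assumes "bounded (c ` K)"
  shows "approx mixB Pmix (\<lambda>h p. c (fst p) * of_real (real (snd p) powr \<alpha>))"
proof (rule approx_cong[OF approx_base[OF mixB_I[OF assms, of 0 0 \<alpha>]]])
  show "\<forall>\<^sub>F h in at_right 0. \<forall>p\<in>Pmix h. c (fst p) * of_real (h powr (real 0 * \<gamma> + real 0) * real (snd p) powr \<alpha>) = c (fst p) * of_real (real (snd p) powr \<alpha>)"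
    using eventually_small[OF zero_less_one] by eventually_elim auto
qed

definition "ratio h p = complex_of_real (h / node h (fst p) (snd p))"

lemma bounded_E_powr_of_real: "bounded ((\<lambda>E. complex_of_real (E powr a)) ` K)"
  by (rule bounded_of_real[OF bounded_E_powr])

lemma ratio_eq: "\<forall>\<^sub>F h in at_right 0. \<forall>p\<in>Pmix h.
   of_real (1 / pi) * of_real (fst p powr (1/2)) * of_real (real (snd p) powr (-1)) = ratio h p"
  using node_small[OF zero_less_one]
proof eventually_elim
  case (elim h)
  show ?case
  proof
    fix p assume p: "p \<in> Pmix h"
    have E: "fst p \<in> K" "fst p > 0" using Pmix_K[OF p] E_pos by auto
    have "h / node h (fst p) (snd p) = 1 / pi * fst p powr (1/2) * real (snd p) powr (-1)"
      using node_identities(2)[OF E(1), of h "snd p"] elim p E by (simp add: powr_half_sqrt powr_minus_divide)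
    then show "of_real (1 / pi) * of_real (fst p powr (1/2)) * of_real (real (snd p) powr (-1)) = ratio h p"
      unfolding ratio_def by (simp only: of_real_mult)
  qed
qed

lemma approx_ratio: "approx mixB Pmix ratio"
  by (rule approx_cong[OF approx_mix_base ratio_eq])
    (intro bounded_times bounded_const bounded_E_powr_of_real)

lemma bigo_ratio: "bigo_on Pmix (\<kappa> / 4) ratio"
proof (rule bigo_on_cong[OF _ ratio_eq])
  have n: "bigo_on Pmix (\<kappa> / 4) (\<lambda>h p. of_real (real (snd p) powr (-1)))"
  proof (rule bigo_onI[of _ _ 1], use Pmix_large[of 1] eventually_small[OF zero_less_one] in eventually_elim)
    case (elim h)
    show ?case
    proof
      fix p assume p: "p \<in> Pmix h"
      have "0 < h powr (- \<kappa> / 4)" using elim by simp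
      then have "real (snd p) powr (-1) \<le> (h powr (- \<kappa> / 4)) powr (-1)"
        using p by (intro powr_mono2') (auto simp: Pmix_def)
      also have "\<dots> = h powr (\<kappa> / 4)" unfolding powr_powr by simp
      finally show "norm (complex_of_real (real (snd p) powr (-1))) \<le> 1 * h powr (\<kappa> / 4)"
        unfolding norm_of_real by simp
    qed
  qed
  have "bigo_on Pmix 0 (\<lambda>h p. (\<lambda>E. of_real (1 / pi) * complex_of_real (E powr (1/2))) (fst p))"
    by (intro bigo_on_coeff bounded_times bounded_const bounded_E_powr_of_real Pmix_K)
  from bigo_on_mult[OF this n]
  show "bigo_on Pmix (\<kappa> / 4) (\<lambda>h p. of_real (1 / pi) * of_real (fst p powr (1/2)) * of_real (real (snd p) powr (-1)))"
    by simp
qed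

lemma bigo_n: "bigo_on Pmix (- \<kappa> / 2) (\<lambda>h p. of_real (real (snd p)))"
  by (rule bigo_onI[of _ _ 1], rule always_eventually) (auto simp: Pmix_def)

lemma approx_n: "approx mixB Pmix (\<lambda>h p. of_real (real (snd p)))"
  using approx_mix_base[OF bounded_const, of 1 1] by simp

definition nY :: "nat \<Rightarrow> real \<Rightarrow> real \<times> nat \<Rightarrow> complex" where
  "nY M h p = (\<Sum>j\<le>M. (- \<i>) ^ j * (ratio h p ^ j * of_real (ev (wkb_exp \<gamma> j) (fst p) (node h (fst p) (snd p)))))"

lemma approx_nY: "approx mixB Pmix (nY M)"
  unfolding nY_def[abs_def]
  by (intro approx_sum approx_cmult[OF gauge_mix] approx_mult[OF gauge_mix] approx_power[OF gauge_mix] approx_ratio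
      approx_node[OF approx_ev] finite_atMost)

lemma bigo_nY: "bigo_on Pmix 0 (nY M)"
  unfolding nY_def[abs_def]
proof (intro bigo_on_sum bigo_on_cmult finite_atMost)
  fix j
  have "bigo_on Pmix (\<kappa> / 4 * real j + (1 - \<kappa> / 2) * 0) (\<lambda>h p. ratio h p ^ j * of_real (ev (wkb_exp \<gamma> j) (fst p) (node h (fst p) (snd p))))"
    by (intro bigo_on_mult bigo_on_power bigo_ratio bigo_node approx_powB_bigo approx_ev) auto
  then show "bigo_on Pmix 0 (\<lambda>h p. ratio h p ^ j * of_real (ev (wkb_exp \<gamma> j) (fst p) (node h (fst p) (snd p))))"
    by (rule bigo_on_mono) (use kappa in auto)
qed

text \<open>The phase \<open>wphase\<close> at the matching point without its main part
  \<open>- \<i> * pi * n\<close>, rearranged into products of \<open>n\<close>, of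
  \<open>h / x\<close> and of functions with known expansions in the position.\<close>

definition "nphase M h p = - \<i> * (of_real pi * of_real (real (snd p)) * of_real (fst p powr (-1/2))) *
     of_real ((action (fst p) (node h (fst p) (snd p)) - sqrt (fst p) * node h (fst p) (snd p)) / node h (fst p) (snd p))
   + (\<Sum>j=2..M. \<i> * (- \<i>) ^ j * (ratio h p ^ (j - 1) * of_real (node h (fst p) (snd p) ^ (j - 1) * wH j (fst p) (node h (fst p) (snd p)))))"

lemma approx_nphase: "approx mixB Pmix (nphase M)"
proof -
  have "approx mixB Pmix (\<lambda>h p. of_real (fst p powr (-1/2)))"
    by (rule approx_node[OF approx_E_powr])
  then show ?thesis
    unfolding nphase_def[abs_def]
    by (intro approx_add approx_mult[OF gauge_mix] approx_const[OF gauge_mix] approx_n approx_node[OF approx_action]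
        approx_sum approx_power[OF gauge_mix] approx_ratio approx_node[OF approx_wH]) auto
qed

text \<open>The right-hand sides are the orders of the phase deviation (the relative error of the
  action times \<open>n\<close>), of the inner amplitude and of the factor \<open>Ka\<close>. A
  common positive order is all that is wanted.\<close>

lemma kappa_le: "\<kappa> / 4 \<le> (1 - \<kappa> / 2) * \<gamma> - \<kappa> / 2" "\<kappa> / 4 \<le> \<gamma> / 2" "\<kappa> / 4 \<le> (1 - \<kappa> / 2) * \<gamma>"
proof -
  have 1: "\<kappa> * \<gamma> + \<kappa> = \<gamma> / 2" using kappa(3) by (simp add: algebra_simps)
  have 2: "0 < \<kappa> * \<gamma>" using kappa gamma_pos by simp
  have "(1 - \<kappa> / 2) * \<gamma> = \<gamma> - (\<kappa> * \<gamma>) / 2" by (simp add: algebra_simps)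
  then show "\<kappa> / 4 \<le> (1 - \<kappa> / 2) * \<gamma> - \<kappa> / 2" "\<kappa> / 4 \<le> \<gamma> / 2" "\<kappa> / 4 \<le> (1 - \<kappa> / 2) * \<gamma>"
    using 1 2 kappa(1) by linarith+
qed

lemma bigo_nphase: "bigo_on Pmix (\<kappa> / 4) (nphase M)"
  unfolding nphase_def[abs_def]
proof (intro bigo_on_add bigo_on_sum finite_atLeastAtMost)
  have "bigo_on Pmix 0 (\<lambda>h p. (\<lambda>E. complex_of_real (E powr (-1/2))) (fst p))"
    by (rule bigo_on_coeff[OF bounded_E_powr_of_real Pmix_K])
  then have "bigo_on Pmix (0 + (0 + - \<kappa> / 2 + 0) + (1 - \<kappa> / 2) * \<gamma>) (\<lambda>h p. - \<i> * (of_real pi * of_real (real (snd p)) * of_real (fst p powr (-1/2))) *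
     of_real ((action (fst p) (node h (fst p) (snd p)) - sqrt (fst p) * node h (fst p) (snd p)) / node h (fst p) (snd p)))"
    by (intro bigo_on_mult bigo_on_const bigo_n bigo_node[OF bigo_action]) (use gamma_pos in auto)
  then show "bigo_on Pmix (\<kappa> / 4) (\<lambda>h p. - \<i> * (of_real pi * of_real (real (snd p)) * of_real (fst p powr (-1/2))) *
     of_real ((action (fst p) (node h (fst p) (snd p)) - sqrt (fst p) * node h (fst p) (snd p)) / node h (fst p) (snd p)))"
    by (rule bigo_on_mono) (use kappa_le in simp)
  fix j assume "j \<in> {2..M}"
  then have j: "j \<ge> 2" by simp
  have "bigo_on Pmix (0 + (\<kappa> / 4 * real (j - 1) + (1 - \<kappa> / 2) * 0)) (\<lambda>h p. \<i> * (- \<i>) ^ j * (ratio h p ^ (j - 1) * of_real (node h (fst p) (snd p) ^ (j - 1) * wH j (fst p) (node h (fst p) (snd p)))))"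
    by (intro bigo_on_mult bigo_on_const bigo_on_power bigo_ratio bigo_node approx_powB_bigo approx_wH[OF j]) auto
  then show "bigo_on Pmix (\<kappa> / 4) (\<lambda>h p. \<i> * (- \<i>) ^ j * (ratio h p ^ (j - 1) * of_real (node h (fst p) (snd p) ^ (j - 1) * wH j (fst p) (node h (fst p) (snd p)))))"
  proof (rule bigo_on_mono)
    have "\<kappa> / 4 * 1 \<le> \<kappa> / 4 * real (j - 1)" using j kappa by (intro mult_left_mono) auto
    then show "\<kappa> / 4 \<le> 0 + (\<kappa> / 4 * real (j - 1) + (1 - \<kappa> / 2) * 0)" by simp
  qed
qed

text \<open>Normalized to tend to 1: at the matching point \<open>dsol\<close> is close to
  \<open>sqrt E\<close> up to sign and \<open>Ka\<close> is close to \<open>E powr (-1/4)\<close>,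
  so the Wronskian has size \<open>E powr (1/4)\<close>.\<close>

definition "nwron M h p =
   (of_real (Re (nampl h p)) + \<i> * (nY M h p * of_real (fst p powr (-1/2))) * of_real (Im (nampl h p)))
   * (of_real (fst p powr (1/4)) * of_real (ev Ka (fst p) (node h (fst p) (snd p)))) * exp (nphase M h p)"

lemma approx_nwron: "approx mixB Pmix (nwron M)"
proof -
  have E: "approx mixB Pmix (\<lambda>h p. of_real (fst p powr a))" for a
    by (rule approx_node[OF approx_E_powr])
  have "approx mixB Pmix (\<lambda>h p. exp (nphase M h p))"
    by (rule approx_compose[OF gauge_mix approx_nphase bigo_nphase, where r = 1]) (use kappa in \<open>auto intro: holomorphic_intros\<close>)
  then show ?thesis
    unfolding nwron_def[abs_def]
    by (intro approx_mult[OF gauge_mix] approx_add approx_const[OF gauge_mix] approx_Re approx_nampl approx_nY E approx_node[OF approx_ev])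
qed

lemma bigo_nwron: "bigo_on Pmix (\<kappa> / 4) (\<lambda>h p. nwron M h p - 1)"
  unfolding nwron_def[abs_def]
proof (rule bigo_on_mult_one, rule bigo_on_mult_one)
  have A: "bigo_on Pmix (\<kappa> / 4) (\<lambda>h p. nampl h p - 1)" by (rule bigo_on_mono[OF bigo_nampl kappa_le(2)])
  have Re: "bigo_on Pmix (\<kappa> / 4) (\<lambda>h p. of_real (Re (nampl h p)) - 1)"
    by (rule bigo_on_le[OF A], rule always_eventually) (metis abs_Re_le_cmod minus_complex.sel(1) norm_of_real of_real_1 of_real_diff one_complex.sel(1))
  have Im: "bigo_on Pmix (\<kappa> / 4) (\<lambda>h p. of_real (Im (nampl h p)))"
    by (rule bigo_on_le[OF A], rule always_eventually) (metis abs_Im_le_cmod diff_zero minus_complex.sel(2) norm_of_real one_complex.sel(2))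
  have E: "bigo_on Pmix 0 (\<lambda>h p. (\<lambda>E. complex_of_real (E powr (-1/2))) (fst p))"
    by (rule bigo_on_coeff[OF bounded_E_powr_of_real Pmix_K])
  have "bigo_on Pmix (0 + (0 + 0) + \<kappa> / 4) (\<lambda>h p. \<i> * (nY M h p * of_real (fst p powr (-1/2))) * of_real (Im (nampl h p)))"
    by (intro bigo_on_mult bigo_on_const bigo_nY Im E)
  then have "bigo_on Pmix (\<kappa> / 4) (\<lambda>h p. (of_real (Re (nampl h p)) - 1) + \<i> * (nY M h p * of_real (fst p powr (-1/2))) * of_real (Im (nampl h p)))"
    by (intro bigo_on_add Re) simp
  then show "bigo_on Pmix (\<kappa> / 4) (\<lambda>h p. of_real (Re (nampl h p)) + \<i> * (nY M h p * of_real (fst p powr (-1/2))) * of_real (Im (nampl h p)) - 1)"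
    by (simp add: algebra_simps)
  have "bigo_on Pmix ((1 - \<kappa> / 2) * \<gamma>) (\<lambda>h p. of_real (fst p powr (1/4)) * of_real ((fst p - V (node h (fst p) (snd p))) powr (-1/4)) - 1)"
    by (rule bigo_node[OF bigo_Ka]) (use gamma_pos in auto)
  then show "bigo_on Pmix (\<kappa> / 4) (\<lambda>h p. of_real (fst p powr (1/4)) * of_real (ev Ka (fst p) (node h (fst p) (snd p))) - 1)"
    by (intro bigo_on_mono[OF _ kappa_le(3)]) simp
  show "bigo_on Pmix (\<kappa> / 4) (\<lambda>h p. exp (nphase M h p) - 1)"
    using bigo_on_compose[OF bigo_nphase, of exp 1 M] kappa by (auto intro: holomorphic_intros)
qed (use kappa in auto)

text \<open>The sign \<open>(- 1) ^ n\<close> of the solution at the matching point cancels against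
  the factor \<open>exp (- \<i> * pi * n)\<close> of the WKB solution, so the parity of
  \<open>n\<close> leaves no trace.\<close>

lemma nwron_eq:
  "\<forall>\<^sub>F h in at_right 0. \<forall>p\<in>Pmix h. nwron M h p = of_real (fst p powr (-1/4)) * wron h M (fst p) (node h (fst p) (snd p))"
  using node_small[OF b_pos]
proof eventually_elim
  case (elim h)
  show ?case
  proof
    fix p assume p: "p \<in> Pmix h"
    obtain E n where pe: "p = (E, n)" by fastforce
    define x where "x = node h E n"
    have E: "E \<in> K" "E > 0" using Pmix_K[OF p] E_pos by (auto simp: pe)
    have h: "h > 0" and n: "n \<ge> 1" and x: "x \<in> {0<..b}" using elim p by (auto simp: pe x_def)
    define k where "k = sqrt E"
    have k: "k > 0" "E powr (1/2) = k" "E powr (-1/2) = 1 / k" using E by (auto simp: k_def powr_half_sqrt powr_minus_divide)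
    have ids: "h / x = k / (pi * real n)" "x / h = pi * real n / k" using node_identities[OF E(1) h n] by (auto simp: x_def k_def)
    define s where "s = ((- 1) ^ n :: complex)"
    have ss: "s * s = 1" by (simp add: s_def flip: power_add)
    have Y: "wY (- \<i> * of_real h) M E x = nY M h p"
      unfolding wY_def nY_def
    proof (rule sum.cong[OF refl])
      fix j
      have "(- \<i> * complex_of_real h) ^ j * of_real (wkb j E x) = (- \<i>) ^ j * of_real (h ^ j * (ev (wkb_exp \<gamma> j) E x / x ^ j))"
        by (simp only: power_mult_distrib wkb_def of_real_mult of_real_power mult.assoc)
      also have "h ^ j * (ev (wkb_exp \<gamma> j) E x / x ^ j) = (h / x) ^ j * ev (wkb_exp \<gamma> j) E x"
        by (simp add: power_divide)
      finally show "(- \<i> * complex_of_real h) ^ j * of_real (wkb j E x) = (- \<i>) ^ j * (ratio h p ^ j * of_real (ev (wkb_exp \<gamma> j) (fst p) (node h (fst p) (snd p))))"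
        by (simp add: ratio_def pe x_def)
    qed
    have ph: "wphase h M E x = - \<i> * of_real (pi * real n) + nphase M h p"
    proof -
      have a: "action E x / h = pi * real n + pi * real n / k * ((action E x - k * x) / x)"
      proof -
        have "pi * real n / k * ((action E x - k * x) / x) = x / h * ((action E x - k * x) / x)" by (simp only: ids(2))
        also have "\<dots> = action E x / h - k * (x / h)" using x h by (simp add: field_simps)
        also have "k * (x / h) = pi * real n" unfolding ids(2) using k by simp
        finally show ?thesis by simp
      qed
      have b: "\<i> / of_real h * ((- \<i> * of_real h) ^ j * of_real (wH j E x)) = \<i> * (- \<i>) ^ j * (ratio h p ^ (j - 1) * of_real (x ^ (j - 1) * wH j E x))"
        if jm: "j \<in> {2..M}" for j
      proof -
        obtain i where i: "j = Suc i" using jm by (cases j) auto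
        have "ratio h p ^ i * of_real (x ^ i) = of_real ((h / x) ^ i * x ^ i)" by (simp add: ratio_def pe x_def)
        also have "(h / x) ^ i * x ^ i = h ^ i" using x by (simp add: power_divide)
        finally have r: "ratio h p ^ i * of_real (x ^ i) = of_real (h ^ i)" .
        have "\<i> / of_real h * ((- \<i> * of_real h) ^ j * of_real (wH j E x)) = \<i> * (- \<i>) ^ j * (of_real (h ^ i) * of_real (wH j E x))"
          unfolding power_mult_distrib using h by (simp add: i)
        also have "\<dots> = \<i> * (- \<i>) ^ j * (ratio h p ^ (j - 1) * of_real (x ^ (j - 1) * wH j E x))"
          unfolding r[symmetric] by (simp add: i)
        finally show ?thesis .
      qed
      have "\<i> / of_real h * (\<Sum>n=2..M. (- \<i> * of_real h) ^ n * of_real (wH n E x)) = (\<Sum>j=2..M. \<i> * (- \<i>) ^ j * (ratio h p ^ (j - 1) * of_real (x ^ (j - 1) * wH j E x)))"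
        unfolding sum_distrib_left by (rule sum.cong[OF refl b])
      moreover have "complex_of_real (action E x / h) = of_real (pi * real n) + of_real pi * of_real (real n) * of_real (E powr (-1/2)) * of_real ((action E x - k * x) / x)"
        unfolding a k(3) by simp
      ultimately show ?thesis unfolding wphase_def nphase_def pe fst_conv snd_conv x_def[symmetric] k_def[symmetric]
        by (simp only: distrib_left mult.assoc add.assoc)
    qed
    have "exp (- \<i> * of_real r) = cnj (cis r)" for r by (simp add: cis_cnj) (simp add: cis_conv_exp)
    then have "exp (- \<i> * of_real (pi * real n)) = cnj (cis (pi * real n))" .
    also have "\<dots> = s" by (simp add: cis_pi_nat s_def)
    finally have ex: "exp (wphase h M E x) = s * exp (nphase M h p)" unfolding ph exp_add by simp
    have so: "complex_of_real (sol h E x) = s * of_real (Im (nampl h p))" "complex_of_real (dsol h E x) = of_real k * (s * of_real (Re (nampl h p)))"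
      unfolding x_def sol_node[OF E(1) h n] by (simp_all add: nampl_def pe s_def k_def)
    have "E powr (1/4) = E powr (-1/4) * k" unfolding k(2)[symmetric] by (subst powr_add[symmetric]) simp
    then have e4: "complex_of_real (E powr (1/4)) = of_real (E powr (-1/4)) * of_real k" by (metis of_real_mult)
    have ek: "complex_of_real (E powr (-1/2)) * of_real k = 1" unfolding k(3) using k(1) by simp
    have "of_real (E powr (-1/4)) * wron h M E x =
      of_real (E powr (-1/4)) * ((of_real k * (s * of_real (Re (nampl h p))) + \<i> * nY M h p * (s * of_real (Im (nampl h p)))) * (of_real (ev Ka E x) * (s * exp (nphase M h p))))"
      unfolding wron_def Y ex so ..
    also have "\<dots> = (s * s) * ((of_real k * of_real (Re (nampl h p)) + \<i> * nY M h p * of_real (Im (nampl h p))) * (of_real (E powr (-1/4)) * of_real (ev Ka E x)) * exp (nphase M h p))"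
      by (simp add: algebra_simps)
    also have "\<dots> = (of_real k * of_real (Re (nampl h p)) + \<i> * nY M h p * (complex_of_real (E powr (-1/2)) * of_real k) * of_real (Im (nampl h p))) * (of_real (E powr (-1/4)) * of_real (ev Ka E x)) * exp (nphase M h p)"
      unfolding ss ek by simp
    also have "\<dots> = nwron M h p"
      unfolding nwron_def pe fst_conv snd_conv x_def[symmetric] e4 by (simp add: algebra_simps)
    finally show "nwron M h p = of_real (fst p powr (-1/4)) * wron h M (fst p) (node h (fst p) (snd p))"
      by (simp add: pe x_def)
  qed
qed

section \<open>The quantization condition\<close>

definition "boundary_coeff j E = (- \<i>) ^ j * complex_of_real (wkb j E b)"

lemma bounded_boundary_coeff: "bounded (boundary_coeff j ` K)"
proof -
  obtain B where B: "B \<ge> 0" "\<And>E x. E \<in> K \<Longrightarrow> x \<in> {0<..b} \<Longrightarrow> \<bar>wkb j E x\<bar> \<le> B / x ^ j"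
    by (rule wkb_bound[of j]) blast
  have "norm (boundary_coeff j E) \<le> B / b ^ j" if "E \<in> K" for E
    using B(2)[OF that, of b] b_pos by (simp add: boundary_coeff_def norm_mult norm_power)
  then show ?thesis unfolding bounded_iff by blast
qed

text \<open>The truncated Riccati solutions of all orders are merged at the right end point only, where
  their coefficients are Borel summed: this makes the quantity below independent of the order.\<close>
definition eta :: "real \<Rightarrow> real \<Rightarrow> complex" where
  "eta = (SOME \<eta>. \<forall>N. bigo_on PK (real N) (\<lambda>h E. \<eta> h E - (\<Sum>n<N. of_real (h ^ n) * boundary_coeff n E)))"

lemma eta: "bigo_on PK (real N) (\<lambda>h E. eta h E - (\<Sum>n<N. of_real (h ^ n) * boundary_coeff n E))"
  using someI_ex[OF borel_sum[of boundary_coeff K, OF bounded_boundary_coeff]] unfolding eta_def by blast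

text \<open>The counterpart of a Jost function in scattering theory, whose argument is the phase
  shift.\<close>

definition "jost h E = of_real (E powr (-1/4)) * ((of_real (dsol h E b) + \<i> * eta h E * of_real (sol h E b))
    * (of_real (ev Ka E b) * exp (- \<i> * of_real (action E b / h))))"

text \<open>At \<open>b\<close> the corrections \<open>wH\<close> vanish and the remaining
  exponential has modulus 1, so the two quantities differ only through \<open>eta\<close> in place
  of the truncated sum.\<close>

lemma jost_wron: "bigo_on PK (real (Suc M)) (\<lambda>h E. jost h E - of_real (E powr (-1/4)) * wron h M E b)"
proof -
  have bb: "b \<in> {0<..b}" "b \<in> {0..b}" using b_pos by auto
  obtain C where C: "C \<ge> 0" "\<forall>\<^sub>F h in at_right 0. \<forall>E\<in>K. norm (eta h E - (\<Sum>n<Suc M. of_real (h ^ n) * boundary_coeff n E)) \<le> C * h powr real (Suc M)"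
    using eta by (rule bigo_onE)
  obtain C1 where C1: "\<And>E. E \<in> K \<Longrightarrow> norm (E powr (-1/4)) \<le> C1" using bounded_E_powr[of "-1/4"] unfolding bounded_iff by blast
  obtain C2 where C2: "C2 > 0" "\<And>E h x. E \<in> K \<Longrightarrow> h > 0 \<Longrightarrow> x \<in> {0..b} \<Longrightarrow> \<bar>sol h E x\<bar> \<le> C2" by (rule sol_bound) blast
  obtain C3 where C3: "C3 \<ge> 0" "\<And>E x. E \<in> K \<Longrightarrow> x \<in> {0<..b} \<Longrightarrow> \<bar>ev Ka E x\<bar> \<le> C3" by (rule ev_bounded[of Ka]) blast
  show ?thesis
  proof (rule bigo_onI[of _ _ "\<bar>C1\<bar> * (C * C2 * C3)"], use C(2) eventually_small[OF zero_less_one] in eventually_elim)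
    case (elim h)
    show ?case
    proof
      fix E assume E: "E \<in> K"
      have h: "h > 0" using elim by simp
      have Y: "wY (- \<i> * of_real h) M E b = (\<Sum>n<Suc M. of_real (h ^ n) * boundary_coeff n E)"
        unfolding wY_def lessThan_Suc_atMost boundary_coeff_def
        by (intro sum.cong refl) (simp only: power_mult_distrib of_real_power mult_ac)
      have "wphase h M E b = - \<i> * of_real (action E b / h)" by (simp add: wphase_def wH_def)
      then have eq: "jost h E - of_real (E powr (-1/4)) * wron h M E b =
        of_real (E powr (-1/4)) * ((eta h E - wY (- \<i> * of_real h) M E b) * of_real (sol h E b) * of_real (ev Ka E b)
          * (\<i> * exp (- \<i> * of_real (action E b / h))))"
        unfolding jost_def wron_def by (simp add: algebra_simps)
      have "norm (jost h E - of_real (E powr (-1/4)) * wron h M E b) = \<bar>E powr (-1/4)\<bar> * (norm (eta h E - wY (- \<i> * of_real h) M E b) * \<bar>sol h E b\<bar> * \<bar>ev Ka E b\<bar>)"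
        unfolding eq norm_mult norm_of_real norm_exp_eq_Re by simp
      also have "\<dots> \<le> \<bar>C1\<bar> * (C * h powr real (Suc M) * C2 * C3)"
      proof -
        have 1: "\<bar>E powr (-1/4)\<bar> \<le> \<bar>C1\<bar>" using C1[OF E] by simp
        have 2: "norm (eta h E - wY (- \<i> * of_real h) M E b) \<le> C * h powr real (Suc M)"
          unfolding Y using elim(1) E by blast
        show ?thesis
          by (rule mult_mono[OF 1 mult_mono[OF mult_mono[OF 2 C2(2)[OF E h bb(2)]] C3(2)[OF E bb(1)]]])
            (use C(1) C2(1) C3(1) in \<open>simp_all del: of_nat_Suc\<close>)
      qed
      finally show "norm (jost h E - of_real (E powr (-1/4)) * wron h M E b) \<le> \<bar>C1\<bar> * (C * C2 * C3) * h powr real (Suc M)"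
        by (simp only: mult_ac)
    qed
  qed
qed

lemma jost_nwron:
  assumes M: "M \<ge> 1" and N: "N \<le> real (Suc M)" "N \<le> \<kappa> / 4 * real (Suc M) - 1"
  shows "bigo_on Pmix N (\<lambda>h p. jost h (fst p) - nwron M h p)"
proof -
  obtain C where C: "C \<ge> 0" "\<And>E h x. E \<in> K \<Longrightarrow> x \<in> {0<..b} \<Longrightarrow> 0 < h \<Longrightarrow> h \<le> x \<Longrightarrow>
    norm (wron h M E b - wron h M E x) \<le> C / h * (h / x) ^ Suc M" by (rule wron_almost_conserved[OF M]) blast
  obtain C1 where C1: "\<And>E. E \<in> K \<Longrightarrow> norm (E powr (-1/4)) \<le> C1" using bounded_E_powr[of "-1/4"] unfolding bounded_iff by blast
  have 1: "bigo_on Pmix N (\<lambda>h p. jost h (fst p) - of_real (fst p powr (-1/4)) * wron h M (fst p) b)"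
  proof -
    obtain C where C: "\<forall>\<^sub>F h in at_right 0. \<forall>E\<in>K. norm (jost h E - of_real (E powr (-1/4)) * wron h M E b) \<le> C * h powr real (Suc M)"
      using jost_wron[of M] by (auto simp: bigo_on_def)
    have "bigo_on Pmix (real (Suc M)) (\<lambda>h p. jost h (fst p) - of_real (fst p powr (-1/4)) * wron h M (fst p) b)"
      by (rule bigo_onI[of _ _ C], use C in eventually_elim) (use Pmix_K in blast)
    then show ?thesis by (rule bigo_on_mono[OF _ N(1)])
  qed
  \<comment> \<open>The order -1 accounts for the factor \<open>1 / h\<close> in
    \<open>wron_almost_conserved\<close>; each factor \<open>ratio\<close> gains
    \<open>\<kappa> / 4\<close>.\<close>
  have r: "bigo_on Pmix N (\<lambda>h p. of_real (h powr (-1)) * ratio h p ^ Suc M)"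
  proof (rule bigo_on_mono)
    show "bigo_on Pmix (- 1 + \<kappa> / 4 * real (Suc M)) (\<lambda>h p. of_real (h powr (-1)) * ratio h p ^ Suc M)"
      by (intro bigo_on_mult bigo_on_h_powr bigo_on_power bigo_ratio)
  qed (use N in simp)
  have small: "\<forall>\<^sub>F h in at_right 0. \<forall>p\<in>Pmix h. norm (ratio h p) \<le> 1"
    by (rule bigo_on_small[OF bigo_ratio]) (use kappa in auto)
  have 2: "bigo_on Pmix N (\<lambda>h p. of_real (fst p powr (-1/4)) * wron h M (fst p) b - of_real (fst p powr (-1/4)) * wron h M (fst p) (node h (fst p) (snd p)))"
  proof (rule bigo_on_le[OF bigo_on_cmult[OF r, of "of_real (\<bar>C1\<bar> * C)"]])
    show "\<forall>\<^sub>F h in at_right 0. \<forall>p\<in>Pmix h.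
      norm (of_real (fst p powr (-1/4)) * wron h M (fst p) b - of_real (fst p powr (-1/4)) * wron h M (fst p) (node h (fst p) (snd p)))
       \<le> norm (of_real (\<bar>C1\<bar> * C) * (of_real (h powr (-1)) * ratio h p ^ Suc M))"
      using node_small[OF b_pos] small
    proof eventually_elim
      case (elim h)
      show ?case
      proof
        fix p assume p: "p \<in> Pmix h"
        let ?x = "node h (fst p) (snd p)"
        have E: "fst p \<in> K" using Pmix_K[OF p] .
        have x: "?x \<in> {0<..b}" and h: "h > 0" using elim p by auto
        have "norm (ratio h p) \<le> 1" using elim p by blast
        then have hx: "h / ?x \<le> 1" unfolding ratio_def norm_of_real by linarith
        then have "h \<le> ?x" using x by (simp add: divide_le_eq)
        have "norm (of_real (fst p powr (-1/4)) * wron h M (fst p) b - of_real (fst p powr (-1/4)) * wron h M (fst p) ?x)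
            = \<bar>fst p powr (-1/4)\<bar> * norm (wron h M (fst p) b - wron h M (fst p) ?x)"
          unfolding right_diff_distrib[symmetric] norm_mult norm_of_real ..
        also have "\<dots> \<le> \<bar>C1\<bar> * (C / h * (h / ?x) ^ Suc M)"
          using C1[OF E] C(2)[OF E x h \<open>h \<le> ?x\<close>] by (intro mult_mono) auto
        also have "\<dots> = norm (of_real (\<bar>C1\<bar> * C) * (of_real (h powr (-1)) * ratio h p ^ Suc M))"
          using C(1) h x unfolding ratio_def norm_mult norm_power norm_of_real by (simp add: powr_minus_divide)
        finally show "norm (of_real (fst p powr (-1/4)) * wron h M (fst p) b - of_real (fst p powr (-1/4)) * wron h M (fst p) ?x)
            \<le> norm (of_real (\<bar>C1\<bar> * C) * (of_real (h powr (-1)) * ratio h p ^ Suc M))" .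
      qed
    qed
  qed
  from bigo_on_add[OF 1 2] show ?thesis
    by (rule bigo_on_cong) (use nwron_eq[of M] in eventually_elim, simp)
qed

lemma exists_wkb_order: "\<exists>M\<ge>1. N \<le> real (Suc M) \<and> N \<le> \<kappa> / 4 * real (Suc M) - 1"
proof -
  define M where "M = nat \<lceil>\<bar>N\<bar> + (\<bar>N\<bar> + 1) * 4 / \<kappa>\<rceil> + 1"
  have 1: "\<bar>N\<bar> + (\<bar>N\<bar> + 1) * 4 / \<kappa> \<le> real (Suc M)" unfolding M_def by linarith
  have 2: "0 \<le> (\<bar>N\<bar> + 1) * 4 / \<kappa>" using kappa by simp
  have "(\<bar>N\<bar> + 1) * 4 / \<kappa> \<le> real (Suc M)" using 1 by linarith
  then have "\<bar>N\<bar> + 1 \<le> \<kappa> / 4 * real (Suc M)" using kappa(1) by (simp add: field_simps)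
  moreover have "M \<ge> 1" by (simp add: M_def)
  ultimately show ?thesis using 1 2 by (intro exI[of _ M]) linarith
qed

text \<open>\<open>jost\<close> involves neither the WKB order nor \<open>n\<close>. The order can
  therefore be chosen anew for each precision, and the averaging still concerns one and the same
  function.\<close>

lemma approx_jost: "approx powB PK jost"
proof (rule approx_averaging, rule approx_limit)
  fix N
  obtain M where M: "M \<ge> 1" "N \<le> real (Suc M)" "N \<le> \<kappa> / 4 * real (Suc M) - 1" using exists_wkb_order by blast
  show "\<exists>G. approx mixB Pmix G \<and> bigo_on Pmix N (\<lambda>h p. jost h (fst p) - G h p)"
    using approx_nwron jost_nwron[OF M] by blast
qed

lemma bigo_jost: "bigo_on PK (\<kappa> / 4) (\<lambda>h E. jost h E - 1)"
proof (rule bigo_averaging)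
  obtain M where M: "M \<ge> 1" "\<kappa> / 4 \<le> real (Suc M)" "\<kappa> / 4 \<le> \<kappa> / 4 * real (Suc M) - 1" using exists_wkb_order by blast
  from bigo_on_add[OF jost_nwron[OF M] bigo_nwron[of M]] show "bigo_on Pmix (\<kappa> / 4) (\<lambda>h p. jost h (fst p) - 1)" by simp
qed

text \<open>Since \<open>jost\<close> tends to 1 uniformly on \<open>K\<close>, the branch cut of
  the logarithm is out of reach for small \<open>h\<close>.\<close>

definition "Theta h E = Im (Ln (jost h E))"

lemma holomorphic_Ln_one_plus: "(\<lambda>z. Ln (1 + z)) holomorphic_on ball 0 1"
proof (intro holomorphic_intros)
  fix z :: complex assume "z \<in> ball 0 1"
  then have "\<bar>Re z\<bar> < 1" using abs_Re_le_cmod[of z] by (simp del: abs_Re_le_cmod)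
  then show "1 + z \<notin> \<real>\<^sub>\<le>\<^sub>0" by (auto simp: complex_nonpos_Reals_iff)
qed

lemma approx_Ln_jost: "approx powB PK (\<lambda>h E. Ln (jost h E))"
proof -
  have "approx powB PK (\<lambda>h E. Ln (1 + (jost h E - 1)))"
    by (rule approx_compose[OF gauge_pow _ bigo_jost _ holomorphic_Ln_one_plus])
      (use kappa in \<open>auto intro!: approx_diff[OF gauge_pow] approx_jost approx_const[OF gauge_pow]\<close>)
  then show ?thesis by simp
qed

lemma bigo_Ln_jost: "bigo_on PK (\<kappa> / 4) (\<lambda>h E. Ln (jost h E))"
proof -
  have "bigo_on PK (\<kappa> / 4) (\<lambda>h E. Ln (1 + (jost h E - 1)) - Ln (1 + 0))"
    by (rule bigo_on_compose[OF bigo_jost _ holomorphic_Ln_one_plus]) (use kappa in auto)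
  then show ?thesis by simp
qed

text \<open>With \<open>S\<close> the action divided by \<open>h\<close>, the imaginary part of
  \<open>jost * exp (\<i> * S)\<close> is a positive multiple of \<open>Re eta * sol b\<close>,
  because \<open>sol\<close> and \<open>dsol\<close> are real. For small \<open>h\<close>,
  \<open>Re eta\<close> is close to the momentum at \<open>b\<close> and hence positive, so
  \<open>sol\<close> vanishes at \<open>b\<close> exactly when \<open>sin (S + Theta)\<close>
  does.\<close>

lemma quantization:
  "\<forall>\<^sub>F h in at_right 0. \<forall>E\<in>K. dirichlet_eigenvalue V b h E \<longleftrightarrow>
     (\<exists>k::int. 1 / h * integral {0..b} (\<lambda>y. sqrt (E - V y)) + Theta h E = of_int k * pi)"
proof -
  have eta1: "bigo_on PK 1 (\<lambda>h E. eta h E - of_real (mom E b))"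
  proof (rule bigo_on_cong)
    show "bigo_on PK 1 (\<lambda>h E. eta h E - (\<Sum>n<1. of_real (h ^ n) * boundary_coeff n E))"
      using eta[of 1] by simp
    have "boundary_coeff 0 E = of_real (mom E b)" if "E \<in> K" for E
      using wkb_0[OF that, of b] b_pos by (simp add: boundary_coeff_def)
    then show "\<forall>\<^sub>F h in at_right 0. \<forall>E\<in>K. eta h E - (\<Sum>n<1. of_real (h ^ n) * boundary_coeff n E) = eta h E - of_real (mom E b)"
      by (intro always_eventually) simp
  qed
  have "\<forall>\<^sub>F h in at_right 0. \<forall>E\<in>K. norm (eta h E - of_real (mom E b)) \<le> sqrt \<delta>\<^sub>0 / 2"
    by (rule bigo_on_small[OF eta1]) (use delta_pos in auto)
  moreover have "\<forall>\<^sub>F h in at_right 0. \<forall>E\<in>K. norm (jost h E - 1) \<le> 1 / 2"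
    by (rule bigo_on_small[OF bigo_jost]) (use kappa in auto)
  ultimately show ?thesis using eventually_small[OF zero_less_one]
  proof eventually_elim
    case (elim h)
    show ?case
    proof
      fix E assume E: "E \<in> K"
      have h: "h > 0" using elim by simp
      have bb: "b \<in> {0..b}" using b_pos by simp
      define S where "S = action E b / h"
      define a where "a = E powr (-1/4) * ev Ka E b"
      have a: "a > 0" using gap_pos[OF E bb] E_pos[OF E] by (simp add: a_def)
      have m: "mom E b \<ge> sqrt \<delta>\<^sub>0" using gap[OF E bb] by (simp add: mom_def)
      have sd: "sqrt \<delta>\<^sub>0 > 0" using delta_pos by simp
      have "\<bar>Re (eta h E - of_real (mom E b))\<bar> \<le> sqrt \<delta>\<^sub>0 / 2" 
        using elim(1) E abs_Re_le_cmod order_trans by blast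
      then have "\<bar>Re (eta h E) - mom E b\<bar> \<le> sqrt \<delta>\<^sub>0 / 2" by simp
      then have eta_pos: "Re (eta h E) > 0" using m sd by linarith
      have g0: "jost h E \<noteq> 0" using elim(2) E by force
      have "jost h E = of_real (norm (jost h E)) * exp (\<i> * of_real (Theta h E))"
      proof -
        have "jost h E = exp (Ln (jost h E))" using g0 by simp
        also have "Ln (jost h E) = of_real (Re (Ln (jost h E))) + \<i> * of_real (Im (Ln (jost h E)))" by (rule complex_eq)
        also have "exp \<dots> = of_real (exp (Re (Ln (jost h E)))) * exp (\<i> * of_real (Im (Ln (jost h E))))"
          by (simp add: exp_add exp_of_real)
        also have "exp (Re (Ln (jost h E))) = norm (jost h E)" using g0 by (simp add: exp_Ln flip: norm_exp_eq_Re)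
        finally show ?thesis by (simp add: Theta_def)
      qed
      then have 1: "jost h E * exp (\<i> * of_real S) = of_real (norm (jost h E)) * exp (\<i> * of_real (S + Theta h E))"
        by (simp add: distrib_left exp_add)
      have 2: "jost h E * exp (\<i> * of_real S) = of_real a * (of_real (dsol h E b) + \<i> * eta h E * of_real (sol h E b))"
      proof -
        have "exp (- \<i> * of_real S) * exp (\<i> * of_real S) = 1" by (simp flip: exp_add)
        then show ?thesis unfolding jost_def S_def[symmetric] a_def by (simp add: mult_ac)
      qed
      have "norm (jost h E) * sin (S + Theta h E) = a * (Re (eta h E) * sol h E b)"
        using arg_cong[OF 1[unfolded 2], of Im] by (simp add: Im_exp)
      then have "sol h E b = 0 \<longleftrightarrow> sin (S + Theta h E) = 0"
        using a eta_pos g0 by (metis less_irrefl mult_eq_0_iff norm_eq_zero)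
      moreover have "S = 1 / h * integral {0..b} (\<lambda>y. sqrt (E - V y))"
        by (simp add: S_def action_def mom_def[abs_def])
      ultimately show "dirichlet_eigenvalue V b h E \<longleftrightarrow>
         (\<exists>k::int. 1 / h * integral {0..b} (\<lambda>y. sqrt (E - V y)) + Theta h E = of_int k * pi)"
        unfolding dirichlet_iff_sol[OF E h] by (simp add: sin_zero_iff_int2)
    qed
  qed
qed

section \<open>From approximants of each order to a single asymptotic series\<close>

definition idx :: "real \<Rightarrow> (nat \<times> nat) set" where
  "idx N = {p. real (fst p) * \<gamma> + real (snd p) < N}"

lemma idx_subset: "idx N \<subseteq> insert (0, 0) (expansion_indices \<gamma> N)"
  by (auto simp: idx_def expansion_indices_def)

lemma finite_idx: "finite (idx N)"
  by (rule finite_subset[OF idx_subset]) (simp add: finite_expansion_indices[OF gamma_pos])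

text \<open>If the first indices differed, equality of the exponents would express
  \<open>\<gamma>\<close> as a quotient of integers. The uniqueness of coefficients rests on
  this.\<close>

lemma inj_on_exponent: "inj_on (\<lambda>p. real (fst p) * \<gamma> + real (snd p)) A"
proof (rule inj_onI)
  fix p q :: "nat \<times> nat"
  assume eq: "real (fst p) * \<gamma> + real (snd p) = real (fst q) * \<gamma> + real (snd q)"
  have "fst p = fst q"
  proof (rule ccontr)
    assume "fst p \<noteq> fst q"
    then have "\<gamma> = of_int (int (snd q) - int (snd p)) / of_int (int (fst p) - int (fst q))"
      using eq by (simp add: field_simps)
    also have "\<dots> \<in> \<rat>" by (intro Rats_divide Rats_of_int)
    finally show False using gamma_irrat by blast
  qed
  then show "p = q" using eq by (simp add: prod_eq_iff)
qed

text \<open>Terms with equal indices are merged into one coefficient. The family is total, with 0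
  outside the finite set, so that sums over different sets of indices can be compared.\<close>

lemma lin_powB_sum:
  assumes "g \<in> lin powB"
  shows "\<exists>I c. finite I \<and> (\<forall>p. bounded (c p ` K)) \<and> (\<forall>p. p \<notin> I \<longrightarrow> c p = (\<lambda>E. 0)) \<and>
    (\<forall>h E. g h E = (\<Sum>p\<in>I. c p E * of_real (h powr (real (fst p) * \<gamma> + real (snd p)))))"
  using assms
proof (induction g rule: lin.induct)
  case lin_zero
  show ?case by (intro exI[of _ "{}"] exI[of _ "\<lambda>p E. 0"]) (auto intro: bounded_const)
next
  case (lin_plus f g)
  from lin_plus.IH obtain I c where I: "finite I" and c: "\<forall>p. bounded (c p ` K)" "\<forall>p. p \<notin> I \<longrightarrow> c p = (\<lambda>E. 0)"
    and g: "\<forall>h E. g h E = (\<Sum>p\<in>I. c p E * of_real (h powr (real (fst p) * \<gamma> + real (snd p))))"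
    by (elim exE conjE) (rule that)
  obtain d m n where f: "f = (\<lambda>h E. d E * of_real (h powr (real m * \<gamma> + real n)))" and d: "bounded (d ` K)"
    using lin_plus(1) unfolding powB_def by blast
  define c' where "c' = (\<lambda>p E. c p E + (if p = (m, n) then d E else 0))"
  have bd: "bounded (c' p ` K)" for p
  proof (cases "p = (m, n)")
    case True
    obtain A B where "\<And>E. E \<in> K \<Longrightarrow> norm (c p E) \<le> A" "\<And>E. E \<in> K \<Longrightarrow> norm (d E) \<le> B"
      using c(1) d unfolding bounded_iff by (metis imageI)
    then have "norm (c' p E) \<le> A + B" if "E \<in> K" for E
      using that True norm_triangle_mono by (fastforce simp: c'_def)
    then show ?thesis unfolding bounded_iff by blast
  next
    case False
    then show ?thesis using c(1)[rule_format, of p] by (simp add: c'_def)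
  qed
  have "f h E + g h E = (\<Sum>p\<in>insert (m, n) I. c' p E * of_real (h powr (real (fst p) * \<gamma> + real (snd p))))" for h E
  proof -
    have "g h E = (\<Sum>p\<in>insert (m, n) I. c p E * of_real (h powr (real (fst p) * \<gamma> + real (snd p))))"
      unfolding g[rule_format] by (rule sum.mono_neutral_left) (use I c(2) in auto)
    moreover have "f h E = (\<Sum>p\<in>insert (m, n) I. (if p = (m, n) then d E else 0) * of_real (h powr (real (fst p) * \<gamma> + real (snd p))))"
    proof -
      have "(\<Sum>p\<in>insert (m, n) I. (if p = (m, n) then d E else 0) * complex_of_real (h powr (real (fst p) * \<gamma> + real (snd p))))
        = (\<Sum>p\<in>insert (m, n) I. if p = (m, n) then d E * of_real (h powr (real m * \<gamma> + real n)) else 0)"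
        by (rule sum.cong) auto
      also have "\<dots> = d E * of_real (h powr (real m * \<gamma> + real n))"
        using I by (subst sum.delta) auto
      finally show ?thesis by (simp add: f)
    qed
    ultimately show ?thesis unfolding c'_def distrib_right sum.distrib by simp
  qed
  then have sum: "\<forall>h E. f h E + g h E = (\<Sum>p\<in>insert (m, n) I. c' p E * of_real (h powr (real (fst p) * \<gamma> + real (snd p))))"
    by blast
  have "\<forall>p. p \<notin> insert (m, n) I \<longrightarrow> c' p = (\<lambda>E. 0)" using c(2) by (simp add: c'_def)
  with sum bd I show ?case
    by (intro exI[of _ "insert (m, n) I"] exI[of _ c'] conjI finite.insertI allI) blast+
qed

abbreviation "psum N c h E \<equiv> (\<Sum>p\<in>idx N. c p E * complex_of_real (h powr (real (fst p) * \<gamma> + real (snd p))))"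

lemma bigo_on_term:
  assumes "bounded (c ` K)" "r \<le> s"
  shows "bigo_on PK r (\<lambda>h E. c E * of_real (h powr s))"
  using bigo_on_mono[OF bigo_on_mult[OF bigo_on_coeff_K[OF assms(1)] bigo_on_h_powr[of _ s]], of r] assms(2) by simp

lemma approx_psum:
  assumes "approx powB PK F"
  shows "\<exists>c. (\<forall>p. bounded (c p ` K)) \<and> bigo_on PK N (\<lambda>h E. F h E - psum N c h E)"
proof -
  obtain g where g: "g \<in> lin powB" "bigo_on PK N (\<lambda>h E. F h E - g h E)" using assms unfolding approx_def by blast
  obtain I c where I: "finite I" and c: "\<forall>p. bounded (c p ` K)" "\<forall>p. p \<notin> I \<longrightarrow> c p = (\<lambda>E. 0)"
    and gs: "\<forall>h E. g h E = (\<Sum>p\<in>I. c p E * of_real (h powr (real (fst p) * \<gamma> + real (snd p))))"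
    using lin_powB_sum[OF g(1)] by (elim exE conjE) (rule that)
  have "g h E = psum N c h E + (\<Sum>p\<in>I - idx N. c p E * complex_of_real (h powr (real (fst p) * \<gamma> + real (snd p))))" for h E
  proof -
    have "(\<Sum>p\<in>I. c p E * of_real (h powr (real (fst p) * \<gamma> + real (snd p)))) = (\<Sum>p\<in>I \<union> idx N. c p E * complex_of_real (h powr (real (fst p) * \<gamma> + real (snd p))))"
      by (rule sum.mono_neutral_left) (use I finite_idx c(2) in auto)
    also have "I \<union> idx N = idx N \<union> (I - idx N)" by auto
    finally show ?thesis unfolding gs[rule_format] using I finite_idx by (subst sum.union_disjoint[symmetric]) auto
  qed
  then have eq: "F h E - psum N c h E = (F h E - g h E) + (\<Sum>p\<in>I - idx N. c p E * complex_of_real (h powr (real (fst p) * \<gamma> + real (snd p))))" for h E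
    by simp
  have "bigo_on PK N (\<lambda>h E. \<Sum>p\<in>I - idx N. c p E * complex_of_real (h powr (real (fst p) * \<gamma> + real (snd p))))"
    by (intro bigo_on_sum bigo_on_term) (use I c in \<open>auto simp: idx_def\<close>)
  from bigo_on_add[OF g(2) this] have "bigo_on PK N (\<lambda>h E. F h E - psum N c h E)" unfolding eq .
  then show ?thesis using c(1) by blast
qed

lemma psum_truncate:
  assumes "\<forall>p. bounded (c p ` K)" "bigo_on PK N (\<lambda>h E. F h E - psum N c h E)" "N' \<le> N"
  shows "bigo_on PK N' (\<lambda>h E. F h E - psum N' c h E)"
proof -
  have sub: "idx N' \<subseteq> idx N" using assms(3) by (auto simp: idx_def)
  have eq: "F h E - psum N' c h E = (F h E - psum N c h E) + (\<Sum>p\<in>idx N - idx N'. c p E * complex_of_real (h powr (real (fst p) * \<gamma> + real (snd p))))" for h E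
    using sum.subset_diff[OF sub finite_idx, of "\<lambda>p. c p E * complex_of_real (h powr (real (fst p) * \<gamma> + real (snd p)))"] by simp
  have "bigo_on PK N' (\<lambda>h E. \<Sum>p\<in>idx N - idx N'. c p E * complex_of_real (h powr (real (fst p) * \<gamma> + real (snd p))))"
    by (intro bigo_on_sum bigo_on_term) (use assms(1) finite_idx in \<open>auto simp: idx_def\<close>)
  from bigo_on_add[OF bigo_on_mono[OF assms(2,3)] this] show ?thesis unfolding eq .
qed

lemma psum_unique:
  assumes "bigo_on PK N (\<lambda>h E. F h E - psum N c h E)" "bigo_on PK N (\<lambda>h E. F h E - psum N d h E)"
    and "p \<in> idx N" "E \<in> K"
  shows "c p E = d p E"
proof -
  have "bigo_on PK N (\<lambda>h E. (F h E - psum N d h E) - (F h E - psum N c h E))"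
    by (rule bigo_on_diff[OF assms(2,1)])
  also have "(\<lambda>h E. (F h E - psum N d h E) - (F h E - psum N c h E)) = (\<lambda>h E. psum N (\<lambda>p E. c p E - d p E) h E)"
    by (simp add: left_diff_distrib sum_subtractf)
  finally obtain C where C: "\<forall>\<^sub>F h in at_right 0. \<forall>E\<in>K. norm (psum N (\<lambda>p E. c p E - d p E) h E) \<le> C * h powr N"
    by (auto simp: bigo_on_def)
  have "c p E - d p E = 0"
  proof (rule eq_zero_if_powr_sum_small[OF finite_idx inj_on_exponent _ _ assms(3)])
    show "\<And>i. i \<in> idx N \<Longrightarrow> real (fst i) * \<gamma> + real (snd i) < N" by (simp add: idx_def)
    show "\<forall>\<^sub>F h in at_right 0. norm (\<Sum>i\<in>idx N. (c i E - d i E) * of_real (h powr (real (fst i) * \<gamma> + real (snd i)))) \<le> C * h powr N"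
      using C by eventually_elim (use assms(4) in blast)
  qed
  then show ?thesis by simp
qed

text \<open>\<open>approx\<close> permits unrelated approximants for different orders. Uniqueness
  makes their coefficients agree wherever both truncations contain the index, so they fit together
  to one series.\<close>

lemma expansion_exists:
  assumes F: "approx powB PK F" and small: "bigo_on PK r F" "r > 0"
  shows "\<exists>\<theta>. has_expansion \<gamma> K (\<lambda>h E. Im (F h E)) \<theta>"
proof -
  have "\<exists>c. \<forall>N::nat. (\<forall>p. bounded (c N p ` K)) \<and> bigo_on PK (real N) (\<lambda>h E. F h E - psum (real N) (c N) h E)"
    by (rule choice, rule allI, rule approx_psum[OF F])
  then obtain c where c: "\<And>N. \<forall>p. bounded (c N p ` K)"
    "\<And>N::nat. bigo_on PK (real N) (\<lambda>h E. F h E - psum (real N) (c N) h E)" by blast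
  \<comment> \<open>An order whose truncation already contains \<open>p\<close>; the coefficient
    taken there is valid for every truncation containing \<open>p\<close>.\<close>
  define Np where "Np = (\<lambda>p. nat \<lceil>real (fst p) * \<gamma> + real (snd p)\<rceil> + 1)"
  have Np: "p \<in> idx (real (Np p))" for p unfolding idx_def Np_def mem_Collect_eq by linarith
  have same: "c N p E = c (Np p) p E" if p: "p \<in> idx (real N)" and E: "E \<in> K" for N p E
  proof (rule psum_unique[where N = "min (real N) (real (Np p))" and F = F and c = "c N" and d = "c (Np p)" and p = p])
    show "bigo_on PK (min (real N) (real (Np p))) (\<lambda>h E. F h E - psum (min (real N) (real (Np p))) (c N) h E)"
      by (rule psum_truncate[OF c(1,2)]) simp
    show "bigo_on PK (min (real N) (real (Np p))) (\<lambda>h E. F h E - psum (min (real N) (real (Np p))) (c (Np p)) h E)"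
      by (rule psum_truncate[OF c(1,2)]) simp
    show "p \<in> idx (min (real N) (real (Np p)))" using p Np[of p] by (simp add: idx_def)
  qed (rule E)
  \<comment> \<open>As \<open>F\<close> has the positive order \<open>r\<close>, the zero family is
    a valid expansion up to that order, and uniqueness then removes the constant term. The minimum
    with 1 keeps the comparison within the precision of \<open>c 1\<close>.\<close>
  have c0: "c 1 (0, 0) E = 0" if E: "E \<in> K" for E
  proof (rule psum_unique[where N = "min (min r 1) 1" and F = F and c = "c 1" and d = "\<lambda>p E. 0" and p = "(0, 0)"])
    show "bigo_on PK (min (min r 1) 1) (\<lambda>h E. F h E - psum (min (min r 1) 1) (c 1) h E)"
      by (rule psum_truncate[OF c(1) c(2)[of 1]]) simp
    show "bigo_on PK (min (min r 1) 1) (\<lambda>h E. F h E - psum (min (min r 1) 1) (\<lambda>p E. 0) h E)"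
      using bigo_on_mono[OF small(1), of "min (min r 1) 1"] by simp
    show "(0, 0) \<in> idx (min (min r 1) 1)" using small(2) by (simp add: idx_def)
  qed (rule E)
  define \<theta> where "\<theta> = (\<lambda>m n E. Im (c (Np (m, n)) (m, n) E))"
  have "has_expansion \<gamma> K (\<lambda>h E. Im (F h E)) \<theta>"
    unfolding has_expansion_def
  proof (intro allI impI)
    fix N :: real assume "0 \<le> N"
    define M where "M = nat \<lceil>N\<rceil> + 1"
    have M: "N \<le> real M" unfolding M_def by linarith
    obtain C where C: "\<forall>\<^sub>F h in at_right 0. \<forall>E\<in>K. norm (F h E - psum N (c M) h E) \<le> C * h powr N"
      using psum_truncate[OF c(1) c(2)[of M] M] by (auto simp: bigo_on_def)
    then obtain h0 where h0: "h0 > 0" "\<And>h E. 0 < h \<Longrightarrow> h < h0 \<Longrightarrow> E \<in> K \<Longrightarrow> norm (F h E - psum N (c M) h E) \<le> C * h powr N"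
      unfolding eventually_at_right_field by blast
    have "\<bar>Im (F h E) - (\<Sum>(m, n)\<in>expansion_indices \<gamma> N. h powr (real m * \<gamma> + real n) * \<theta> m n E)\<bar> \<le> C * h powr N"
      if E: "E \<in> K" and h: "0 < h" "h < h0" for E h
    proof -
      have Ms: "c M p E = c (Np p) p E" if "p \<in> idx N" for p
        by (rule same[OF _ E]) (use that M in \<open>auto simp: idx_def\<close>)
      have z: "c M (0, 0) E = 0"
      proof -
        have M1: "(0, 0) \<in> idx (real M)" "(0, 0) \<in> idx (real 1)" by (auto simp: idx_def M_def)
        show ?thesis using same[OF M1(1) E] same[OF M1(2) E] c0[OF E] by simp
      qed
      have "Im (psum N (c M) h E) = (\<Sum>p\<in>idx N. Im (c M p E) * h powr (real (fst p) * \<gamma> + real (snd p)))"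
        by simp
      also have "\<dots> = (\<Sum>p\<in>expansion_indices \<gamma> N. Im (c M p E) * h powr (real (fst p) * \<gamma> + real (snd p)))"
      proof (rule sum.mono_neutral_right[OF finite_idx])
        show "expansion_indices \<gamma> N \<subseteq> idx N" by (auto simp: idx_def expansion_indices_def)
        show "\<forall>p\<in>idx N - expansion_indices \<gamma> N. Im (c M p E) * h powr (real (fst p) * \<gamma> + real (snd p)) = 0"
          using idx_subset[of N] z by auto
      qed
      also have "\<dots> = (\<Sum>(m, n)\<in>expansion_indices \<gamma> N. h powr (real m * \<gamma> + real n) * \<theta> m n E)"
      proof (rule sum.cong[OF refl])
        fix p assume "p \<in> expansion_indices \<gamma> N"
        then have "p \<in> idx N" by (auto simp: idx_def expansion_indices_def)
        then show "Im (c M p E) * h powr (real (fst p) * \<gamma> + real (snd p)) = (case p of (m, n) \<Rightarrow> h powr (real m * \<gamma> + real n) * \<theta> m n E)"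
          using Ms[of p] by (simp add: \<theta>_def split: prod.splits)
      qed
      finally have "Im (F h E) - (\<Sum>(m, n)\<in>expansion_indices \<gamma> N. h powr (real m * \<gamma> + real n) * \<theta> m n E) = Im (F h E - psum N (c M) h E)"
        by simp
      then show ?thesis using abs_Im_le_cmod[of "F h E - psum N (c M) h E"] h0(2)[OF h E] by linarith
    qed
    then show "\<exists>C. \<exists>h\<^sub>N>0. \<forall>E\<in>K. \<forall>h. 0 < h \<and> h < h\<^sub>N \<longrightarrow>
       \<bar>Im (F h E) - (\<Sum>(m, n)\<in>expansion_indices \<gamma> N. h powr (real m * \<gamma> + real n) * \<theta> m n E)\<bar> \<le> C * h powr N"
      using h0(1) by blast
  qed
  then show ?thesis by blast
qed

lemma bohr_sommerfeld_rule:
  "\<exists>\<Theta> \<theta>. has_expansion \<gamma> K \<Theta> \<theta> \<and>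
     (\<exists>h\<^sub>0>0. \<forall>h. 0 < h \<and> h < h\<^sub>0 \<longrightarrow>
        (\<forall>E\<in>K. dirichlet_eigenvalue V b h E \<longleftrightarrow>
           (\<exists>k::int. 1 / h * integral {0..b} (\<lambda>y. sqrt (E - V y)) + \<Theta> h E = of_int k * pi)))"
proof -
  obtain \<theta> where "has_expansion \<gamma> K (\<lambda>h E. Im (Ln (jost h E))) \<theta>"
    using expansion_exists[OF approx_Ln_jost bigo_Ln_jost] kappa by auto
  then have "has_expansion \<gamma> K Theta \<theta>" by (simp add: Theta_def[abs_def])
  moreover obtain h0 where "h0 > 0" "\<And>h. 0 < h \<Longrightarrow> h < h0 \<Longrightarrow> \<forall>E\<in>K. dirichlet_eigenvalue V b h E \<longleftrightarrow>
     (\<exists>k::int. 1 / h * integral {0..b} (\<lambda>y. sqrt (E - V y)) + Theta h E = of_int k * pi)"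
    using quantization unfolding eventually_at_right_field by blast
  ultimately show ?thesis by blast
qed

end

theorem mainTheorem2:
  fixes \<gamma> b \<delta>\<^sub>0 :: real and V W :: "real \<Rightarrow> real" and K :: "real set"
  assumes "\<gamma> > 0" and "\<gamma> \<notin> \<rat>" and "b > 0"
    and "continuous_on {0..b} V"
    and "smooth_on {0<..b} V"
    and "mono_on {0<..b} V"
    and "V 0 = 0"
    and "\<And>x. x \<in> {0<..b} \<Longrightarrow> V x = x powr \<gamma> * W x"
    and "smooth_on {0..b} W"
    and "\<And>x. x \<in> {0..b} \<Longrightarrow> W x > 0"
    and "compact K" and "is_interval K" and "K \<subseteq> {0<..}"
    and "\<delta>\<^sub>0 > 0"
    and "\<And>E x. E \<in> K \<Longrightarrow> x \<in> {0..b} \<Longrightarrow> E - V x \<ge> \<delta>\<^sub>0"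
  shows "\<exists>(\<Theta> :: real \<Rightarrow> real \<Rightarrow> real) (\<theta> :: nat \<Rightarrow> nat \<Rightarrow> real \<Rightarrow> real).
           has_expansion \<gamma> K \<Theta> \<theta> \<and>
           (\<exists>h\<^sub>0>0. \<forall>h. 0 < h \<and> h < h\<^sub>0 \<longrightarrow>
              (\<forall>E\<in>K. dirichlet_eigenvalue V b h E \<longleftrightarrow>
                 (\<exists>k::int. 1 / h * integral {0..b} (\<lambda>y. sqrt (E - V y)) + \<Theta> h E = of_int k * pi)))"
proof -
  obtain D where D: "\<And>x. x \<in> {0..b} \<Longrightarrow> D 0 x = W x"
    "\<And>n x. x \<in> {0..b} \<Longrightarrow> (D n has_real_derivative D (Suc n) x) (at x within {0..b})"
    using assms(9) unfolding smooth_on_def by blast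
  interpret bohr_sommerfeld \<gamma> b \<delta>\<^sub>0 V D K
  proof
    fix x assume x: "x \<in> {0..b}"
    \<comment> \<open>For \<open>x = 0\<close> the identity holds through
      \<open>0 powr \<gamma> = 0\<close>, which matches \<open>V 0 = 0\<close>.\<close>
    show "V x = x powr \<gamma> * D 0 x"
      using assms(7) assms(8)[of x] D(1)[OF x] x by (cases "x = 0") auto
  qed (use assms D compact_imp_bounded in auto)
  show ?thesis by (rule bohr_sommerfeld_rule)
qed

end
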